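(* Let $H$ be a separable Hilbert space, let $T>0$, and let $A$ and $\widetilde A$ generate $C_0$-semigroups $S=(S(t))_{t\ge 0}$ and $\widetilde S=(\widetilde S(t))_{t\ge 0}$ on $H$. Let $L_t=bt+W_t+Z_t$ be an $H$-valued Lévy process, where $b\in H$, $W$ is a $Q$-Wiener process ($Q$ a non-negative trace-class operator on $H$) and $Z$ is the jump part, independent of $W$. Suppose that (1) the Gaussian Ornstein--Uhlenbeck laws satisfy $\mathcal L(Y_A(W))\ll\mathcal L(Y_{\widetilde A}(W))$ on $D([0,T];H)$; (2) there exists a $\sigma(Z)$-measurable random variable $U:\Omega\to L^2(0,T;H)$, independent of $W$, such that almost surely, for all $0\le t\le T$, $$\int_0^t (S-\widetilde S)(t-s)\,dZ_s+\int_0^t (S-\widetilde S)(t-s)b\,ds=\int_0^t\widetilde S(t-s)Q^{1/2}U_s\,ds .$$ Then $\mathcal L(X^A)\ll\mathcal L(X^{\widetilde A})$ on $D([0,T];H)$. If moreover the two Gaussian laws are equivalent, i.e. $\mathcal L(Y_A(W))\sim\mathcal L(Y_{\widetilde A}(W))$ on $D([0,T];H)$, then $\mathcal L(X^A)\sim\mathcal L(X^{\widetilde A})$ on $D([0,T];H)$.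
   Context: $D([0,T];H)$ is the space of càdlàg functions $[0,T]\to H$ with the Skorohod $J_1$ topology; its Borel $\sigma$-algebra is generated by the point evaluations. $\mathcal L(\cdot)$ denotes the law of a random element; $\ll$ is absolute continuity and $\sim$ is mutual absolute continuity of measures. The decomposition $L_t=bt+W_t+Z_t$ is the Lévy--Itô decomposition of $L$, with $Z$ the (compensated small jumps plus large jumps) jump part. For a generator $B$ of a $C_0$-semigroup $S_B$ on $H$, put, for $0\le t\le T$, $$Y_B(W)(t)=\int_0^t S_B(t-s)\,dW_s,\qquad J_B(Z)(t)=\int_0^t S_B(t-s)\,dZ_s,\qquad X^B(t)=\int_0^t S_B(t-s)\,dL_s=Y_B(W)(t)+J_B(Z)(t)+\int_0^t S_B(t-s)b\,ds .$$ The processes $Y_B(W)$, $J_B(Z)$ and $X^B$, for $B\in\{A,\widetilde A\}$, are regarded as random elements of $D([0,T];H)$ (i.e. càdlàg versions are used). *)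

theory Defs
  imports "HOL-Probability.Probability"
begin

section \<open>Semigroups and covariance operators\<close>

definition c0_semigroup :: "(real \<Rightarrow> 'h::real_normed_vector \<Rightarrow>\<^sub>L 'h) \<Rightarrow> bool" where
  "c0_semigroup S \<longleftrightarrow>
     S 0 = id_blinfun \<and>
     (\<forall>s\<ge>0. \<forall>t\<ge>0. S (s + t) = S s o\<^sub>L S t) \<and>
     (\<forall>x. ((\<lambda>t. S t x) \<longlongrightarrow> x) (at_right 0))"

text \<open>Unbounded operators are represented by their graphs, so equality of the sets below
  includes equality of the domains.\<close>

definition semigroup_generator ::
  "(real \<Rightarrow> 'h::real_normed_vector \<Rightarrow>\<^sub>L 'h) \<Rightarrow> ('h \<times> 'h) set" where
  "semigroup_generator S = {(x, y). ((\<lambda>h. (S h x - x) /\<^sub>R h) \<longlongrightarrow> y) (at_right 0)}"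

definition generates_c0_semigroup ::
  "('h \<times> 'h) set \<Rightarrow> (real \<Rightarrow> 'h::real_normed_vector \<Rightarrow>\<^sub>L 'h) \<Rightarrow> bool" where
  "generates_c0_semigroup A S \<longleftrightarrow> c0_semigroup S \<and> A = semigroup_generator S"

definition nonneg_operator :: "('h::real_inner \<Rightarrow>\<^sub>L 'h) \<Rightarrow> bool" where
  "nonneg_operator Q \<longleftrightarrow> (\<forall>x y. Q x \<bullet> y = x \<bullet> Q y) \<and> (\<forall>x. Q x \<bullet> x \<ge> 0)"

definition orthonormal_basis :: "'h::real_inner set \<Rightarrow> bool" where
  "orthonormal_basis E \<longleftrightarrow>
     pairwise orthogonal E \<and> (\<forall>e\<in>E. norm e = 1) \<and> closure (span E) = UNIV"

text \<open>A non-negative operator is trace class iff its trace is finite; the trace does not depend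
  on the orthonormal basis.\<close>

definition nonneg_trace_class :: "('h::real_inner \<Rightarrow>\<^sub>L 'h) \<Rightarrow> bool" where
  "nonneg_trace_class Q \<longleftrightarrow>
     nonneg_operator Q \<and> (\<exists>E. orthonormal_basis E \<and> (\<lambda>e. Q e \<bullet> e) summable_on E)"

text \<open>On a Hilbert space, a non-negative operator has exactly one non-negative square root.\<close>

definition operator_sqrt :: "('h::real_inner \<Rightarrow>\<^sub>L 'h) \<Rightarrow> 'h \<Rightarrow>\<^sub>L 'h" where
  "operator_sqrt Q = (THE R. nonneg_operator R \<and> R o\<^sub>L R = Q)"

section \<open>The Skorohod space\<close>

text \<open>Functions on an index set \<open>I\<close> are extensional, i.e. \<open>undefined\<close> outside \<open>I\<close>.\<close>

definition skorohod_space :: "real \<Rightarrow> (real \<Rightarrow> 'h::topological_space) set" where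
  "skorohod_space T = {f \<in> extensional {0..T}.
     (\<forall>t\<in>{0..<T}. (f \<longlongrightarrow> f t) (at_right t)) \<and>
     (\<forall>t\<in>{0<..T}. \<exists>l. (f \<longlongrightarrow> l) (at_left t))}"

definition time_change :: "real \<Rightarrow> (real \<Rightarrow> real) \<Rightarrow> bool" where
  "time_change T l \<longleftrightarrow>
     strict_mono_on {0..T} l \<and> continuous_on {0..T} l \<and> l ` {0..T} = {0..T}"

definition skorohod_ball ::
  "real \<Rightarrow> (real \<Rightarrow> 'h::metric_space) \<Rightarrow> real \<Rightarrow> (real \<Rightarrow> 'h) set" where
  "skorohod_ball T x e = {y \<in> skorohod_space T. \<exists>l. time_change T l \<and>
     (\<forall>t\<in>{0..T}. \<bar>l t - t\<bar> < e \<and> dist (x t) (y (l t)) < e)}"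

text \<open>The \<open>J\<^sub>1\<close> topology.\<close>

definition skorohod_topology :: "real \<Rightarrow> (real \<Rightarrow> 'h::metric_space) topology" where
  "skorohod_topology T = topology (\<lambda>G. G \<subseteq> skorohod_space T \<and>
     (\<forall>x\<in>G. \<exists>e>0. skorohod_ball T x e \<subseteq> G))"

lemma skorohod_ball_mono: "d \<le> e \<Longrightarrow> skorohod_ball T x d \<subseteq> skorohod_ball T x e"
  unfolding skorohod_ball_def by (auto intro: less_le_trans)

lemma openin_skorohod_topology:
  fixes G :: "(real \<Rightarrow> 'h::metric_space) set"
  shows "openin (skorohod_topology T) G \<longleftrightarrow>
     G \<subseteq> skorohod_space T \<and> (\<forall>x\<in>G. \<exists>e>0. skorohod_ball T x e \<subseteq> G)"
proof -
  have "istopology (\<lambda>G :: (real \<Rightarrow> 'h) set. G \<subseteq> skorohod_space T \<and> (\<forall>x\<in>G. \<exists>e>0. skorohod_ball T x e \<subseteq> G))"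
    unfolding istopology_def
  proof (intro conjI allI impI)
    fix G H :: "(real \<Rightarrow> 'h) set"
    assume G: "G \<subseteq> skorohod_space T \<and> (\<forall>x\<in>G. \<exists>e>0. skorohod_ball T x e \<subseteq> G)"
      and H: "H \<subseteq> skorohod_space T \<and> (\<forall>x\<in>H. \<exists>e>0. skorohod_ball T x e \<subseteq> H)"
    show "G \<inter> H \<subseteq> skorohod_space T" using G by blast
    show "\<forall>x\<in>G \<inter> H. \<exists>e>0. skorohod_ball T x e \<subseteq> G \<inter> H"
    proof
      fix x assume "x \<in> G \<inter> H"
      then obtain d e where "d > 0" "skorohod_ball T x d \<subseteq> G" "e > 0" "skorohod_ball T x e \<subseteq> H"
        using G H by blast
      then show "\<exists>e>0. skorohod_ball T x e \<subseteq> G \<inter> H"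
        using skorohod_ball_mono[of "min d e" d T x] skorohod_ball_mono[of "min d e" e T x]
        by (intro exI[of _ "min d e"]) auto
    qed
  next
    fix \<K> :: "(real \<Rightarrow> 'h) set set"
    assume K: "\<forall>G\<in>\<K>. G \<subseteq> skorohod_space T \<and> (\<forall>x\<in>G. \<exists>e>0. skorohod_ball T x e \<subseteq> G)"
    show "\<Union>\<K> \<subseteq> skorohod_space T" using K by blast
    show "\<forall>x\<in>\<Union>\<K>. \<exists>e>0. skorohod_ball T x e \<subseteq> \<Union>\<K>" using K by (meson Union_iff Sup_upper order_trans)
  qed
  then show ?thesis
    unfolding skorohod_topology_def by (simp add: topology_inverse')
qed

definition skorohod_borel :: "real \<Rightarrow> (real \<Rightarrow> 'h::metric_space) measure" where
  "skorohod_borel T = sigma (skorohod_space T) {G. openin (skorohod_topology T) G}"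

section \<open>Processes, \<open>L\<^sup>2\<close> and laws\<close>

text \<open>A process is a map \<open>X t \<omega>\<close> of time and scenario; \<open>sample_path I X\<close> views it as a map from
  scenarios to functions on \<open>I\<close>.\<close>

definition sample_path :: "real set \<Rightarrow> (real \<Rightarrow> 'w \<Rightarrow> 'h) \<Rightarrow> 'w \<Rightarrow> real \<Rightarrow> 'h" where
  "sample_path I X \<omega> = (\<lambda>t\<in>I. X t \<omega>)"

abbreviation path_measure :: "(real \<Rightarrow> 'h::topological_space) measure" where
  "path_measure \<equiv> (\<Pi>\<^sub>M t\<in>{0..}. borel)"

definition process_algebra ::
  "'w measure \<Rightarrow> (real \<Rightarrow> 'w \<Rightarrow> 'h::topological_space) \<Rightarrow> 'w measure" where
  "process_algebra M Z = vimage_algebra (space M) (sample_path {0..} Z) path_measure"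

definition skorohod_law ::
  "'w measure \<Rightarrow> real \<Rightarrow> (real \<Rightarrow> 'w \<Rightarrow> 'h::metric_space) \<Rightarrow> (real \<Rightarrow> 'h) measure" where
  "skorohod_law M T X = distr M (skorohod_borel T) (sample_path {0..T} X)"

definition mutually_absolutely_continuous :: "'a measure \<Rightarrow> 'a measure \<Rightarrow> bool" where
  "mutually_absolutely_continuous \<mu> \<nu> \<longleftrightarrow>
     absolutely_continuous \<mu> \<nu> \<and> absolutely_continuous \<nu> \<mu>"

text \<open>Elements of \<open>L\<^sup>2(0,T;H)\<close> are represented by square-integrable functions, equipped with the
  \<open>L\<^sup>2\<close> pseudometric instead of passing to classes modulo a.e. equality. Every open set is a union
  of such classes, so measurability into the Borel sets below is measurability into the quotient.\<close>

definition L2_space ::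
  "real \<Rightarrow> (real \<Rightarrow> 'h::{real_inner, banach, second_countable_topology}) set" where
  "L2_space T = {u. set_borel_measurable lborel {0..T} u \<and>
     set_integrable lborel {0..T} (\<lambda>s. (norm (u s))\<^sup>2)}"

definition L2_dist ::
  "real \<Rightarrow> (real \<Rightarrow> 'h::{real_inner, banach, second_countable_topology}) \<Rightarrow> (real \<Rightarrow> 'h) \<Rightarrow> real"
  where "L2_dist T u v = sqrt (LINT s:{0..T}|lborel. (norm (u s - v s))\<^sup>2)"

definition L2_borel ::
  "real \<Rightarrow> (real \<Rightarrow> 'h::{real_inner, banach, second_countable_topology}) measure" where
  "L2_borel T = sigma (L2_space T) {G. G \<subseteq> L2_space T \<and>
     (\<forall>u\<in>G. \<exists>e>0. \<forall>v\<in>L2_space T. L2_dist T u v < e \<longrightarrow> v \<in> G)}"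

section \<open>Levy processes\<close>

definition cadlag_process ::
  "'w measure \<Rightarrow> (real \<Rightarrow> 'w \<Rightarrow> 'h::topological_space) \<Rightarrow> bool" where
  "cadlag_process M X \<longleftrightarrow>
     (\<forall>t\<ge>0. X t \<in> borel_measurable M) \<and>
     (\<forall>\<omega>\<in>space M.
        (\<forall>t\<ge>0. ((\<lambda>r. X r \<omega>) \<longlongrightarrow> X t \<omega>) (at_right t)) \<and>
        (\<forall>t>0. \<exists>l. ((\<lambda>r. X r \<omega>) \<longlongrightarrow> l) (at_left t)))"

definition independent_increments ::
  "'w measure \<Rightarrow> (real \<Rightarrow> 'w \<Rightarrow> 'h::{real_normed_vector, second_countable_topology}) \<Rightarrow> bool" where
  "independent_increments M X \<longleftrightarrow>
     (\<forall>(n::nat) \<tau>. 0 \<le> \<tau> 0 \<and> (\<forall>i<n. \<tau> i \<le> \<tau> (Suc i)) \<longrightarrow>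
        prob_space.indep_vars M (\<lambda>_. borel) (\<lambda>i \<omega>. X (\<tau> (Suc i)) \<omega> - X (\<tau> i) \<omega>) {..<n})"

text \<open>Stochastic continuity follows from right-continuity and stationarity of the increments.\<close>

definition levy_process ::
  "'w measure \<Rightarrow> (real \<Rightarrow> 'w \<Rightarrow> 'h::{real_normed_vector, second_countable_topology}) \<Rightarrow> bool" where
  "levy_process M L \<longleftrightarrow>
     cadlag_process M L \<and>
     (AE \<omega> in M. L 0 \<omega> = 0) \<and>
     independent_increments M L \<and>
     (\<forall>s\<ge>0. \<forall>h\<ge>0. distr M borel (\<lambda>\<omega>. L (s + h) \<omega> - L s \<omega>) = distr M borel (L h))"

definition normal_law :: "real \<Rightarrow> real \<Rightarrow> real measure" where
  "normal_law m v =
     (if v = 0 then return borel m else density lborel (\<lambda>x. ennreal (normal_density m (sqrt v) x)))"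

definition wiener_process ::
  "'w measure \<Rightarrow> ('h::{real_inner, second_countable_topology} \<Rightarrow>\<^sub>L 'h) \<Rightarrow> (real \<Rightarrow> 'w \<Rightarrow> 'h) \<Rightarrow> bool"
  where
  "wiener_process M Q W \<longleftrightarrow>
     (\<forall>t\<ge>0. W t \<in> borel_measurable M) \<and>
     (\<forall>\<omega>\<in>space M. continuous_on {0..} (\<lambda>t. W t \<omega>)) \<and>
     (AE \<omega> in M. W 0 \<omega> = 0) \<and>
     independent_increments M W \<and>
     (\<forall>s\<ge>0. \<forall>t\<ge>s. \<forall>x. distr M borel (\<lambda>\<omega>. x \<bullet> (W t \<omega> - W s \<omega>)) =
        normal_law 0 ((t - s) * (Q x \<bullet> x)))"

definition jump :: "(real \<Rightarrow> 'h::real_normed_vector) \<Rightarrow> real \<Rightarrow> 'h" where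
  "jump f s = f s - Lim (at_left s) f"

definition jump_sum ::
  "(real \<Rightarrow> 'w \<Rightarrow> 'h::real_normed_vector) \<Rightarrow> real set \<Rightarrow> real \<Rightarrow> 'w \<Rightarrow> 'h" where
  "jump_sum L R t \<omega> =
     (\<Sum>s\<in>{s\<in>{0<..t}. norm (jump (\<lambda>r. L r \<omega>) s) \<in> R}. jump (\<lambda>r. L r \<omega>) s)"

text \<open>Jumps of norm greater than 1 are not compensated; those of norm in \<open>(\<epsilon>, 1]\<close> are compensated
  by their mean, which is \<open>t\<close> times the integral of \<open>x\<close> over \<open>\<epsilon> < norm x \<le> 1\<close> with respect to
  the Levy measure of \<open>L\<close>.\<close>

definition truncated_jump_part ::
  "'w measure \<Rightarrow> (real \<Rightarrow> 'w \<Rightarrow> 'h::{real_inner, banach, second_countable_topology}) \<Rightarrow>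
     real \<Rightarrow> real \<Rightarrow> 'w \<Rightarrow> 'h" where
  "truncated_jump_part M L \<epsilon> t \<omega> =
     jump_sum L {1<..} t \<omega> +
     (jump_sum L {\<epsilon><..1} t \<omega> - (\<integral>\<omega>'. jump_sum L {\<epsilon><..1} t \<omega>' \<partial>M))"

text \<open>Convergence in probability at each time determines the cadlag process \<open>Z\<close> up to
  indistinguishability.\<close>

definition jump_part_of ::
  "'w measure \<Rightarrow> (real \<Rightarrow> 'w \<Rightarrow> 'h::{real_inner, banach, second_countable_topology}) \<Rightarrow>
     (real \<Rightarrow> 'w \<Rightarrow> 'h) \<Rightarrow> bool" where
  "jump_part_of M L Z \<longleftrightarrow>
     cadlag_process M Z \<and>
     (\<forall>t\<ge>0. \<forall>\<delta>>0.
        ((\<lambda>\<epsilon>. measure M {\<omega>\<in>space M. norm (truncated_jump_part M L \<epsilon> t \<omega> - Z t \<omega>) > \<delta>})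
           \<longlongrightarrow> 0) (at_right 0))"

definition levy_ito_decomposition ::
  "'w measure \<Rightarrow> (real \<Rightarrow> 'w \<Rightarrow> 'h::{real_inner, banach, second_countable_topology}) \<Rightarrow>
     'h \<Rightarrow> ('h \<Rightarrow>\<^sub>L 'h) \<Rightarrow> (real \<Rightarrow> 'w \<Rightarrow> 'h) \<Rightarrow> (real \<Rightarrow> 'w \<Rightarrow> 'h) \<Rightarrow> bool" where
  "levy_ito_decomposition M L b Q W Z \<longleftrightarrow>
     levy_process M L \<and>
     nonneg_trace_class Q \<and>
     wiener_process M Q W \<and>
     jump_part_of M L Z \<and>
     prob_space.indep_var M path_measure (sample_path {0..} W) path_measure (sample_path {0..} Z) \<and>
     (AE \<omega> in M. \<forall>t\<ge>0. L t \<omega> = t *\<^sub>R b + W t \<omega> + Z t \<omega>)"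

section \<open>Stochastic convolutions\<close>

definition partition_of :: "real \<Rightarrow> real \<Rightarrow> nat \<Rightarrow> (nat \<Rightarrow> real) \<Rightarrow> bool" where
  "partition_of t \<delta> n \<tau> \<longleftrightarrow>
     \<tau> 0 = 0 \<and> \<tau> n = t \<and> (\<forall>i<n. \<tau> i \<le> \<tau> (Suc i) \<and> \<tau> (Suc i) - \<tau> i < \<delta>)"

text \<open>The integral of a deterministic operator-valued function \<open>\<Phi>\<close> over \<open>(0, t]\<close> with respect to
  \<open>L\<close>, as the limit in probability of Riemann-Stieltjes sums when the mesh tends to 0. For
  strongly continuous \<open>\<Phi>\<close> and a Levy process \<open>L\<close> the limit exists, without any moment
  assumption on \<open>L\<close>, and agrees with the integral obtained from Ito's isometry and the
  pathwise sum over the large jumps.\<close>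

definition has_stochastic_integral ::
  "'w measure \<Rightarrow> (real \<Rightarrow> 'h::real_normed_vector \<Rightarrow>\<^sub>L 'h) \<Rightarrow> (real \<Rightarrow> 'w \<Rightarrow> 'h) \<Rightarrow> real \<Rightarrow>
     ('w \<Rightarrow> 'h) \<Rightarrow> bool" where
  "has_stochastic_integral M \<Phi> L t I \<longleftrightarrow>
     I \<in> borel_measurable M \<and>
     (\<forall>\<epsilon>>0. \<exists>\<delta>>0. \<forall>n \<tau>. partition_of t \<delta> n \<tau> \<longrightarrow>
        measure M {\<omega>\<in>space M.
          norm ((\<Sum>i<n. \<Phi> (\<tau> i) (L (\<tau> (Suc i)) \<omega> - L (\<tau> i) \<omega>)) - I \<omega>) > \<epsilon>} < \<epsilon>)"

text \<open>\<open>X\<close> is a cadlag version of the process \<open>t \<mapsto> \<integral>\<^sub>0\<^sup>t S(t - s) dL\<^sub>s\<close> on \<open>[0, T]\<close>.\<close>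

definition cadlag_convolution ::
  "'w measure \<Rightarrow> real \<Rightarrow> (real \<Rightarrow> 'h::real_normed_vector \<Rightarrow>\<^sub>L 'h) \<Rightarrow> (real \<Rightarrow> 'w \<Rightarrow> 'h) \<Rightarrow>
     (real \<Rightarrow> 'w \<Rightarrow> 'h) \<Rightarrow> bool" where
  "cadlag_convolution M T S L X \<longleftrightarrow>
     sample_path {0..T} X \<in> measurable M (skorohod_borel T) \<and>
     (\<forall>t\<in>{0..T}. has_stochastic_integral M (\<lambda>s. S (t - s)) L t (X t))"

end

theory Submission
  imports Defs
begin

text \<open>
  Put \<open>D(u)(t) = \<integral>\<^sub>0\<^sup>t S'(t - s) Q\<^sup>1\<^sup>/\<^sup>2 u\<^sub>s ds\<close> and \<open>V = X' - Y'\<close>. The assumption on \<open>U\<close> says that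
  \<open>X = Y + V + D(U)\<close> almost surely, where \<open>(V, D(U))\<close> is a function of the jump part and hence
  independent of \<open>(Y, Y')\<close>. Conditionally on the jump part, \<open>V = v\<close> and \<open>D(U) = D(u)\<close> are fixed, and the
  law of \<open>Y + v + D(u)\<close> is absolutely continuous with respect to the law of \<open>Y' + v + D(u)\<close>, which is
  equivalent to the law of \<open>Y' + v\<close> by the Cameron-Martin theorem for \<open>W\<close>.

  The Cameron-Martin theorem needs no stochastic integral here: for every finite-dimensional
  projection, the law \<open>\<nu>\<close> of \<open>W\<close> and the law \<open>\<mu>\<close> of \<open>W\<close> shifted by \<open>\<integral>\<^sub>0\<^sup>t Q\<^sup>1\<^sup>/\<^sup>2 u\<^sub>s ds\<close> satisfy
  \<open>2 \<mu>(A) \<le> r \<nu>(A) + e\<^sup>C / r\<close> for all \<open>r > 0\<close>, where \<open>C\<close> is the squared \<open>L\<^sup>2\<close> norm of \<open>u\<close>. The constant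
  does not depend on the projection, so the bound survives the passage to all Borel sets.

  Since the Borel sets of the Skorohod space are generated by evaluations at dyadic times, all laws
  can be compared on a countable grid.\<close>

section \<open>Semigroups\<close>

text \<open>A stochastic convolution is only a limit in probability, so freezing the jumps has no
  meaning for it directly. Along a subsequence of dyadic partitions chosen for each grid time, the
  Riemann sums converge almost surely, and their limit is a Borel function of the values of the
  driving path on the grid. Feeding the shifted noise into the same function gives the shifted
  convolution, because for the shift itself the Riemann sums converge to the deterministic
  convolution.

  The bound is 2 f \<le> r + f^2 / r for the density f of a projection of \<mu> with respect to that
  of \<nu>. The integral of f^2 is e^s, where s is the squared Cameron-Martin norm of the projected
  shift, and s \<le> C for every projection. A \<nu>-null set then has \<mu>-measure at most e^C /
  (2 r) for all r. Densities are thus compared on the real line alone, and degenerate covariances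
  are harmless.\<close>

lemma uniform_boundedness:
  fixes A :: "nat \<Rightarrow> 'a::banach \<Rightarrow>\<^sub>L 'b::real_normed_vector"
  assumes bd: "\<And>x. bounded (range (\<lambda>n. A n x))"
  shows "\<exists>C. \<forall>n. norm (A n) \<le> C"
proof -
  \<comment> \<open>By Baire some \<open>E m\<close> contains a ball. Every vector of norm
    \<open>e\<close>, the radius of that ball, is a difference of two of its points, which costs the
    factor 2 in the final bound.\<close>
  define E where "E m = {x. \<forall>n. norm (A n x) \<le> real m}" for m :: nat
  have clE: "closed (E m)" for m
  proof -
    have "E m = (\<Inter>n. {x. norm (A n x) \<le> real m})" unfolding E_def by auto
    moreover have "closed {x. norm (A n x) \<le> real m}" for n
      by (intro closed_Collect_le continuous_intros)
    ultimately show ?thesis by auto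
  qed
  have UnE: "(\<Union>m. E m) = UNIV"
  proof -
    have "x \<in> (\<Union>m. E m)" for x
    proof -
      obtain B where "\<And>n. norm (A n x) \<le> B" using bd[of x] unfolding bounded_iff by blast
      moreover obtain m :: nat where "B \<le> real m" using real_arch_simple by blast
      ultimately show ?thesis unfolding E_def using order_trans by blast
    qed
    then show ?thesis by blast
  qed
  have "\<exists>m. interior (E m) \<noteq> {}"
  proof (rule ccontr)
    assume "\<not> ?thesis"
    then have "(euclidean :: 'a topology) interior_of \<Union>(range E) = {}"
      using clE
      by (intro Baire_category_alt) (auto simp: completely_metrizable_space_euclidean)
    then show False using UnE by simp
  qed
  then obtain m x0 where "x0 \<in> interior (E m)" by blast
  then obtain e where e: "e > 0" "cball x0 e \<subseteq> E m" by (auto simp: mem_interior_cball)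
  have "norm (A n) \<le> 2 * real m / e" for n
  proof (rule norm_blinfun_bound)
    show "0 \<le> 2 * real m / e" using e by simp
    fix y
    show "norm (A n y) \<le> 2 * real m / e * norm y"
    proof (cases "y = 0")
      case False
      define z where "z = (e / norm y) *\<^sub>R y"
      have "norm z = e" using False e unfolding z_def by simp
      then have "x0 + z \<in> E m" "x0 \<in> E m" using e by (auto simp: subset_iff dist_norm)
      then have "norm (A n (x0 + z)) \<le> real m" "norm (A n x0) \<le> real m" unfolding E_def by auto
      then have "norm (A n z) \<le> 2 * real m"
        using norm_triangle_ineq4[of "A n (x0 + z)" "A n x0"] by (simp add: blinfun.add_right)
      moreover have "norm (A n z) = e / norm y * norm (A n y)"
        unfolding z_def using e by (simp add: blinfun.scaleR_right)
      ultimately show ?thesis using e False by (simp add: field_simps)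
    qed simp
  qed
  then show ?thesis by blast
qed

lemma c0_semigroup_right_continuous:
  assumes S: "c0_semigroup S" and t: "0 \<le> t"
  shows "((\<lambda>s. S s x) \<longlongrightarrow> S t x) (at_right t)"
proof -
  have "((\<lambda>h. S h (S t x)) \<longlongrightarrow> S t x) (at_right 0)"
    using S unfolding c0_semigroup_def by blast
  moreover have "\<forall>\<^sub>F h in at_right 0. S h (S t x) = S (h + t) x"
    unfolding eventually_at_right_field
    using S t unfolding c0_semigroup_def by (intro exI[of _ 1]) auto
  ultimately have "((\<lambda>h. S (h + t) x) \<longlongrightarrow> S t x) (at_right 0)"
    using tendsto_cong by force
  then show ?thesis by (subst filterlim_at_right_to_0)
qed

text \<open>Strong continuity controls orbits, not operator norms. If the norms were unbounded near
  0, they would explode along some positive times tending to 0 although every orbit converges along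
  them, against uniform boundedness. The semigroup law then carries the local bound \<open>C\<close>
  to \<open>C ^ k\<close> over \<open>k\<close> steps.\<close>

lemma c0_semigroup_bounded:
  fixes S :: "real \<Rightarrow> 'h::banach \<Rightarrow>\<^sub>L 'h"
  assumes S: "c0_semigroup S"
  shows "\<exists>C. \<forall>t\<in>{0..T}. norm (S t) \<le> C"
proof -
  have S0: "S 0 = id_blinfun" and Sadd: "\<And>s t. s \<ge> 0 \<Longrightarrow> t \<ge> 0 \<Longrightarrow> S (s + t) = S s o\<^sub>L S t"
    using S unfolding c0_semigroup_def by auto
  have "\<exists>n. \<forall>t\<in>{0..1 / real (Suc n)}. norm (S t) \<le> real (Suc n)"
  proof (rule ccontr)
    assume "\<not> ?thesis"
    then have "\<forall>n. \<exists>t. t \<in> {0..1 / real (Suc n)} \<and> norm (S t) > real (Suc n)" by force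
    then obtain \<tau> where \<tau>: "\<And>n. \<tau> n \<in> {0..1 / real (Suc n)}" "\<And>n. norm (S (\<tau> n)) > real (Suc n)"
      by metis
    \<comment> \<open>Orbits are only known to converge from the right of 0, so the times must avoid
      0 itself; there the norm is at most 1.\<close>
    have "\<tau> n \<noteq> 0" for n
    proof
      assume "\<tau> n = 0"
      then have "norm (id_blinfun :: 'h \<Rightarrow>\<^sub>L 'h) > real (Suc n)" using \<tau>(2)[of n] S0 by simp
      then show False using norm_blinfun_id_le[where 'a='h] by simp
    qed
    moreover have "\<tau> n \<ge> 0" for n using \<tau>(1)[of n] by simp
    ultimately have pos: "\<tau> n > 0" for n by (metis less_eq_real_def)
    have "\<tau> \<longlonglongrightarrow> 0"
      by (rule tendsto_sandwich[OF _ _ tendsto_const LIMSEQ_Suc[OF lim_1_over_n]])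
        (use \<tau>(1) in auto)
    then have lim: "filterlim \<tau> (at_right 0) sequentially"
      using pos by (auto simp: filterlim_at less_imp_neq[symmetric])
    have "bounded (range (\<lambda>n. S (\<tau> n) x))" for x
    proof -
      have "((\<lambda>t. S t x) \<longlongrightarrow> x) (at_right 0)" using S unfolding c0_semigroup_def by blast
      from filterlim_compose[OF this lim] show ?thesis by (rule convergent_imp_bounded)
    qed
    then obtain C where C: "\<And>n. norm (S (\<tau> n)) \<le> C"
      using uniform_boundedness[of "\<lambda>n. S (\<tau> n)"] by blast
    obtain n :: nat where "C \<le> real n" using real_arch_simple by blast
    with C[of n] \<tau>(2)[of n] show False by simp
  qed
  then obtain n where n: "\<And>t. t \<in> {0..1 / real (Suc n)} \<Longrightarrow> norm (S t) \<le> real (Suc n)" by blast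
  define d where "d = 1 / real (Suc n)"
  define C where "C = real (Suc n)"
  have d: "d > 0" and C: "C \<ge> 1" unfolding d_def C_def by auto
  have loc: "norm (S t) \<le> C" if "0 \<le> t" "t \<le> d" for t
    using n[of t] that unfolding d_def C_def by auto
  have step: "\<forall>t\<in>{0..real k * d}. norm (S t) \<le> C ^ k" for k
  proof (induction k)
    case 0
    show ?case using S0 norm_blinfun_id_le[where 'a='h] by auto
  next
    case (Suc k)
    show ?case
    proof
      fix t assume t: "t \<in> {0..real (Suc k) * d}"
      show "norm (S t) \<le> C ^ Suc k"
      proof (cases "t \<le> d")
        case True
        then show ?thesis using loc[of t] t C
          by (simp add: order_trans[OF _ self_le_power[of C "Suc k"]] del: power_Suc)
      next
        case False
        then have "S t = S d o\<^sub>L S (t - d)" using Sadd[of d "t - d"] d by simp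
        then have "norm (S t) \<le> norm (S d) * norm (S (t - d))"
          by (simp add: norm_blinfun_compose)
        also have "\<dots> \<le> C * C ^ k"
        proof (rule mult_mono)
          have "t - d \<in> {0..real k * d}" using t False by (auto simp: algebra_simps)
          then show "norm (S (t - d)) \<le> C ^ k" using Suc by blast
        qed (use loc[of d] d C in auto)
        finally show ?thesis by simp
      qed
    qed
  qed
  obtain k :: nat where "T / d \<le> real k" using real_arch_simple by blast
  then have "T \<le> real k * d" using d by (simp add: field_simps)
  then have "\<forall>t\<in>{0..T}. norm (S t) \<le> C ^ k" using step[of k] by auto
  then show ?thesis by blast
qed

section \<open>Square roots of non-negative operators\<close>

text \<open>Source of every Cauchy-Schwarz inequality below: the polynomial is a squared norm or a
  quadratic form along a line, as a function of \<open>r\<close>. The forms may be degenerate, hence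
  the case of a vanishing leading coefficient.\<close>

lemma quadratic_nonneg_imp_discriminant:
  fixes a b c :: real
  assumes "\<And>r. 0 \<le> a * r\<^sup>2 + 2 * b * r + c"
  shows "b\<^sup>2 \<le> a * c"
proof (cases "a = 0")
  case True
  have "b = 0"
  proof (rule ccontr)
    assume "b \<noteq> 0"
    then show False using assms[of "- (c + 1) / (2 * b)"] True by simp
  qed
  then show ?thesis using True by simp
next
  case False
  have "a > 0"
  proof (rule ccontr)
    assume "\<not> a > 0"
    then have a: "a < 0" using False by simp
    \<comment> \<open>Adding the values at \<open>r\<close> and \<open>- r\<close> cancels the
      linear term. A number that is at least 1 does not exceed its square, which turns the remaining
      estimate into a linear one.\<close>
    have "0 \<le> a * r\<^sup>2 + c" for r using assms[of r] assms[of "- r"] by simp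
    from this[of "1 + \<bar>c\<bar> / (- a)"] a
    have "0 \<le> a * (1 + \<bar>c\<bar> / (- a))\<^sup>2 + c" by simp
    moreover have "(1 + \<bar>c\<bar> / (- a)) \<le> (1 + \<bar>c\<bar> / (- a))\<^sup>2"
      using a by (intro self_le_power) (auto intro: divide_nonneg_neg divide_nonpos_neg)
    then have "a * (1 + \<bar>c\<bar> / (- a))\<^sup>2 \<le> a * (1 + \<bar>c\<bar> / (- a))"
      using a by (intro mult_left_mono_neg) auto
    moreover have "a * (1 + \<bar>c\<bar> / (- a)) = a - \<bar>c\<bar>" using a by (simp add: field_simps)
    ultimately show False using a by linarith
  qed
  moreover have "0 \<le> a * (- b / a)\<^sup>2 + 2 * b * (- b / a) + c" by (rule assms)
  ultimately show ?thesis by (simp add: field_simps power2_eq_square)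
qed

lemma nonneg_operator_cauchy_schwarz:
  fixes Q :: "'h::real_inner \<Rightarrow>\<^sub>L 'h"
  assumes Q: "nonneg_operator Q"
  shows "(Q x \<bullet> y)\<^sup>2 \<le> (Q x \<bullet> x) * (Q y \<bullet> y)"
proof (rule quadratic_nonneg_imp_discriminant)
  fix r
  have sym: "Q y \<bullet> x = Q x \<bullet> y" using Q unfolding nonneg_operator_def by (metis inner_commute)
  have "0 \<le> Q (r *\<^sub>R x + y) \<bullet> (r *\<^sub>R x + y)" using Q unfolding nonneg_operator_def by blast
  also have "\<dots> = (Q x \<bullet> x) * r\<^sup>2 + 2 * (Q x \<bullet> y) * r + Q y \<bullet> y"
    by (simp add: blinfun.add_right blinfun.scaleR_right inner_add_left inner_add_right sym
        power2_eq_square algebra_simps)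
  finally show "0 \<le> (Q x \<bullet> x) * r\<^sup>2 + 2 * (Q x \<bullet> y) * r + Q y \<bullet> y" .
qed

lemma nonneg_operator_eq_0:
  assumes "nonneg_operator Q" "Q x \<bullet> x = 0"
  shows "Q x = 0"
proof -
  have "(Q x \<bullet> Q x)\<^sup>2 \<le> 0" using nonneg_operator_cauchy_schwarz[OF assms(1), of x "Q x"] assms(2) by simp
  then show ?thesis by simp
qed

text \<open>Cauchy-Schwarz for the form of \<open>A\<close> at the vectors \<open>x\<close> and
  \<open>A x\<close> gives |A x|^4 \<le> |x|^2 |A x|^2, and |A x|^2 cancels.\<close>

lemma norm_nonneg_operator_le_1:
  assumes A: "nonneg_operator A" and le: "\<And>x. A x \<bullet> x \<le> x \<bullet> x"
  shows "norm A \<le> 1"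
proof (rule norm_blinfun_bound)
  fix x
  have "(A x \<bullet> A x)\<^sup>2 \<le> (A x \<bullet> x) * (A (A x) \<bullet> A x)"
    by (rule nonneg_operator_cauchy_schwarz[OF A])
  also have "\<dots> \<le> (x \<bullet> x) * (A x \<bullet> A x)"
    using le[of x] le[of "A x"] A[unfolded nonneg_operator_def, THEN conjunct2]
    by (intro mult_mono) (blast | simp)+
  finally have "(A x \<bullet> A x) * (A x \<bullet> A x) \<le> (x \<bullet> x) * (A x \<bullet> A x)" by (simp add: power2_eq_square)
  then have "A x \<bullet> A x \<le> x \<bullet> x"
    by (metis inner_ge_zero inner_gt_zero_iff inner_zero_left mult_le_cancel_right not_less)
  then show "norm (A x) \<le> 1 * norm x" by (simp add: norm_le)
qed simp

lemma blinfun_compose_eqD: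
  assumes "A o\<^sub>L B = C o\<^sub>L D"
  shows "A (B x) = C (D x)"
  using arg_cong[OF assms, of "\<lambda>F. blinfun_apply F x"] by simp

text \<open>The square root of \<open>I - A\<close> is \<open>I - X\<close> where \<open>X\<close> is the limit of \<open>X\<^sub>n\<^sub>+\<^sub>1 = (A + X\<^sub>n\<^sup>2) / 2\<close>;
  the increments of \<open>X\<^sub>n\<close> are dominated by those of the same iteration started with \<open>A = 1\<close>.\<close>

lemma operator_fixed_point:
  fixes A :: "'h::{real_inner, banach} \<Rightarrow>\<^sub>L 'h"
  assumes sym: "\<And>x y. A x \<bullet> y = x \<bullet> A y" and nA: "norm A \<le> 1"
  shows "\<exists>X :: 'h \<Rightarrow>\<^sub>L 'h. (\<forall>x y. blinfun_apply X x \<bullet> y = x \<bullet> blinfun_apply X y) \<and> norm X \<le> 1 \<and> 2 *\<^sub>R X = A + (X o\<^sub>L X) \<and>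
    (\<forall>B. B o\<^sub>L A = A o\<^sub>L B \<longrightarrow> B o\<^sub>L X = X o\<^sub>L B)"
proof -
  define X where "X n = ((\<lambda>Y. (1/2) *\<^sub>R (A + (Y o\<^sub>L Y))) ^^ n) 0" for n :: nat
  define a where "a n = ((\<lambda>y. (1 + y\<^sup>2) / 2) ^^ n) (0::real)" for n :: nat
  have X0: "X 0 = 0" and XS: "\<And>n. X (Suc n) = (1/2) *\<^sub>R (A + (X n o\<^sub>L X n))"
    unfolding X_def by auto
  have a0: "a 0 = 0" and aS: "\<And>n. a (Suc n) = (1 + (a n)\<^sup>2) / 2"
    unfolding a_def by auto
  have a_range: "0 \<le> a n \<and> a n \<le> 1" for n
  proof (induction n)
    case (Suc n)
    then show ?case using power_le_one[of "a n" 2] by (auto simp: aS)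
  qed (simp add: a0)
  have a_inc: "a n \<le> a (Suc n)" for n
    using zero_le_power2[of "1 - a n"] unfolding aS by (simp add: power2_eq_square algebra_simps)
  have "incseq a" by (rule incseq_SucI) (rule a_inc)
  then have "convergent a"
    using a_range by (intro Bseq_mono_convergent) (auto simp: Bseq_def incseq_def intro!: exI[of _ 1])
  then have Cau_a: "Cauchy a" by (rule convergent_Cauchy)
  have comp_left: "((B::'h \<Rightarrow>\<^sub>L 'h) o\<^sub>L (C + D)) = (B o\<^sub>L C) + (B o\<^sub>L D)"
    "((C + D) o\<^sub>L B) = (C o\<^sub>L B) + (D o\<^sub>L B)"
    "(B o\<^sub>L (r *\<^sub>R C)) = r *\<^sub>R (B o\<^sub>L C)" "((r *\<^sub>R C) o\<^sub>L B) = r *\<^sub>R (C o\<^sub>L B)" for B C D r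
    by (auto intro!: blinfun_eqI simp: blinfun.bilinear_simps)
  have assoc: "(B o\<^sub>L C) o\<^sub>L D = B o\<^sub>L (C o\<^sub>L D)" for B C D :: "'h \<Rightarrow>\<^sub>L 'h"
    by (auto intro!: blinfun_eqI)
  have comm: "B o\<^sub>L X n = X n o\<^sub>L B" if "B o\<^sub>L A = A o\<^sub>L B" for B n
  proof (induction n)
    case (Suc n)
    have "B o\<^sub>L (X n o\<^sub>L X n) = (X n o\<^sub>L B) o\<^sub>L X n" using Suc by (simp flip: assoc)
    also have "\<dots> = (X n o\<^sub>L X n) o\<^sub>L B" using Suc by (simp add: assoc)
    finally have "B o\<^sub>L (X n o\<^sub>L X n) = (X n o\<^sub>L X n) o\<^sub>L B" .
    then show ?case using that by (simp add: XS comp_left)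
  qed (auto simp: X0 intro!: blinfun_eqI)
  have commA: "A o\<^sub>L X n = X n o\<^sub>L A" for n by (rule comm) simp
  have comm2: "X m o\<^sub>L X n = X n o\<^sub>L X m" for m n by (rule comm) (simp add: commA)
  have symX: "X n x \<bullet> y = x \<bullet> X n y" for n x y
  proof (induction n arbitrary: x y)
    case (Suc n)
    then show ?case by (simp add: XS blinfun.bilinear_simps sym inner_add_left inner_add_right)
  qed (simp add: X0)
  have nX: "norm (X n) \<le> a n" for n
  proof (induction n)
    case (Suc n)
    have "norm (X n o\<^sub>L X n) \<le> (a n)\<^sup>2"
      using order_trans[OF norm_blinfun_compose mult_mono[OF Suc Suc]] a_range[of n]
      by (simp add: power2_eq_square)
    then have "norm (A + (X n o\<^sub>L X n)) \<le> 1 + (a n)\<^sup>2"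
      using nA by (intro norm_triangle_le add_mono)
    then show ?case by (simp add: XS aS)
  qed (simp add: X0 a0)
  have inc: "norm (X (Suc n) - X n) \<le> a (Suc n) - a n" for n
  proof (induction n)
    case 0
    show ?case using nA by (simp add: XS X0 aS a0 comp_left)
  next
    case (Suc n)
    let ?D = "X (Suc n) - X n" and ?P = "X (Suc n) + X n"
    have "X (Suc (Suc n)) - X (Suc n) = (1/2) *\<^sub>R ((X (Suc n) o\<^sub>L X (Suc n)) - (X n o\<^sub>L X n))"
      using XS[of "Suc n"] XS[of n] by (simp add: scaleR_diff_right scaleR_add_right)
    \<comment> \<open>The difference of squares factorises because the iterates commute, being
      polynomials in \<open>A\<close>. The scalar iteration factorises in the same way with
      equality, so the domination is inherited.\<close>
    also have "(X (Suc n) o\<^sub>L X (Suc n)) - (X n o\<^sub>L X n) = ?P o\<^sub>L ?D"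
    proof (rule blinfun_eqI)
      fix x
      have "X n (X (Suc n) x) = X (Suc n) (X n x)" using comm2[of n "Suc n"] by (rule blinfun_compose_eqD)
      then show "((X (Suc n) o\<^sub>L X (Suc n)) - (X n o\<^sub>L X n)) x = (?P o\<^sub>L ?D) x"
        by (simp add: blinfun.bilinear_simps)
    qed
    finally have "norm (X (Suc (Suc n)) - X (Suc n)) \<le> 1/2 * (norm ?P * norm ?D)"
      using norm_blinfun_compose[of ?P ?D] by simp
    also have "\<dots> \<le> 1/2 * ((a (Suc n) + a n) * (a (Suc n) - a n))"
    proof -
      have "norm ?P \<le> a (Suc n) + a n" by (rule norm_triangle_le) (intro add_mono nX)
      then show ?thesis using Suc a_range[of n] a_range[of "Suc n"]
        by (intro mult_left_mono mult_mono) auto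
    qed
    also have "\<dots> = a (Suc (Suc n)) - a (Suc n)"
    proof -
      have "a (Suc (Suc n)) = 1 / 2 + a (Suc n) * a (Suc n) / 2"
        by (simp only: aS[of "Suc n"] power2_eq_square add_divide_distrib)
      moreover have "a (Suc n) = 1 / 2 + a n * a n / 2"
        by (simp only: aS power2_eq_square add_divide_distrib)
      then have "1/2 * ((r + a n) * (r - a n)) = r * r / 2 + 1 / 2 - a (Suc n)" for r
        by (simp add: algebra_simps)
      ultimately show ?thesis by simp
    qed
    finally show ?case .
  qed
  have inc2: "norm (X (n + k) - X n) \<le> a (n + k) - a n" for n k
  proof (induction k)
    case (Suc k)
    have "norm (X (n + Suc k) - X n) \<le> norm (X (Suc (n + k)) - X (n + k)) + norm (X (n + k) - X n)"
      using norm_triangle_ineq[of "X (Suc (n + k)) - X (n + k)" "X (n + k) - X n"] by simp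
    then show ?case using Suc inc[of "n + k"] by simp
  qed simp
  have "Cauchy X"
  proof (rule CauchyI)
    fix e :: real assume "e > 0"
    then obtain N where N: "\<And>m n. m \<ge> N \<Longrightarrow> n \<ge> N \<Longrightarrow> norm (a m - a n) < e"
      using Cau_a unfolding Cauchy_iff by blast
    have *: "norm (X m - X n) < e" if "n \<ge> N" "m \<ge> n" for m n
    proof -
      have "norm (X m - X n) \<le> a m - a n" using inc2[of n "m - n"] that by simp
      also have "\<dots> < e" using N[of m n] that by simp
      finally show ?thesis .
    qed
    then show "\<exists>M. \<forall>m\<ge>M. \<forall>n\<ge>M. norm (X m - X n) < e"
      by (intro exI[of _ N]) (metis linear norm_minus_commute)
  qed
  then obtain Y where Y: "X \<longlonglongrightarrow> Y" by (auto simp: Cauchy_convergent_iff convergent_def)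
  have ptw: "(\<lambda>n. X n x) \<longlonglongrightarrow> Y x" for x by (intro tendsto_intros Y)
  have "Y x \<bullet> y = x \<bullet> Y y" for x y
  proof (rule LIMSEQ_unique)
    show "(\<lambda>n. X n x \<bullet> y) \<longlonglongrightarrow> Y x \<bullet> y" by (intro tendsto_intros ptw)
    show "(\<lambda>n. X n x \<bullet> y) \<longlonglongrightarrow> x \<bullet> Y y" unfolding symX by (intro tendsto_intros ptw)
  qed
  moreover have "norm Y \<le> 1"
    by (rule LIMSEQ_le_const2[OF tendsto_norm[OF Y]]) (use nX a_range order_trans in blast)
  moreover have "2 *\<^sub>R Y = A + (Y o\<^sub>L Y)"
  proof (rule LIMSEQ_unique)
    show "(\<lambda>n. 2 *\<^sub>R X (Suc n)) \<longlonglongrightarrow> 2 *\<^sub>R Y" by (intro tendsto_intros LIMSEQ_Suc Y)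
    have "(\<lambda>n. X n o\<^sub>L X n) \<longlonglongrightarrow> (Y o\<^sub>L Y)"
      by (rule bounded_bilinear.tendsto[OF bounded_bilinear_blinfun_compose Y Y])
    then show "(\<lambda>n. 2 *\<^sub>R X (Suc n)) \<longlonglongrightarrow> A + (Y o\<^sub>L Y)" unfolding XS by (auto intro!: tendsto_intros)
  qed
  moreover have "B o\<^sub>L Y = Y o\<^sub>L B" if "B o\<^sub>L A = A o\<^sub>L B" for B
  proof (rule LIMSEQ_unique)
    show "(\<lambda>n. B o\<^sub>L X n) \<longlonglongrightarrow> (B o\<^sub>L Y)"
      by (rule bounded_bilinear.tendsto[OF bounded_bilinear_blinfun_compose tendsto_const Y])
    show "(\<lambda>n. B o\<^sub>L X n) \<longlonglongrightarrow> (Y o\<^sub>L B)" unfolding comm[OF that]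
      by (rule bounded_bilinear.tendsto[OF bounded_bilinear_blinfun_compose Y tendsto_const])
  qed
  ultimately show ?thesis by blast
qed

text \<open>Dividing \<open>Q\<close> by its norm makes A = I - Q / |Q| a non-negative contraction.
  The fixed point equation 2 X = A + X^2 says (I - X)^2 = I - A, so the root is a multiple of I - X.
  The commutation clause is what uniqueness of the root rests on.\<close>

lemma nonneg_operator_has_sqrt:
  fixes Q :: "'h::{real_inner, banach} \<Rightarrow>\<^sub>L 'h"
  assumes Q: "nonneg_operator Q"
  shows "\<exists>R :: 'h \<Rightarrow>\<^sub>L 'h. nonneg_operator R \<and> R o\<^sub>L R = Q \<and> (\<forall>B. B o\<^sub>L Q = Q o\<^sub>L B \<longrightarrow> B o\<^sub>L R = R o\<^sub>L B)"
proof (cases "Q = 0")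
  case True
  then show ?thesis
    by (intro exI[of _ 0]) (auto simp: nonneg_operator_def intro!: blinfun_eqI)
next
  case False
  define k where "k = norm Q"
  have k: "k > 0" using False unfolding k_def by simp
  define A where "A = id_blinfun - (1 / k) *\<^sub>R Q"
  have QA: "Q = k *\<^sub>R (id_blinfun - A)" using k unfolding A_def by simp
  have Qle: "Q x \<bullet> x \<le> k * (x \<bullet> x)" for x
  proof -
    have "Q x \<bullet> x \<le> norm (Q x) * norm x" by (rule norm_cauchy_schwarz)
    also have "\<dots> \<le> (k * norm x) * norm x"
      unfolding k_def by (intro mult_right_mono norm_blinfun) simp
    finally show ?thesis by (simp add: dot_square_norm power2_eq_square)
  qed
  have nA: "nonneg_operator A"
    using Q Qle k unfolding nonneg_operator_def A_def
    by (auto simp: blinfun.bilinear_simps inner_diff_left inner_diff_right field_simps)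
  have "norm A \<le> 1"
  proof (rule norm_nonneg_operator_le_1[OF nA])
    fix x
    show "A x \<bullet> x \<le> x \<bullet> x" using Q k unfolding nonneg_operator_def A_def
      by (auto simp: blinfun.bilinear_simps inner_diff_left inner_diff_right)
  qed
  then obtain X where X: "\<And>x y. blinfun_apply X x \<bullet> y = x \<bullet> blinfun_apply X y" "norm X \<le> 1" "2 *\<^sub>R X = A + (X o\<^sub>L X)"
    "\<And>B. B o\<^sub>L A = A o\<^sub>L B \<Longrightarrow> B o\<^sub>L X = X o\<^sub>L B"
    using operator_fixed_point[of A] nA unfolding nonneg_operator_def by metis
  define R where "R = sqrt k *\<^sub>R (id_blinfun - X)"
  have Xle: "X x \<bullet> x \<le> x \<bullet> x" for x
  proof -
    have "X x \<bullet> x \<le> norm (X x) * norm x" by (rule norm_cauchy_schwarz)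
    also have "\<dots> \<le> (1 * norm x) * norm x"
      using X(2) by (intro mult_right_mono order_trans[OF norm_blinfun]) auto
    finally show ?thesis by (simp add: dot_square_norm power2_eq_square)
  qed
  have "nonneg_operator R"
    using X(1) Xle k unfolding nonneg_operator_def R_def
    by (auto simp: blinfun.bilinear_simps inner_diff_left inner_diff_right)
  moreover have "R o\<^sub>L R = Q"
  proof (rule blinfun_eqI)
    fix x
    have "2 *\<^sub>R X x = A x + X (X x)"
      using arg_cong[OF X(3), of "\<lambda>B. blinfun_apply B x"] by (simp add: blinfun.bilinear_simps)
    then have "x - 2 *\<^sub>R X x + X (X x) = x - A x" by (simp add: algebra_simps)
    moreover have "(R o\<^sub>L R) x = k *\<^sub>R (x - 2 *\<^sub>R X x + X (X x))"
      unfolding R_def using k by (simp add: blinfun.bilinear_simps algebra_simps scaleR_2)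
    moreover have "Q x = k *\<^sub>R (x - A x)" unfolding QA by (simp add: blinfun.bilinear_simps)
    ultimately show "(R o\<^sub>L R) x = Q x" by simp
  qed
  moreover have "B o\<^sub>L R = R o\<^sub>L B" if B: "B o\<^sub>L Q = Q o\<^sub>L B" for B
  proof -
    have BQ: "B (Q x) = Q (B x)" for x using B by (rule blinfun_compose_eqD)
    have "B o\<^sub>L A = A o\<^sub>L B"
      unfolding A_def by (intro blinfun_eqI) (simp add: blinfun.bilinear_simps BQ)
    then have "B o\<^sub>L X = X o\<^sub>L B" by (rule X(4))
    then have "B (X x) = X (B x)" for x by (rule blinfun_compose_eqD)
    then show ?thesis
      unfolding R_def by (intro blinfun_eqI) (simp add: blinfun.bilinear_simps)
  qed
  ultimately show ?thesis by blast
qed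

text \<open>Existence and uniqueness give the \<open>THE\<close> in the definition its meaning.
  Another root \<open>V\<close> commutes with \<open>V\<close> squared, which is \<open>Q\<close>,
  hence with \<open>R\<close>. So V + R annihilates y = V x - R x; both forms are non-negative at y
  and therefore vanish there, whence V y = R y = 0. By symmetry |y|^2 is the inner product of x with
  V y - R y, which is 0.\<close>

lemma operator_sqrt:
  fixes Q :: "'h::{real_inner, banach} \<Rightarrow>\<^sub>L 'h"
  assumes Q: "nonneg_operator Q"
  shows nonneg_operator_operator_sqrt: "nonneg_operator (operator_sqrt Q)"
    and operator_sqrt_compose: "operator_sqrt Q o\<^sub>L operator_sqrt Q = Q"
proof -
  obtain R where R: "nonneg_operator R" "R o\<^sub>L R = Q"
    and comm: "\<And>B. B o\<^sub>L Q = Q o\<^sub>L B \<Longrightarrow> B o\<^sub>L R = R o\<^sub>L B"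
    using nonneg_operator_has_sqrt[OF Q] by blast
  have uniq: "V = R" if V: "nonneg_operator V" "V o\<^sub>L V = Q" for V
  proof (rule blinfun_eqI)
    fix x
    define y where "y = V x - R x"
    have "V o\<^sub>L R = R o\<^sub>L V"
    proof (rule comm)
      show "V o\<^sub>L Q = Q o\<^sub>L V" unfolding V(2)[symmetric] by (rule blinfun_eqI) simp
    qed
    then have VR: "V (R u) = R (V u)" for u by (rule blinfun_compose_eqD)
    have sq: "V (V u) = R (R u)" for u by (rule blinfun_compose_eqD) (simp only: V(2) R(2))
    have symV: "V u \<bullet> v = u \<bullet> V v" and symR: "R u \<bullet> v = u \<bullet> R v" for u v
      using V R unfolding nonneg_operator_def by auto
    have "V y + R y = 0" unfolding y_def by (simp add: blinfun.bilinear_simps VR sq)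
    then have "V y \<bullet> y + R y \<bullet> y = 0" by (simp flip: inner_add_left)
    moreover have "V y \<bullet> y \<ge> 0" "R y \<bullet> y \<ge> 0" using V R unfolding nonneg_operator_def by auto
    ultimately have "V y \<bullet> y = 0" "R y \<bullet> y = 0" by auto
    then have "V y = 0" "R y = 0" using V R nonneg_operator_eq_0 by blast+
    then have "(V x - R x) \<bullet> y = 0"
      using symV[of x y] symR[of x y] by (simp add: inner_diff_left)
    then show "V x = R x" unfolding y_def by simp
  qed
  have "operator_sqrt Q = R"
    unfolding operator_sqrt_def using R uniq by (blast intro: the_equality)
  then show "nonneg_operator (operator_sqrt Q)" "operator_sqrt Q o\<^sub>L operator_sqrt Q = Q"
    using R by auto
qed

section \<open>Borel sets of the Skorohod space\<close>

lemma strict_mono_on_image_endpoints: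
  fixes l :: "real \<Rightarrow> real"
  assumes mono: "strict_mono_on {a..b} l" and im: "l ` {a..b} = {c..d}" and le: "a \<le> b" "c \<le> d"
  shows "l a = c" "l b = d"
proof -
  have "c \<in> l ` {a..b}" "d \<in> l ` {a..b}" unfolding im using le by auto
  then obtain s t where st: "s \<in> {a..b}" "l s = c" "t \<in> {a..b}" "l t = d" by blast
  have "l a \<in> {c..d}" "l b \<in> {c..d}" using im le by auto
  moreover have "l a \<le> l s" "l t \<le> l b"
    using st le by (auto intro!: strict_mono_on_leD[OF mono])
  ultimately show "l a = c" "l b = d" using st by auto
qed

text \<open>A monotone map onto an interval has no jumps, so continuity comes for free. Extending by
  the identity outside the interval makes it a monotone map of the line onto itself.\<close>

lemma time_changeI:
  assumes mono: "strict_mono_on {0..T} l" and im: "l ` {0..T} = {0..T}"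
  shows "time_change T l"
proof -
  define L where "L t = (if t \<in> {0..T} then l t else t)" for t
  have inc: "l t \<in> {0..T}" if "t \<in> {0..T}" for t using im that by blast
  have "mono L"
  proof (rule monoI)
    fix s t :: real assume st: "s \<le> t"
    show "L s \<le> L t"
    proof (cases "s \<in> {0..T} \<and> t \<in> {0..T}")
      case True
      then show ?thesis using strict_mono_on_leD[OF mono, of s t] st by (simp add: L_def)
    next
      case False
      then show ?thesis using inc[of s] inc[of t] st unfolding L_def by auto
    qed
  qed
  moreover have "range L = UNIV"
  proof -
    have "y \<in> range L" for y
    proof (cases "y \<in> {0..T}")
      case True
      then obtain t where "t \<in> {0..T}" "y = l t" using im by blast
      then show ?thesis by (intro image_eqI[of _ _ t]) (auto simp: L_def)
    next
      case False
      then show ?thesis by (intro image_eqI[of _ _ y]) (auto simp: L_def)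
    qed
    then show ?thesis by blast
  qed
  ultimately have "continuous_on UNIV L"
    by (intro continuous_onI_mono) (auto simp: mono_def)
  then have "continuous_on {0..T} L" by (rule continuous_on_subset) simp
  then have "continuous_on {0..T} l" by (rule continuous_on_eq) (simp add: L_def)
  then show ?thesis using mono im unfolding time_change_def by blast
qed

lemma time_change_comp:
  assumes "time_change T l" "time_change T m"
  shows "time_change T (\<lambda>t. m (l t))"
proof (rule time_changeI)
  have inc: "l t \<in> {0..T}" if "t \<in> {0..T}" for t
    using assms(1) that unfolding time_change_def by blast
  show "strict_mono_on {0..T} (\<lambda>t. m (l t))"
    using assms inc unfolding time_change_def strict_mono_on_def by blast
  show "(\<lambda>t. m (l t)) ` {0..T} = {0..T}"
    using assms unfolding time_change_def by (metis image_image)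
qed

lemma time_change_inv_into:
  assumes "time_change T l"
  shows "time_change T (inv_into {0..T} l)"
proof (rule time_changeI)
  have mono: "strict_mono_on {0..T} l" and im: "l ` {0..T} = {0..T}"
    using assms unfolding time_change_def by auto
  have inj: "inj_on l {0..T}" by (rule strict_mono_on_imp_inj_on[OF mono])
  show "inv_into {0..T} l ` {0..T} = {0..T}"
    using inj im by (metis bij_betw_def bij_betw_inv_into)
  show "strict_mono_on {0..T} (inv_into {0..T} l)"
  proof (rule strict_mono_onI)
    fix s t :: real assume st: "s \<in> {0..T}" "t \<in> {0..T}" "s < t"
    then have l: "l (inv_into {0..T} l s) = s" "l (inv_into {0..T} l t) = t"
      using im by (auto intro!: f_inv_into_f)
    have r: "inv_into {0..T} l s \<in> {0..T}" "inv_into {0..T} l t \<in> {0..T}"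
      by (rule inv_into_into, use st im in simp)+
    show "inv_into {0..T} l s < inv_into {0..T} l t"
      using strict_mono_on_leD[OF mono r(2) r(1)] l st by force
  qed
qed

lemma time_change_in: "time_change T l \<Longrightarrow> t \<in> {0..T} \<Longrightarrow> l t \<in> {0..T}"
  unfolding time_change_def by blast

lemma skorohod_ball_sym:
  assumes y: "y \<in> skorohod_ball T x e" and x: "x \<in> skorohod_space T"
  shows "x \<in> skorohod_ball T y e"
proof -
  obtain l where l: "time_change T l"
    and d: "\<And>t. t \<in> {0..T} \<Longrightarrow> \<bar>l t - t\<bar> < e \<and> dist (x t) (y (l t)) < e"
    using y unfolding skorohod_ball_def by blast
  let ?m = "inv_into {0..T} l"
  have "\<bar>?m t - t\<bar> < e \<and> dist (y t) (x (?m t)) < e" if t: "t \<in> {0..T}" for t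
  proof -
    have "t \<in> l ` {0..T}" using l t unfolding time_change_def by blast
    then have "l (?m t) = t" "?m t \<in> {0..T}" by (rule f_inv_into_f inv_into_into; assumption)+
    then show ?thesis using d[of "?m t"] by (simp add: dist_commute abs_minus_commute)
  qed
  then show ?thesis
    using x time_change_inv_into[OF l] unfolding skorohod_ball_def by blast
qed

lemma skorohod_ball_triangle:
  assumes y: "y \<in> skorohod_ball T x d" and z: "z \<in> skorohod_ball T y e"
  shows "z \<in> skorohod_ball T x (d + e)"
proof -
  obtain l where l: "time_change T l"
    and dl: "\<And>t. t \<in> {0..T} \<Longrightarrow> \<bar>l t - t\<bar> < d \<and> dist (x t) (y (l t)) < d"
    using y unfolding skorohod_ball_def by blast
  obtain m where m: "time_change T m"
    and dm: "\<And>t. t \<in> {0..T} \<Longrightarrow> \<bar>m t - t\<bar> < e \<and> dist (y t) (z (m t)) < e"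
    using z unfolding skorohod_ball_def by blast
  have "\<bar>m (l t) - t\<bar> < d + e \<and> dist (x t) (z (m (l t))) < d + e" if t: "t \<in> {0..T}" for t
    using dl[OF t] dm[OF time_change_in[OF l t]] dist_triangle[of "x t" "z (m (l t))" "y (l t)"]
    by linarith
  then show ?thesis
    using z time_change_comp[OF l m] unfolding skorohod_ball_def by blast
qed

section \<open>Dyadic step functions of a cadlag path\<close>

definition dyadic_time :: "real \<Rightarrow> nat \<times> nat \<Rightarrow> real" where
  "dyadic_time T p = min (real (snd p) * T / 2 ^ fst p) T"

lemma dyadic_time_in: "0 \<le> T \<Longrightarrow> dyadic_time T p \<in> {0..T}"
  unfolding dyadic_time_def by auto

text \<open>The values form a point of a countable product rather than a path, so that the step
  function is a continuous image of finitely many coordinates. The index \<open>2 ^ k\<close> is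
  reached at time \<open>T\<close> alone, so the end value of the path is kept.\<close>

definition dyadic_step :: "real \<Rightarrow> nat \<Rightarrow> (nat \<times> nat \<Rightarrow> 'h) \<Rightarrow> real \<Rightarrow> 'h" where
  "dyadic_step T k a = (\<lambda>t\<in>{0..T}. a (k, nat \<lfloor>t * (2 ^ k / T)\<rfloor>))"

lemma eventually_floor_at_right:
  fixes c t :: real
  assumes c: "c > 0"
  shows "\<forall>\<^sub>F s in at_right t. \<lfloor>s * c\<rfloor> = \<lfloor>t * c\<rfloor>"
proof -
  define b where "b = (of_int \<lfloor>t * c\<rfloor> + 1) / c"
  have "t < b" unfolding b_def using c by (simp add: pos_less_divide_eq) 
  moreover have "\<lfloor>s * c\<rfloor> = \<lfloor>t * c\<rfloor>" if "t < s" "s < b" for s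
  proof -
    have "s * c < of_int \<lfloor>t * c\<rfloor> + 1" using that c unfolding b_def by (simp add: pos_less_divide_eq)
    moreover have "t * c \<le> s * c" using that c by simp
    ultimately show ?thesis by linarith
  qed
  ultimately show ?thesis unfolding eventually_at_right_field by blast
qed

text \<open>Ceiling minus one is the left limit of the floor in both cases: at an integer the floor
  jumps, elsewhere it equals the floor itself.\<close>

lemma eventually_floor_at_left:
  fixes c t :: real
  assumes c: "c > 0"
  shows "\<forall>\<^sub>F s in at_left t. \<lfloor>s * c\<rfloor> = \<lceil>t * c\<rceil> - 1"
proof -
  define b where "b = (of_int \<lceil>t * c\<rceil> - 1) / c"
  have "b < t" unfolding b_def using c by (simp add: pos_divide_less_eq) linarith
  moreover have "\<lfloor>s * c\<rfloor> = \<lceil>t * c\<rceil> - 1" if "b < s" "s < t" for s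
  proof -
    have "s * c > of_int \<lceil>t * c\<rceil> - 1" using that c unfolding b_def by (simp add: pos_divide_less_eq)
    moreover have "s * c < t * c" using that c by simp
    ultimately show ?thesis by linarith
  qed
  ultimately show ?thesis unfolding eventually_at_left_field by blast
qed

lemma dyadic_step_in_skorohod_space:
  assumes T: "T > 0"
  shows "dyadic_step T k a \<in> skorohod_space T"
  unfolding skorohod_space_def mem_Collect_eq
proof (intro conjI ballI)
  have c: "2 ^ k / T > 0" using T by simp
  show "dyadic_step T k a \<in> extensional {0..T}" unfolding dyadic_step_def by simp
  fix t
  {
    assume t: "t \<in> {0..<T}"
    have "\<forall>\<^sub>F s in at_right t. s < T" using t unfolding eventually_at_right_field by auto
    then have "\<forall>\<^sub>F s in at_right t. dyadic_step T k a s = dyadic_step T k a t"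
      using eventually_floor_at_right[OF c, of t] eventually_at_right_less[of t]
      by eventually_elim (use t in \<open>auto simp: dyadic_step_def\<close>)
    then show "(dyadic_step T k a \<longlongrightarrow> dyadic_step T k a t) (at_right t)"
      by (rule tendsto_eventually)
  }
  {
    assume t: "t \<in> {0<..T}"
    have "\<forall>\<^sub>F s in at_left t. 0 < s \<and> s < t" using t unfolding eventually_at_left_field by auto
    then have "\<forall>\<^sub>F s in at_left t. dyadic_step T k a s = a (k, nat (\<lceil>t * (2 ^ k / T)\<rceil> - 1))"
      using eventually_floor_at_left[OF c, of t]
      by eventually_elim (use t in \<open>auto simp: dyadic_step_def\<close>)
    then show "\<exists>l. (dyadic_step T k a \<longlongrightarrow> l) (at_left t)"
      using tendsto_eventually by blast
  }
qed

text \<open>The dyadic step functions of a cadlag path converge to it in \<open>J\<^sub>1\<close>: on each interval on which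
  the path oscillates by less than \<open>e\<close>, the time change maps the end points to the next
  dyadic points. Such intervals are glued together by bisection.\<close>

lemma eventually_dyadic_step_in_skorohod_ball:
  fixes x :: "real \<Rightarrow> 'h::metric_space"
  assumes T: "T > 0" and x: "x \<in> skorohod_space T" and e: "e > 0"
  shows "\<forall>\<^sub>F k in sequentially. dyadic_step T k (\<lambda>p. x (dyadic_time T p)) \<in> skorohod_ball T x e"
proof -
  define c where "c k = 2 ^ k / T" for k :: nat
  have c: "c k > 0" for k using T unfolding c_def by simp
  define up where "up k a = of_int \<lceil>a * c k\<rceil> / c k" for k a
  define dn where "dn k a = of_int \<lfloor>a * c k\<rfloor> / c k" for k a
  have up_ge: "a \<le> up k a" and up_less: "up k a < a + 1 / c k" for k a
  proof -
    show "a \<le> up k a" unfolding up_def using c[of k] by (simp add: pos_le_divide_eq)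
    have "of_int \<lceil>a * c k\<rceil> < a * c k + 1" by linarith
    then show "up k a < a + 1 / c k" unfolding up_def using c[of k]
      by (simp add: field_simps)
  qed
  have up_mono: "up k a \<le> up k b" if "a \<le> b" for k a b
    unfolding up_def using c[of k] that by (intro divide_right_mono) (auto intro!: ceiling_mono)
  have c_lim: "\<exists>K. \<forall>k\<ge>K. 1 / c k < d" if "d > 0" for d
  proof -
    have "(\<lambda>k. T * (1 / 2) ^ k) \<longlonglongrightarrow> T * 0" by (intro tendsto_intros LIMSEQ_realpow_zero) auto
    then have "\<forall>\<^sub>F k in sequentially. T * (1 / 2) ^ k < d"
      using that by (auto dest: order_tendstoD(2)[of _ _ _ d])
    then show ?thesis unfolding eventually_sequentially c_def by (simp add: power_one_over)
  qed
  \<comment> \<open>A local form of membership in the ball. The distance clause omits the right end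
    point, since a path that oscillates little before \<open>b\<close> may still jump at
    \<open>b\<close>; the value there belongs to the next interval.\<close>
  define good where "good k a b l \<longleftrightarrow> strict_mono_on {a..b} l \<and> l ` {a..b} = {up k a..up k b} \<and>
     (\<forall>s\<in>{a..b}. \<bar>l s - s\<bar> < e) \<and> (\<forall>s\<in>{a..<b}. dist (x s) (x (dn k (l s))) < e)"
    for k a b and l :: "real \<Rightarrow> real"
  \<comment> \<open>Bisection asks for all short intervals around a point, including those that
    leave the time interval, so \<open>P\<close> is made vacuous for them.\<close>
  define P where "P a b \<longleftrightarrow> (0 \<le> a \<longrightarrow> a \<le> b \<longrightarrow> b \<le> T \<longrightarrow> (\<exists>K. \<forall>k\<ge>K. \<exists>l. good k a b l))" for a b
  have P_refl: "P a a" for a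
  proof -
    obtain K where K: "\<And>k. k \<ge> K \<Longrightarrow> 1 / c k < e" using c_lim[OF e] by blast
    have "good k a a (\<lambda>_. up k a)" if "k \<ge> K" for k
      unfolding good_def using K[OF that] up_ge[of a k] up_less[of k a]
      by (auto simp: strict_mono_on_def)
    then show ?thesis unfolding P_def by blast
  qed
  have P_osc: "P a b" if ab: "a < b" and osc: "\<And>s u. s \<in> {a..<b} \<Longrightarrow> u \<in> {a..<b} \<Longrightarrow> dist (x s) (x u) < e"
    for a b
  proof -
    \<comment> \<open>A mesh below \<open>b - a\<close> separates the images of the two end points,
      so that the affine map between them increases.\<close>
    obtain K where K: "\<And>k. k \<ge> K \<Longrightarrow> 1 / c k < min e (b - a)" using c_lim[of "min e (b - a)"] e ab by auto
    have "\<exists>l. good k a b l" if "k \<ge> K" for k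
    proof -
      have h: "1 / c k < e" "1 / c k < b - a" using K[OF that] by auto
      define r where "r = (up k b - up k a) / (b - a)"
      have "up k a < up k b" using up_less[of k a] up_ge[of b k] h by linarith
      then have r: "r > 0" using ab unfolding r_def by simp
      define l where "l s = up k a + (s - a) * r" for s
      have lb: "l b = up k b" unfolding l_def r_def using ab by simp
      have la: "l a = up k a" unfolding l_def by simp
      have mono: "l s < l t \<longleftrightarrow> s < t" for s t unfolding l_def using r by simp
      have mono': "l s \<le> l t \<longleftrightarrow> s \<le> t" for s t unfolding l_def using r by simp
      have im: "l ` {a..b} = {up k a..up k b}"
      proof (intro equalityI subsetI)
        fix y assume "y \<in> l ` {a..b}"
        then show "y \<in> {up k a..up k b}" unfolding la[symmetric] lb[symmetric] using mono' by auto
      next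
        fix y assume y: "y \<in> {up k a..up k b}"
        define s where "s = a + (y - up k a) / r"
        have ls: "l s = y" unfolding l_def s_def using r by simp
        then show "y \<in> l ` {a..b}" using y unfolding la[symmetric] lb[symmetric]
          by (intro image_eqI[of _ _ s]) (use mono' in auto)
      qed
      have near: "\<bar>l s - s\<bar> < e" if s: "s \<in> {a..b}" for s
      proof -
        \<comment> \<open>The displacement of an affine map is the convex combination of its
          displacements at the end points, and each of these lies between 0 and the mesh.\<close>
        define \<theta> where "\<theta> = (s - a) / (b - a)"
        have \<theta>: "0 \<le> \<theta>" "\<theta> \<le> 1" using s ab unfolding \<theta>_def by auto
        have s_eq: "s = a + \<theta> * (b - a)" unfolding \<theta>_def using ab by simp
        have "l s = up k a + \<theta> * (up k b - up k a)" unfolding l_def r_def \<theta>_def by simp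
        then have "l s - s = (1 - \<theta>) * (up k a - a) + \<theta> * (up k b - b)"
          by (subst (2) s_eq) (simp add: algebra_simps)
        moreover have "(1 - \<theta>) * (up k a - a) + \<theta> * (up k b - b) \<le> (1 - \<theta>) * (1 / c k) + \<theta> * (1 / c k)"
          using \<theta> up_less[of k a] up_less[of k b] by (intro add_mono mult_left_mono) auto
        moreover have "0 \<le> (1 - \<theta>) * (up k a - a) + \<theta> * (up k b - b)"
          using \<theta> up_ge[of a k] up_ge[of b k] by auto
        moreover have "(1 - \<theta>) * (1 / c k) + \<theta> * (1 / c k) = 1 / c k"
          by (simp only: distrib_right[symmetric]) simp
        moreover have "\<bar>x\<bar> < e" if "x = y" "y \<le> z" "0 \<le> y" "z = 1 / c k" for x y z :: real
          using that h by simp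
        ultimately show ?thesis by blast
      qed
      have "dist (x s) (x (dn k (l s))) < e" if s: "s \<in> {a..<b}" for s
      proof (rule osc[OF s])
        have "l s < up k b" "up k a \<le> l s" unfolding la[symmetric] lb[symmetric] using s mono mono' by auto
        then have 1: "l s * c k < of_int \<lceil>b * c k\<rceil>" and 2: "of_int \<lceil>a * c k\<rceil> \<le> l s * c k"
          unfolding up_def using c[of k] by (auto simp: pos_less_divide_eq pos_divide_le_eq)
        \<comment> \<open>A grid point strictly below the first one that is not below
          \<open>b\<close> lies strictly below \<open>b\<close>. Hence the step function does not
          yet see a jump of the path at \<open>b\<close>.\<close>
        have "of_int \<lfloor>l s * c k\<rfloor> < b * c k" "a * c k \<le> of_int \<lfloor>l s * c k\<rfloor>"
        proof -
          from 1 have "\<lfloor>l s * c k\<rfloor> < \<lceil>b * c k\<rceil>" by (rule floor_less_iff[THEN iffD2])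
          then show "of_int \<lfloor>l s * c k\<rfloor> < b * c k" by (rule less_ceiling_iff[THEN iffD1])
          from 2 have "\<lceil>a * c k\<rceil> \<le> \<lfloor>l s * c k\<rfloor>" by (rule le_floor_iff[THEN iffD2])
          then show "a * c k \<le> of_int \<lfloor>l s * c k\<rfloor>" by (rule ceiling_le_iff[THEN iffD1])
        qed
        then show "dn k (l s) \<in> {a..<b}"
          unfolding dn_def using c[of k] by (auto simp: pos_divide_less_eq pos_le_divide_eq)
      qed
      then have "good k a b l" unfolding good_def using im near mono by (auto simp: strict_mono_on_def)
      then show ?thesis by blast
    qed
    then show ?thesis unfolding P_def by blast
  qed
  have P_trans: "P a c'" if "P a b" "P b c'" "a \<le> b" "b \<le> c'" for a b c'
    unfolding P_def
  proof (intro impI)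
    assume *: "0 \<le> a" "a \<le> c'" "c' \<le> T"
    have "b \<le> T" "0 \<le> b" using * that by auto
    then have "\<exists>K. \<forall>k\<ge>K. \<exists>l. good k a b l" "\<exists>K. \<forall>k\<ge>K. \<exists>l. good k b c' l"
      using * that unfolding P_def by blast+
    then obtain K1 K2 where K: "\<And>k. k \<ge> K1 \<Longrightarrow> \<exists>l. good k a b l" "\<And>k. k \<ge> K2 \<Longrightarrow> \<exists>l. good k b c' l"
      by metis
    have "\<exists>l. good k a c' l" if k: "k \<ge> max K1 K2" for k
    proof -
      obtain l m where l: "good k a b l" and m: "good k b c' m" using K k by (meson max.bounded_iff)
      have lb: "l b = up k b" and mb: "m b = up k b"
        using strict_mono_on_image_endpoints[of a b l "up k a" "up k b"]
          strict_mono_on_image_endpoints[of b c' m "up k b" "up k c'"]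
          l m \<open>a \<le> b\<close> \<open>b \<le> c'\<close> up_mono[of a b k] up_mono[of b c' k] unfolding good_def by auto
      define n where "n s = (if s < b then l s else m s)" for s
      have nl: "n s = l s" if "s \<in> {a..b}" for s using that lb mb unfolding n_def by (cases "s = b") auto
      have nm: "n s = m s" if "s \<in> {b..c'}" for s using that unfolding n_def by auto
      have U: "{a..c'} = {a..b} \<union> {b..c'}" using \<open>a \<le> b\<close> \<open>b \<le> c'\<close> by auto
      have "n ` {a..c'} = l ` {a..b} \<union> m ` {b..c'}"
        unfolding U image_Un using nl nm by (intro arg_cong2[of _ _ _ _ "(\<union>)"] image_cong) auto
      also have "\<dots> = {up k a..up k c'}"
        using l m up_mono[OF \<open>a \<le> b\<close>, of k] up_mono[OF \<open>b \<le> c'\<close>, of k] unfolding good_def by auto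
      finally have im: "n ` {a..c'} = {up k a..up k c'}" .
      have "n s < n t" if st: "s \<in> {a..c'}" "t \<in> {a..c'}" "s < t" for s t
      proof -
        consider "t \<le> b" | "s \<ge> b" | "s < b" "b < t" by linarith
        then show ?thesis
        proof cases
          case 1
          then have "s \<in> {a..b}" "t \<in> {a..b}" using st by auto
          then show ?thesis using l st nl unfolding good_def strict_mono_on_def by auto
        next
          case 2
          then have "s \<in> {b..c'}" "t \<in> {b..c'}" using st by auto
          then show ?thesis using m st nm unfolding good_def strict_mono_on_def by auto
        next
          case 3
          then have "s \<in> {a..b}" "b \<in> {a..b}" "t \<in> {b..c'}" "b \<in> {b..c'}" using st by auto
          then have "l s < l b" "m b < m t" using 3 l m unfolding good_def strict_mono_on_def by auto
          then show ?thesis using 3 lb mb unfolding n_def by auto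
        qed
      qed
      then have "strict_mono_on {a..c'} n" by (rule strict_mono_onI)
      moreover have "\<bar>n s - s\<bar> < e" if "s \<in> {a..c'}" for s
        using that l m unfolding n_def good_def by (auto split: if_splits)
      moreover have "dist (x s) (x (dn k (n s))) < e" if "s \<in> {a..<c'}" for s
        using that l m unfolding n_def good_def by (auto split: if_splits)
      ultimately show ?thesis using im unfolding good_def by blast
    qed
    then show "\<exists>K. \<forall>k\<ge>K. \<exists>l. good k a c' l" by blast
  qed
  have "P 0 T"
  proof (rule Bolzano)
    show "0 \<le> T" using T by simp
    show "P a c'" if "P a b" "P b c'" "a \<le> b" "b \<le> c'" for a b c' using P_trans that by blast
    fix z assume z: "0 \<le> z" "z \<le> T"
    \<comment> \<open>Oscillation is small on the right of \<open>z\<close> because the path is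
      right-continuous, and on the left because it has a left limit, which may differ from
      \<open>x z\<close>. So intervals ending at \<open>z\<close> and intervals starting at
      \<open>z\<close> are treated separately.\<close>
    have "\<exists>d>0. \<forall>b. z < b \<and> b \<le> T \<and> b - z < d \<longrightarrow> P z b"
    proof (cases "z < T")
      case True
      then have "(x \<longlongrightarrow> x z) (at_right z)" using x z unfolding skorohod_space_def by auto
      then have "\<forall>\<^sub>F s in at_right z. dist (x s) (x z) < e / 2" by (rule tendstoD) (use e in simp)
      then obtain b' where b': "b' > z" "\<And>s. z < s \<Longrightarrow> s < b' \<Longrightarrow> dist (x s) (x z) < e / 2"
        unfolding eventually_at_right_field by blast
      have "P z b" if "z < b" "b - z < b' - z" for b
      proof (rule P_osc[OF that(1)])
        have "dist (x s) (x z) < e / 2" if "s \<in> {z..<b}" for s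
          using b'(2)[of s] that \<open>b - z < b' - z\<close> e by (cases "s = z") auto
        then show "dist (x s) (x u) < e" if "s \<in> {z..<b}" "u \<in> {z..<b}" for s u
          using that dist_triangle_half_l[of "x s" "x z" e "x u"] by (metis dist_commute)
      qed
      then show ?thesis using b'(1) by (intro exI[of _ "b' - z"]) auto
    qed (intro exI[of _ 1], auto)
    then obtain d1 where d1: "d1 > 0" "\<And>b. z < b \<Longrightarrow> b \<le> T \<Longrightarrow> b - z < d1 \<Longrightarrow> P z b" by blast
    have "\<exists>d>0. \<forall>a. a < z \<and> 0 \<le> a \<and> z - a < d \<longrightarrow> P a z"
    proof (cases "z > 0")
      case True
      then have "z \<in> {0<..T}" using z by simp
      then obtain y where "(x \<longlongrightarrow> y) (at_left z)" using x unfolding skorohod_space_def by blast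
      then have "\<forall>\<^sub>F s in at_left z. dist (x s) y < e / 2" by (rule tendstoD) (use e in simp)
      then obtain b' where b': "b' < z" "\<And>s. b' < s \<Longrightarrow> s < z \<Longrightarrow> dist (x s) y < e / 2"
        unfolding eventually_at_left_field by blast
      have "P a z" if "a < z" "z - a < z - b'" for a
      proof (rule P_osc[OF that(1)])
        have "dist (x s) y < e / 2" if "s \<in> {a..<z}" for s
          using b'(2)[of s] that \<open>z - a < z - b'\<close> by auto
        then show "dist (x s) (x u) < e" if "s \<in> {a..<z}" "u \<in> {a..<z}" for s u
          using that dist_triangle_half_l[of "x s" y e "x u"] by (metis dist_commute)
      qed
      then show ?thesis using b'(1) by (intro exI[of _ "z - b'"]) auto
    qed (intro exI[of _ 1], auto)
    then obtain d2 where d2: "d2 > 0" "\<And>a. a < z \<Longrightarrow> 0 \<le> a \<Longrightarrow> z - a < d2 \<Longrightarrow> P a z" by blast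
    have "P a b" if ab: "a \<le> z" "z \<le> b" "b - a < min d1 d2" for a b
    proof (cases "0 \<le> a \<and> b \<le> T")
      case True
      have "P a z" using d2(2)[of a] P_refl[of z] ab True by (cases "a = z") auto
      moreover have "P z b" using d1(2)[of b] P_refl[of z] ab True by (cases "z = b") auto
      ultimately show ?thesis using P_trans ab by blast
    qed (auto simp: P_def)
    then show "\<exists>d>0. \<forall>a b. a \<le> z \<and> z \<le> b \<and> b - a < d \<longrightarrow> P a b"
      using d1(1) d2(1) by (intro exI[of _ "min d1 d2"]) auto
  qed
  then obtain K where K: "\<And>k. k \<ge> K \<Longrightarrow> \<exists>l. good k 0 T l" unfolding P_def using T by auto
  have "dyadic_step T k (\<lambda>p. x (dyadic_time T p)) \<in> skorohod_ball T x e" if k: "k \<ge> K" for k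
  proof -
    obtain l where l: "good k 0 T l" using K[OF k] by blast
    have T_c: "T * c k = of_int (2 ^ k)" unfolding c_def using T by simp
    have up0: "up k 0 = 0" unfolding up_def by simp
    have upT: "up k T = T" unfolding up_def T_c ceiling_of_int using T by (simp add: c_def)
    have l_mono: "strict_mono_on {0..T} l" and im: "l ` {0..T} = {0..T}"
      using l unfolding good_def up0 upT by auto
    have lT: "l T = T" using strict_mono_on_image_endpoints(2)[OF l_mono im] T by simp
    have tc: "time_change T l" by (rule time_changeI[OF l_mono im])
    have step: "dyadic_step T k (\<lambda>p. x (dyadic_time T p)) u = x (dn k u)" if u: "u \<in> {0..T}" for u
    proof -
      have "0 \<le> \<lfloor>u * c k\<rfloor>" using u c[of k] by simp
      then have "real (nat \<lfloor>u * c k\<rfloor>) * T / 2 ^ k = dn k u"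
        unfolding dn_def by (simp add: c_def)
      moreover have "dn k u \<le> u" unfolding dn_def using c[of k] by (simp add: pos_divide_le_eq)
      ultimately have "dyadic_time T (k, nat \<lfloor>u * c k\<rfloor>) = dn k u"
        unfolding dyadic_time_def using u by simp
      then show ?thesis unfolding dyadic_step_def c_def[symmetric] using u by simp
    qed
    have dnT: "dn k T = T" unfolding dn_def T_c floor_of_int using T by (simp add: c_def)
    have "\<bar>l t - t\<bar> < e \<and> dist (x t) (dyadic_step T k (\<lambda>p. x (dyadic_time T p)) (l t)) < e"
      if t: "t \<in> {0..T}" for t
      using t l lT dnT e step[OF time_change_in[OF tc t]] unfolding good_def by (cases "t = T") auto
    then show ?thesis using tc dyadic_step_in_skorohod_space[OF T] unfolding skorohod_ball_def by blast
  qed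
  then show ?thesis unfolding eventually_sequentially by blast
qed

text \<open>Only the coordinates of level \<open>k\<close> with index up to \<open>2 ^ k\<close>
  enter, and uniform closeness is closeness in the ball with the identity as time change.\<close>

lemma open_dyadic_step_vimage:
  fixes G :: "(real \<Rightarrow> 'h::metric_space) set"
  assumes T: "T > 0" and G: "openin (skorohod_topology T) G"
  shows "open {a :: nat \<times> nat \<Rightarrow> 'h. dyadic_step T k a \<in> G}"
proof (subst open_subopen, intro ballI)
  fix a :: "nat \<times> nat \<Rightarrow> 'h" assume "a \<in> {a. dyadic_step T k a \<in> G}"
  then obtain e where e: "e > 0" "skorohod_ball T (dyadic_step T k a) e \<subseteq> G"
    using G unfolding openin_skorohod_topology by blast
  define N where "N = (\<Inter>i\<in>{..(2::nat) ^ k}. (\<lambda>b :: nat \<times> nat \<Rightarrow> 'h. b (k, i)) -` ball (a (k, i)) e)"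
  have "open N" unfolding N_def
    by (intro open_INT finite_atMost ballI open_vimage open_ball continuous_on_product_coordinates)
  moreover have "a \<in> N" unfolding N_def using e by auto
  moreover have "dyadic_step T k b \<in> G" if b: "b \<in> N" for b
  proof -
    have "dist (dyadic_step T k a t) (dyadic_step T k b t) < e" if t: "t \<in> {0..T}" for t
    proof -
      have "t * (2 ^ k / T) \<le> 2 ^ k" using t T by (simp add: field_simps mult_right_mono)
      then have "\<lfloor>t * (2 ^ k / T)\<rfloor> \<le> 2 ^ k"
        by (metis floor_mono floor_of_int of_int_numeral of_int_power)
      then have "nat \<lfloor>t * (2 ^ k / T)\<rfloor> \<le> 2 ^ k" by (simp add: nat_le_iff)
      then show ?thesis using b t unfolding N_def dyadic_step_def by auto
    qed
    moreover have "time_change T (\<lambda>t. t)" by (rule time_changeI) (auto simp: strict_mono_on_def)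
    ultimately have "dyadic_step T k b \<in> skorohod_ball T (dyadic_step T k a) e"
      using dyadic_step_in_skorohod_space[OF T] e(1) unfolding skorohod_ball_def
      by (auto intro!: exI[of _ "\<lambda>t. t"])
    then show ?thesis using e(2) by blast
  qed
  ultimately show "\<exists>N. open N \<and> a \<in> N \<and> N \<subseteq> {a. dyadic_step T k a \<in> G}" by blast
qed

text \<open>The slack in the radius makes these subsets of \<open>G\<close> open; they exhaust \<open>G\<close> if \<open>G\<close> is open.\<close>

definition skorohod_core :: "real \<Rightarrow> (real \<Rightarrow> 'h::metric_space) set \<Rightarrow> nat \<Rightarrow> (real \<Rightarrow> 'h) set" where
  "skorohod_core T G m = {x \<in> skorohod_space T. \<exists>e>1 / real (Suc m). skorohod_ball T x e \<subseteq> G}"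

lemma openin_skorohod_core: "openin (skorohod_topology T) (skorohod_core T G m)"
  unfolding openin_skorohod_topology
proof (intro conjI ballI)
  show "skorohod_core T G m \<subseteq> skorohod_space T" unfolding skorohod_core_def by blast
  fix x assume "x \<in> skorohod_core T G m"
  then obtain e where e: "e > 1 / real (Suc m)" "skorohod_ball T x e \<subseteq> G"
    unfolding skorohod_core_def by blast
  define d where "d = (e - 1 / real (Suc m)) / 2"
  have d: "d > 0" "e - d > 1 / real (Suc m)"
  proof -
    have "0 < (e - r) / 2 \<and> r < e - (e - r) / 2" if "r < e" for r using that by (auto simp: field_simps)
    then show "d > 0" "e - d > 1 / real (Suc m)" unfolding d_def using e(1) by blast+
  qed
  have "skorohod_ball T x d \<subseteq> skorohod_core T G m"
  proof
    fix y assume y: "y \<in> skorohod_ball T x d"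
    have "skorohod_ball T y (e - d) \<subseteq> skorohod_ball T x e"
      using skorohod_ball_triangle[OF y, of _ "e - d"] by auto
    then show "y \<in> skorohod_core T G m"
      using y d(2) e(2) unfolding skorohod_core_def skorohod_ball_def[of T x d] by blast
  qed
  then show "\<exists>e>0. skorohod_ball T x e \<subseteq> skorohod_core T G m" using d(1) by blast
qed

text \<open>Turns membership in an open set into countably many conditions on grid values. It would
  not be enough for the step functions to lie eventually in \<open>G\<close>, since their limit
  could be on the boundary. Lying in a core with a fixed \<open>m\<close> forces the limit into
  \<open>G\<close>, because the approximation eventually comes closer than the radius reserved
  there.\<close>

lemma skorohod_open_iff_dyadic_step:
  assumes T: "T > 0" and G: "openin (skorohod_topology T) G" and x: "x \<in> skorohod_space T"
  shows "x \<in> G \<longleftrightarrow> (\<exists>m K. \<forall>k\<ge>K. dyadic_step T k (\<lambda>p. x (dyadic_time T p)) \<in> skorohod_core T G m)"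
    (is "_ \<longleftrightarrow> (\<exists>m K. \<forall>k\<ge>K. ?s k \<in> _)")
proof
  assume "x \<in> G"
  then obtain e where e: "e > 0" "skorohod_ball T x e \<subseteq> G"
    using G unfolding openin_skorohod_topology by blast
  obtain m where m: "1 / real (Suc m) < e / 2" using nat_approx_posE[of "e / 2"] e(1) by auto
  obtain K where K: "\<And>k. k \<ge> K \<Longrightarrow> ?s k \<in> skorohod_ball T x (e / 2)"
    using eventually_dyadic_step_in_skorohod_ball[OF T x, of "e / 2"] e(1)
    unfolding eventually_sequentially by auto
  have "?s k \<in> skorohod_core T G m" if "k \<ge> K" for k
  proof -
    have "skorohod_ball T (?s k) (e / 2) \<subseteq> skorohod_ball T x e"
      using skorohod_ball_triangle[OF K[OF that], of _ "e / 2"] by auto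
    then show ?thesis using m e(2) dyadic_step_in_skorohod_space[OF T]
      unfolding skorohod_core_def by blast
  qed
  then show "\<exists>m K. \<forall>k\<ge>K. ?s k \<in> skorohod_core T G m" by blast
next
  assume "\<exists>m K. \<forall>k\<ge>K. ?s k \<in> skorohod_core T G m"
  then obtain m K where K: "\<And>k. k \<ge> K \<Longrightarrow> ?s k \<in> skorohod_core T G m" by blast
  obtain K' where K': "\<And>k. k \<ge> K' \<Longrightarrow> ?s k \<in> skorohod_ball T x (1 / real (Suc m))"
    using eventually_dyadic_step_in_skorohod_ball[OF T x, of "1 / real (Suc m)"]
    unfolding eventually_sequentially by auto
  define k where "k = max K K'"
  have "x \<in> skorohod_ball T (?s k) (1 / real (Suc m))"
    by (rule skorohod_ball_sym[OF K' x]) (simp add: k_def)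
  moreover obtain e where "e > 1 / real (Suc m)" "skorohod_ball T (?s k) e \<subseteq> G"
    using K[of k] unfolding skorohod_core_def k_def by auto
  ultimately show "x \<in> G" using skorohod_ball_mono[of "1 / real (Suc m)" e T "?s k"] by auto
qed

section \<open>The Skorohod sigma-algebra and evaluations on the grid\<close>

lemma space_skorohod_borel: "space (skorohod_borel T) = skorohod_space T"
  and sets_skorohod_borel:
    "sets (skorohod_borel T) = sigma_sets (skorohod_space T) {G. openin (skorohod_topology T) G}"
proof -
  have sub: "{G. openin (skorohod_topology T) G} \<subseteq> Pow (skorohod_space T)"
    unfolding openin_skorohod_topology by blast
  show "space (skorohod_borel T) = skorohod_space T"
    unfolding skorohod_borel_def by (rule space_measure_of[OF sub])
  show "sets (skorohod_borel T) = sigma_sets (skorohod_space T) {G. openin (skorohod_topology T) G}"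
    unfolding skorohod_borel_def by (rule sets_measure_of[OF sub])
qed

text \<open>Evaluations are not continuous in \<open>J\<^sub>1\<close>, but "the path meets an open set during an open time
  interval" is an open condition.\<close>

lemma skorohod_hits_open:
  fixes V :: "'h::metric_space set"
  assumes V: "open V"
  shows "openin (skorohod_topology T) {x \<in> skorohod_space T. \<exists>s\<in>{0..T}. a < s \<and> s < b \<and> x s \<in> V}"
  unfolding openin_skorohod_topology
proof (intro conjI ballI)
  fix x assume "x \<in> {x \<in> skorohod_space T. \<exists>s\<in>{0..T}. a < s \<and> s < b \<and> x s \<in> V}"
  then obtain s where s: "s \<in> {0..T}" "a < s" "s < b" "x s \<in> V" by blast
  obtain e where e: "e > 0" "ball (x s) e \<subseteq> V" using V s(4) open_contains_ball by blast
  define d where "d = Min {e, s - a, b - s}"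
  have d: "d > 0" "d \<le> e" "d \<le> s - a" "d \<le> b - s" using e s unfolding d_def by auto
  have "skorohod_ball T x d \<subseteq> {x \<in> skorohod_space T. \<exists>s\<in>{0..T}. a < s \<and> s < b \<and> x s \<in> V}"
  proof
    fix y assume y: "y \<in> skorohod_ball T x d"
    then obtain l where l: "time_change T l" "\<bar>l s - s\<bar> < d" "dist (x s) (y (l s)) < d"
      using s(1) unfolding skorohod_ball_def by blast
    have "y (l s) \<in> V" using e(2) l(3) d(2) by (auto simp: subset_iff)
    moreover have "a < l s" "l s < b" using l(2) d by - linarith+
    ultimately show "y \<in> {x \<in> skorohod_space T. \<exists>s\<in>{0..T}. a < s \<and> s < b \<and> x s \<in> V}"
      using y time_change_in[OF l(1) s(1)] unfolding skorohod_ball_def by blast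
  qed
  then show "\<exists>e>0. skorohod_ball T x e \<subseteq> {x \<in> skorohod_space T. \<exists>s\<in>{0..T}. a < s \<and> s < b \<and> x s \<in> V}"
    using d(1) by blast
qed blast

text \<open>Every time change fixes \<open>T\<close>, so evaluation there is continuous. This
  settles the one time that cannot be approached from the right.\<close>

lemma skorohod_end_value_open:
  fixes V :: "'h::metric_space set"
  assumes T: "T > 0" and V: "open V"
  shows "openin (skorohod_topology T) {x \<in> skorohod_space T. x T \<in> V}"
  unfolding openin_skorohod_topology
proof (intro conjI ballI)
  fix x assume "x \<in> {x \<in> skorohod_space T. x T \<in> V}"
  then obtain e where e: "e > 0" "ball (x T) e \<subseteq> V" using V open_contains_ball by blast
  have "y T \<in> V" if y: "y \<in> skorohod_ball T x e" for y
  proof -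
    obtain l where l: "time_change T l" "dist (x T) (y (l T)) < e"
      using y T unfolding skorohod_ball_def by force
    have "l T = T"
      using l(1) T strict_mono_on_image_endpoints(2)[of 0 T l 0 T] unfolding time_change_def by simp
    then show ?thesis using e(2) l(2) by auto
  qed
  then show "\<exists>e>0. skorohod_ball T x e \<subseteq> {x \<in> skorohod_space T. x T \<in> V}"
    using e(1) unfolding skorohod_ball_def by blast
qed blast

lemma skorohod_evaluation_measurable:
  fixes t :: real
  assumes T: "T > 0" and t: "t \<in> {0..T}"
  shows "(\<lambda>x. x t) \<in> measurable (skorohod_borel T) (borel :: 'h::metric_space measure)"
proof (rule borel_measurableI)
  fix V :: "'h set" assume V: "open V"
  let ?B = "skorohod_borel T :: (real \<Rightarrow> 'h) measure"
  have openB: "G \<in> sets ?B" if "openin (skorohod_topology T) G" for G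
    unfolding sets_skorohod_borel using that by (intro sigma_sets.Basic) simp
  show "(\<lambda>x. x t) -` V \<inter> space ?B \<in> sets ?B"
  proof (cases "t = T")
    case True
    have "(\<lambda>x. x t) -` V \<inter> space ?B = {x \<in> skorohod_space T. x T \<in> V}"
      using True by (auto simp: space_skorohod_borel)
    then show ?thesis using openB[OF skorohod_end_value_open[OF T V]] by simp
  next
    case False
    then have tT: "t < T" using t by auto
    \<comment> \<open>The points at distance at least 1 / (m + 1) from the complement of
      \<open>V\<close>. These sets are closed, so a path staying in one right after \<open>t\<close>
      has its right limit \<open>x t\<close> there; and they exhaust \<open>V\<close> with room
      around each point, so a path starting in \<open>V\<close> stays in one for a short
      time.\<close>
    define F where "F m = - (\<Union>z\<in>- V. ball z (1 / real (Suc m)))" for m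
    have oF: "open (- F m)" for m unfolding F_def by auto
    define A where "A m n = {x \<in> skorohod_space T.
        \<exists>s\<in>{0..T}. t < s \<and> s < t + 1 / real (Suc n) \<and> x s \<in> - F m}" for m n
    have "A m n \<in> sets ?B" for m n unfolding A_def by (intro openB skorohod_hits_open oF)
    then have "(\<Union>m. \<Union>n. space ?B - A m n) \<in> sets ?B" by auto
    moreover have "(\<lambda>x. x t) -` V \<inter> space ?B = (\<Union>m. \<Union>n. space ?B - A m n)"
    proof (intro equalityI subsetI)
      fix x assume "x \<in> (\<lambda>x. x t) -` V \<inter> space ?B"
      then have xt: "x t \<in> V" and x: "x \<in> skorohod_space T" by (auto simp: space_skorohod_borel)
      obtain e where e: "e > 0" "ball (x t) e \<subseteq> V" using V xt open_contains_ball by blast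
      obtain m where m: "1 / real (Suc m) < e / 2" using nat_approx_posE[of "e / 2"] e(1) by auto
      have "(x \<longlongrightarrow> x t) (at_right t)" using x t tT unfolding skorohod_space_def by auto
      then have "\<forall>\<^sub>F s in at_right t. dist (x s) (x t) < e / 2" by (rule tendstoD) (use e(1) in simp)
      then obtain b where b: "b > t" "\<And>s. t < s \<Longrightarrow> s < b \<Longrightarrow> dist (x s) (x t) < e / 2"
        unfolding eventually_at_right_field by blast
      obtain n where n: "1 / real (Suc n) < b - t" using nat_approx_posE[of "b - t"] b(1) by auto
      have "x s \<in> F m" if s: "t < s" "s < t + 1 / real (Suc n)" for s
        unfolding F_def
      proof
        assume "x s \<in> (\<Union>z\<in>- V. ball z (1 / real (Suc m)))"
        then obtain z where z: "z \<notin> V" "dist z (x s) < 1 / real (Suc m)" by auto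
        note z(2)
        moreover have "dist (x s) (x t) < e / 2" using b(2)[of s] s n by auto
        ultimately have "dist (x t) z < e"
          using m dist_triangle[of "x t" z "x s"] by (simp add: dist_commute)
        then show False using e(2) z(1) by auto
      qed
      then have "x \<notin> A m n" unfolding A_def by auto
      then show "x \<in> (\<Union>m. \<Union>n. space ?B - A m n)" using x by (auto simp: space_skorohod_borel)
    next
      fix x assume "x \<in> (\<Union>m. \<Union>n. space ?B - A m n)"
      then obtain m n where x: "x \<in> skorohod_space T" "x \<notin> A m n" by (auto simp: space_skorohod_borel)
      define b where "b = min T (t + 1 / real (Suc n))"
      have "t < b" unfolding b_def using tT by simp
      have "x s \<in> F m" if "t < s" "s < b" for s
        using x that t unfolding A_def b_def by auto
      then have "\<forall>\<^sub>F s in at_right t. x s \<in> F m"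
        unfolding eventually_at_right_field using \<open>t < b\<close> by blast
      moreover have "(x \<longlongrightarrow> x t) (at_right t)" using x t tT unfolding skorohod_space_def by auto
      moreover have "closed (F m)" using oF by (simp add: closed_def)
      ultimately have "x t \<in> F m"
        by (intro Lim_in_closed_set[of "F m" x "at_right t"]) auto
      moreover have "F m \<subseteq> V"
      proof
        fix z assume z: "z \<in> F m"
        have "z \<in> ball z (1 / real (Suc m))" by simp
        then show "z \<in> V" using z unfolding F_def by blast
      qed
      ultimately show "x \<in> (\<lambda>x. x t) -` V \<inter> space ?B" using x by (auto simp: space_skorohod_borel)
    qed
    ultimately show ?thesis by simp
  qed
qed

text \<open>Moves all laws to a countable product, where by second countability measurability can be
  checked coordinatewise. One inclusion is the countable description of open sets, the other the
  measurability of evaluations.\<close>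

lemma sets_skorohod_borel_eq_vimage_algebra:
  fixes T :: real
  assumes T: "T > 0"
  shows "sets (skorohod_borel T) =
    sets (vimage_algebra (skorohod_space T) (\<lambda>x p. x (dyadic_time T p))
      (borel :: (nat \<times> nat \<Rightarrow> 'h::{metric_space, second_countable_topology}) measure))"
    (is "sets ?B = sets ?V")
proof (rule antisym)
  have spV: "space ?V = skorohod_space T" by simp
  have meas: "(\<lambda>x p. x (dyadic_time T p)) \<in> measurable ?V (borel :: (nat \<times> nat \<Rightarrow> 'h) measure)"
    by (rule measurable_vimage_algebra1) simp
  show "sets ?B \<subseteq> sets ?V"
    unfolding sets_skorohod_borel
  proof (subst spV[symmetric], rule sets.sigma_sets_subset, clarify)
    fix G :: "(real \<Rightarrow> 'h) set" assume G: "openin (skorohod_topology T) G"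
    have "G = (\<Union>m. \<Union>K. \<Inter>k\<in>{K..}. {x \<in> space ?V.
        dyadic_step T k (\<lambda>p. x (dyadic_time T p)) \<in> skorohod_core T G m})" (is "_ = ?R")
    proof -
      have 1: "x \<in> skorohod_space T" if "x \<in> G" for x
        using G that unfolding openin_skorohod_topology by blast
      have 2: "x \<in> skorohod_space T" if "x \<in> ?R" for x using that spV by auto
      have 3: "x \<in> G \<longleftrightarrow> x \<in> ?R" if "x \<in> skorohod_space T" for x
        by (subst skorohod_open_iff_dyadic_step[OF T G that]) (simp add: that, simp add: Ball_def)
      show ?thesis
      proof (rule set_eqI)
        fix x
        show "x \<in> G \<longleftrightarrow> x \<in> ?R"
        proof (cases "x \<in> skorohod_space T")
          case False
          have "x \<notin> G" by (rule notI) (rule notE[OF False 1])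
          moreover have "x \<notin> ?R" by (rule notI) (rule notE[OF False 2])
          ultimately show ?thesis by (simp only: simp_thms)
        qed (rule 3)
      qed
    qed
    moreover have "{x \<in> space ?V. dyadic_step T k (\<lambda>p. x (dyadic_time T p)) \<in> skorohod_core T G m} \<in> sets ?V"
      for k m
    proof -
      have "{a :: nat \<times> nat \<Rightarrow> 'h. dyadic_step T k a \<in> skorohod_core T G m} \<in> sets borel"
        by (intro borel_open open_dyadic_step_vimage[OF T] openin_skorohod_core)
      from measurable_sets[OF meas this] show ?thesis
        by (simp add: vimage_def Int_def conj_commute)
    qed
    then have "?R \<in> sets ?V" by (intro sets.countable_UN'' sets.countable_INT') auto
    ultimately show "G \<in> sets ?V" by simp
  qed
  show "sets ?V \<subseteq> sets ?B"
  proof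
    fix A assume "A \<in> sets ?V"
    then obtain B where B: "B \<in> sets (borel :: (nat \<times> nat \<Rightarrow> 'h) measure)"
      and A: "A = (\<lambda>x p. x (dyadic_time T p)) -` B \<inter> skorohod_space T"
      by (subst (asm) sets_vimage_algebra2) auto
    have "(\<lambda>x p. x (dyadic_time T p)) \<in> measurable ?B (borel :: (nat \<times> nat \<Rightarrow> 'h) measure)"
      using T by (intro measurable_coordinatewise_then_product skorohod_evaluation_measurable dyadic_time_in) auto
    from measurable_sets[OF this B] show "A \<in> sets ?B"
      unfolding A space_skorohod_borel .
  qed
qed

section \<open>Uniqueness of finite-dimensional Fourier transforms\<close>

lemma integrable_cis:
  fixes f :: "'a \<Rightarrow> real"
  assumes "finite_measure M" "f \<in> borel_measurable M"
  shows "integrable M (\<lambda>x. cis (f x))"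
proof -
  interpret finite_measure M by fact
  have "(\<lambda>x. cis (f x)) \<in> borel_measurable M"
    using assms(2) unfolding cis_conv_exp by measurable
  then show ?thesis by (intro integrable_const_bound[where B=1]) auto
qed

text \<open>Frequency 0 equates the total masses; after normalisation Levy's theorem for probability
  measures applies. General finite measures are needed because weighted and restricted laws occur
  below.\<close>

lemma finite_measure_eqI_fourier:
  fixes \<mu> \<nu> :: "real measure"
  assumes fin: "finite_measure \<mu>" "finite_measure \<nu>"
    and sets: "sets \<mu> = sets borel" "sets \<nu> = sets borel"
    and eq: "\<And>t. (\<integral>x. cis (t * x) \<partial>\<mu>) = (\<integral>x. cis (t * x) \<partial>\<nu>)"
  shows "\<mu> = \<nu>"
proof -
  interpret \<mu>: finite_measure \<mu> by fact
  interpret \<nu>: finite_measure \<nu> by fact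
  define m where "m = measure \<mu> (space \<mu>)"
  have m_nu: "m = measure \<nu> (space \<nu>)"
    using eq[of 0] unfolding m_def by simp
  show ?thesis
  proof (cases "m = 0")
    case True
    have "emeasure \<mu> A = emeasure \<nu> A" if "A \<in> sets \<mu>" for A
    proof -
      have "measure \<mu> A \<le> 0" "measure \<nu> A \<le> 0"
        using \<mu>.bounded_measure[of A] \<nu>.bounded_measure[of A] True m_nu m_def by auto
      then have "measure \<mu> A = 0" "measure \<nu> A = 0" by (simp_all add: antisym)
      then show ?thesis by (simp add: \<mu>.emeasure_eq_measure \<nu>.emeasure_eq_measure)
    qed
    then show ?thesis using sets by (intro measure_eqI) auto
  next
    case False
    then have m: "m > 0" unfolding m_def by (simp add: zero_less_measure_iff)
    define r where "r = 1 / m"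
    have r: "r > 0" unfolding r_def using m by simp
    have real_dist: "real_distribution (density N (\<lambda>_. ennreal r))"
      if N: "finite_measure N" "sets N = sets borel" "m = measure N (space N)" for N :: "real measure"
    proof -
      interpret N: finite_measure N by fact
      have "emeasure (density N (\<lambda>_. ennreal r)) (space (density N (\<lambda>_. ennreal r))) = ennreal (r * m)"
        using r m N(3) by (simp add: emeasure_density_const N.emeasure_eq_measure ennreal_mult)
      then have "prob_space (density N (\<lambda>_. ennreal r))"
        using m by (intro prob_spaceI) (simp add: r_def)
      then show ?thesis using N(2)
        by (simp add: real_distribution_def real_distribution_axioms_def)
    qed
    have char: "char (density N (\<lambda>_. ennreal r)) t = r *\<^sub>R (\<integral>x. cis (t * x) \<partial>N)"
      if [measurable_cong, simp]: "sets N = sets borel" for N :: "real measure" and t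
      unfolding char_def cis_conv_exp using r
      by (subst integral_density) auto
    have "density \<mu> (\<lambda>_. ennreal r) = density \<nu> (\<lambda>_. ennreal r)"
      by (rule Levy_uniqueness[OF real_dist real_dist])
        (use fin sets m_nu eq in \<open>auto simp: m_def char\<close>)
    then have "ennreal r * emeasure \<mu> A = ennreal r * emeasure \<nu> A" if "A \<in> sets borel" for A
      using that sets emeasure_density_const[of A \<mu> "ennreal r"] emeasure_density_const[of A \<nu> "ennreal r"] by simp
    then have "emeasure \<mu> A = emeasure \<nu> A" if "A \<in> sets borel" for A
      using that r by (auto simp: ennreal_mult_cancel_left)
    then show ?thesis using sets by (intro measure_eqI) auto
  qed
qed

text \<open>Reduction to one dimension: the nonnegative weights \<open>1 + cos \<theta>\<close> and \<open>1 + sin \<theta>\<close> turn the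
  joint Fourier transform into Fourier transforms of finite measures on the line.\<close>

definition phase_weight :: "complex \<Rightarrow> real \<Rightarrow> real" where
  "phase_weight u \<theta> = 1 + Re (u * cis \<theta>)"

lemma phase_weight_measurable[measurable]: "phase_weight u \<in> borel_measurable borel"
proof -
  have "phase_weight u = (\<lambda>\<theta>. 1 + (Re u * cos \<theta> - Im u * sin \<theta>))"
    unfolding phase_weight_def by auto
  then show ?thesis by (auto intro!: borel_measurable_continuous_onI continuous_intros)
qed

lemma phase_weight_bounds:
  assumes "cmod u \<le> 1"
  shows "0 \<le> phase_weight u \<theta>" "phase_weight u \<theta> \<le> 2"
  using abs_Re_le_cmod[of "u * cis \<theta>"] assms unfolding phase_weight_def
  by (auto simp: norm_mult simp del: times_complex.sel)

definition phase_distr :: "complex \<Rightarrow> 'a measure \<Rightarrow> ('a \<Rightarrow> real) \<Rightarrow> ('a \<Rightarrow> real) \<Rightarrow> real measure" where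
  "phase_distr u M X \<theta> = distr (density M (\<lambda>x. ennreal (phase_weight u (\<theta> x)))) borel X"

context
  fixes M :: "'a measure" and X \<theta> :: "'a \<Rightarrow> real" and u :: complex
  assumes fin: "finite_measure M"
    and X[measurable]: "X \<in> borel_measurable M"
    and \<theta>[measurable]: "\<theta> \<in> borel_measurable M"
    and u: "cmod u \<le> 1"
begin

interpretation finite_measure M by (rule fin)

lemma finite_measure_phase_distr: "finite_measure (phase_distr u M X \<theta>)"
proof -
  have "(\<integral>\<^sup>+x. ennreal (phase_weight u (\<theta> x)) \<partial>M) \<le> (\<integral>\<^sup>+x. ennreal 2 \<partial>M)"
    by (intro nn_integral_mono ennreal_leI phase_weight_bounds u)
  also have "\<dots> < \<infinity>" by (simp add: emeasure_eq_measure ennreal_mult_less_top)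
  finally have "finite_measure (density M (\<lambda>x. ennreal (phase_weight u (\<theta> x))))"
    by (intro finite_measureI) (simp add: emeasure_density less_top)
  then show ?thesis unfolding phase_distr_def by (rule finite_measure.finite_measure_distr) simp
qed

lemma integral_phase_distr:
  fixes f :: "real \<Rightarrow> 'b::{banach, second_countable_topology}"
  assumes [measurable]: "f \<in> borel_measurable borel"
  shows "(\<integral>z. f z \<partial>phase_distr u M X \<theta>) = (\<integral>x. phase_weight u (\<theta> x) *\<^sub>R f (X x) \<partial>M)"
  unfolding phase_distr_def
  by (subst integral_distr, simp, simp) (subst integral_density, auto simp: phase_weight_bounds u)

text \<open>Writing the real part as half the sum of a number and its conjugate expresses the
  transform of a weighted law by the joint transform at the second frequencies 0, 1 and -1. The
  factors 0 and 1 are left standing so that a hypothesis on the joint transform at arbitrary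
  frequencies rewrites each term.\<close>

lemma fourier_phase_distr:
  "(\<integral>z. cis (t * z) \<partial>phase_distr u M X \<theta>) =
    (\<integral>x. cis (t * X x + 0 * \<theta> x) \<partial>M) + (u * (\<integral>x. cis (t * X x + 1 * \<theta> x) \<partial>M) +
      cnj u * (\<integral>x. cis (t * X x + (-1) * \<theta> x) \<partial>M)) / 2"
proof -
  have I: "integrable M (\<lambda>x. cis (t * X x + s * \<theta> x))" for s
    by (rule integrable_cis[OF fin]) measurable
  have "(\<integral>z. cis (t * z) \<partial>phase_distr u M X \<theta>) = (\<integral>x. phase_weight u (\<theta> x) *\<^sub>R cis (t * X x) \<partial>M)"
    by (rule integral_phase_distr) (simp add: cis_conv_exp)
  also have "\<dots> = (\<integral>x. cis (t * X x + 0 * \<theta> x) + (u * cis (t * X x + 1 * \<theta> x) +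
      cnj u * cis (t * X x + (-1) * \<theta> x)) / 2 \<partial>M)"
  proof (rule Bochner_Integration.integral_cong[OF refl])
    fix x
    have half: "complex_of_real (Re (u * cis (\<theta> x))) = (u * cis (\<theta> x) + cnj u * cis (- \<theta> x)) / 2"
      by (simp add: complex_eq_iff)
    have "phase_weight u (\<theta> x) *\<^sub>R cis (t * X x) =
        (1 + complex_of_real (Re (u * cis (\<theta> x)))) * cis (t * X x)"
      unfolding phase_weight_def scaleR_conv_of_real of_real_add of_real_1 ..
    also have "\<dots> = cis (t * X x) + (u * (cis (t * X x) * cis (\<theta> x)) +
        cnj u * (cis (t * X x) * cis (- \<theta> x))) / 2"
      unfolding half by (simp add: field_simps)
    finally show "phase_weight u (\<theta> x) *\<^sub>R cis (t * X x) = cis (t * X x + 0 * \<theta> x) +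
        (u * cis (t * X x + 1 * \<theta> x) + cnj u * cis (t * X x + (-1) * \<theta> x)) / 2"
      by (simp add: cis_mult)
  qed
  also have "\<dots> = (\<integral>x. cis (t * X x + 0 * \<theta> x) \<partial>M) + (u * (\<integral>x. cis (t * X x + 1 * \<theta> x) \<partial>M) +
      cnj u * (\<integral>x. cis (t * X x + (-1) * \<theta> x) \<partial>M)) / 2"
    using I[of 0] I[of 1] I[of "-1"] by simp
  finally show ?thesis .
qed

lemma integrable_indicator_cis:
  assumes [measurable]: "B \<in> sets borel"
  shows "integrable M (\<lambda>x. indicator B (X x) *\<^sub>R cis (\<theta> x))"
proof (rule Bochner_Integration.integrable_bound[OF integrable_cis[OF fin \<theta>]])
  show "(\<lambda>x. indicator B (X x) *\<^sub>R cis (\<theta> x)) \<in> borel_measurable M"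
    unfolding cis_conv_exp by measurable
qed (auto simp: indicator_def)

lemma measure_phase_distr:
  assumes [measurable]: "B \<in> sets borel"
  shows "measure (phase_distr u M X \<theta>) B =
    measure M {x \<in> space M. X x \<in> B} + Re (u * (\<integral>x. indicator B (X x) *\<^sub>R cis (\<theta> x) \<partial>M))"
proof -
  interpret D: finite_measure "phase_distr u M X \<theta>" by (rule finite_measure_phase_distr)
  have [simp]: "sets (phase_distr u M X \<theta>) = sets borel" "space (phase_distr u M X \<theta>) = UNIV"
    unfolding phase_distr_def by auto
  have int: "integrable M (\<lambda>x. u * (indicator B (X x) *\<^sub>R cis (\<theta> x)))"
    by (intro integrable_mult_right integrable_indicator_cis assms)
  have "measure (phase_distr u M X \<theta>) B = (\<integral>z. indicator B z \<partial>phase_distr u M X \<theta>)"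
    by simp
  also have "\<dots> = (\<integral>x. phase_weight u (\<theta> x) *\<^sub>R indicator B (X x) \<partial>M)"
    by (rule integral_phase_distr) simp
  also have "\<dots> = (\<integral>x. indicator {x \<in> space M. X x \<in> B} x + Re (u * (indicator B (X x) *\<^sub>R cis (\<theta> x))) \<partial>M)"
    by (rule Bochner_Integration.integral_cong[OF refl]) (auto simp: phase_weight_def indicator_def)
  also have "\<dots> = measure M {x \<in> space M. X x \<in> B} + Re (\<integral>x. u * (indicator B (X x) *\<^sub>R cis (\<theta> x)) \<partial>M)"
  proof (subst Bochner_Integration.integral_add)
    show "integrable M (indicator {x \<in> space M. X x \<in> B} :: 'a \<Rightarrow> real)"
      by (rule integrable_real_indicator) (auto simp: emeasure_eq_measure)
    show "integrable M (\<lambda>x. Re (u * (indicator B (X x) *\<^sub>R cis (\<theta> x))))"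
      by (rule integrable_Re[OF int])
    have "{x \<in> space M. X x \<in> B} \<inter> space M = {x \<in> space M. X x \<in> B}" by auto
    then show "integral\<^sup>L M (indicator {x \<in> space M. X x \<in> B}) + (\<integral>x. Re (u * (indicator B (X x) *\<^sub>R cis (\<theta> x))) \<partial>M) =
        measure M {x \<in> space M. X x \<in> B} + Re (\<integral>x. u * (indicator B (X x) *\<^sub>R cis (\<theta> x)) \<partial>M)"
      using integral_Re[OF int] by simp
  qed
  finally show ?thesis by (simp only: integral_mult_right_zero)
qed

end

text \<open>Peels one coordinate off a joint transform: restricting it to a Borel set leaves the
  transform of the rest still determined. This is the induction step for vectors.\<close>

lemma fourier_restrict_eq:
  fixes X \<theta> :: "'a \<Rightarrow> real" and Y \<eta> :: "'b \<Rightarrow> real"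
  assumes fin: "finite_measure \<mu>" "finite_measure \<nu>"
    and meas: "X \<in> borel_measurable \<mu>" "\<theta> \<in> borel_measurable \<mu>"
      "Y \<in> borel_measurable \<nu>" "\<eta> \<in> borel_measurable \<nu>"
    and eq: "\<And>t s. (\<integral>x. cis (t * X x + s * \<theta> x) \<partial>\<mu>) = (\<integral>x. cis (t * Y x + s * \<eta> x) \<partial>\<nu>)"
    and B: "B \<in> sets borel"
  shows "(\<integral>x. indicator B (X x) *\<^sub>R cis (\<theta> x) \<partial>\<mu>) = (\<integral>x. indicator B (Y x) *\<^sub>R cis (\<eta> x) \<partial>\<nu>)"
proof -
  have distr_eq: "phase_distr u \<mu> X \<theta> = phase_distr u \<nu> Y \<eta>" if u: "cmod u \<le> 1" for u
  proof (rule finite_measure_eqI_fourier)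
    show "finite_measure (phase_distr u \<mu> X \<theta>)" "finite_measure (phase_distr u \<nu> Y \<eta>)"
      by (intro finite_measure_phase_distr fin meas u)+
    show "sets (phase_distr u \<mu> X \<theta>) = sets borel" "sets (phase_distr u \<nu> Y \<eta>) = sets borel"
      by (simp_all add: phase_distr_def)
    show "(\<integral>x. cis (t * x) \<partial>phase_distr u \<mu> X \<theta>) = (\<integral>x. cis (t * x) \<partial>phase_distr u \<nu> Y \<eta>)" for t
      by (simp only: fourier_phase_distr[OF fin(1) meas(1,2) u] fourier_phase_distr[OF fin(2) meas(3,4) u] eq)
  qed
  define I where "I = (\<integral>x. indicator B (X x) *\<^sub>R cis (\<theta> x) \<partial>\<mu>)"
  define J where "J = (\<integral>x. indicator B (Y x) *\<^sub>R cis (\<eta> x) \<partial>\<nu>)"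
  have *: "measure \<mu> {x \<in> space \<mu>. X x \<in> B} + Re (u * I) = measure \<nu> {x \<in> space \<nu>. Y x \<in> B} + Re (u * J)"
    if "cmod u \<le> 1" for u
    using measure_phase_distr[OF fin(1) meas(1,2) that B] measure_phase_distr[OF fin(2) meas(3,4) that B]
      distr_eq[OF that] unfolding I_def J_def by simp
  \<comment> \<open>The weight \<open>u = 0\<close> equates the masses, then \<open>u = 1\<close>
    and \<open>u = \<i>\<close> the real and imaginary parts.\<close>
  have "I = J" using *[of 0] *[of 1] *[of \<i>] by (simp add: complex_eq_iff)
  then show ?thesis unfolding I_def J_def .
qed

lemma finite_measure_density_indicator:
  assumes "finite_measure M" and [measurable]: "A \<in> sets M"
  shows "finite_measure (density M (indicator A))"
proof -
  interpret finite_measure M by fact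
  show ?thesis by (intro finite_measureI) (simp add: emeasure_density nn_integral_multc emeasure_eq_measure)
qed

lemma measure_density_indicator:
  assumes [measurable]: "A \<in> sets M" "B \<in> sets M"
  shows "measure (density M (indicator A)) B = measure M (A \<inter> B)"
proof -
  have "emeasure (density M (indicator A)) B = (\<integral>\<^sup>+x. indicator (A \<inter> B) x \<partial>M)"
    by (simp add: emeasure_density indicator_inter_arith)
  then show ?thesis by (simp add: measure_def)
qed

lemma integral_density_indicator_vimage:
  fixes f :: "'a \<Rightarrow> complex"
  assumes [measurable]: "X \<in> borel_measurable M" "B \<in> sets borel" "f \<in> borel_measurable M"
  shows "(\<integral>x. f x \<partial>density M (indicator {x \<in> space M. X x \<in> B})) = (\<integral>x. indicator B (X x) *\<^sub>R f x \<partial>M)"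
proof -
  have "indicator {x \<in> space M. X x \<in> B} = (\<lambda>x. ennreal (indicator {x \<in> space M. X x \<in> B} x))"
    by (auto simp: indicator_def)
  then have "(\<integral>x. f x \<partial>density M (indicator {x \<in> space M. X x \<in> B})) =
      (\<integral>x. indicator {x \<in> space M. X x \<in> B} x *\<^sub>R f x \<partial>M)"
    by (simp add: integral_density)
  also have "\<dots> = (\<integral>x. indicator B (X x) *\<^sub>R f x \<partial>M)"
    by (rule Bochner_Integration.integral_cong) (auto simp: indicator_def)
  finally show ?thesis .
qed

text \<open>Each step restricts both measures to the event for one coordinate and applies the
  induction hypothesis to the restricted measures, which is why the measures are arbitrary in the
  induction.\<close>

lemma finite_family_measure_eqI_fourier:
  fixes X :: "'i \<Rightarrow> 'a \<Rightarrow> real" and Y :: "'i \<Rightarrow> 'b \<Rightarrow> real"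
  assumes "finite I"
    and "finite_measure \<mu>" "finite_measure \<nu>"
    and "\<And>i. i \<in> I \<Longrightarrow> X i \<in> borel_measurable \<mu>" "\<And>i. i \<in> I \<Longrightarrow> Y i \<in> borel_measurable \<nu>"
    and "\<And>c. (\<integral>x. cis (\<Sum>i\<in>I. c i * X i x) \<partial>\<mu>) = (\<integral>x. cis (\<Sum>i\<in>I. c i * Y i x) \<partial>\<nu>)"
    and "\<And>i. i \<in> I \<Longrightarrow> B i \<in> sets borel"
  shows "measure \<mu> {x \<in> space \<mu>. \<forall>i\<in>I. X i x \<in> B i} = measure \<nu> {x \<in> space \<nu>. \<forall>i\<in>I. Y i x \<in> B i}"
  using assms
proof (induction I arbitrary: \<mu> \<nu> rule: finite_induct)
  case empty
  then show ?case by simp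
next
  case (insert j I)
  note X = insert.prems(3) and Y = insert.prems(4)
  have mX[measurable]: "X j \<in> borel_measurable \<mu>" "\<And>i. i \<in> I \<Longrightarrow> X i \<in> borel_measurable \<mu>"
    and mY[measurable]: "Y j \<in> borel_measurable \<nu>" "\<And>i. i \<in> I \<Longrightarrow> Y i \<in> borel_measurable \<nu>"
    and Bj[measurable]: "B j \<in> sets borel" "\<And>i. i \<in> I \<Longrightarrow> B i \<in> sets borel"
    using insert.prems by auto
  define \<mu>' where "\<mu>' = density \<mu> (indicator {x \<in> space \<mu>. X j x \<in> B j})"
  define \<nu>' where "\<nu>' = density \<nu> (indicator {x \<in> space \<nu>. Y j x \<in> B j})"
  have "measure \<mu>' {x \<in> space \<mu>'. \<forall>i\<in>I. X i x \<in> B i} = measure \<nu>' {x \<in> space \<nu>'. \<forall>i\<in>I. Y i x \<in> B i}"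
  proof (rule insert.IH)
    show "finite_measure \<mu>'" "finite_measure \<nu>'"
      unfolding \<mu>'_def \<nu>'_def using insert.prems(1,2)
      by (simp_all add: finite_measure_density_indicator)
    show "X i \<in> borel_measurable \<mu>'" "Y i \<in> borel_measurable \<nu>'" if "i \<in> I" for i
      using that mX mY unfolding \<mu>'_def \<nu>'_def by auto
    fix c
    have "(\<integral>x. cis (\<Sum>i\<in>I. c i * X i x) \<partial>\<mu>') =
        (\<integral>x. indicator (B j) (X j x) *\<^sub>R cis (\<Sum>i\<in>I. c i * X i x) \<partial>\<mu>)"
      unfolding \<mu>'_def by (rule integral_density_indicator_vimage) (auto simp: cis_conv_exp)
    also have "\<dots> = (\<integral>x. indicator (B j) (Y j x) *\<^sub>R cis (\<Sum>i\<in>I. c i * Y i x) \<partial>\<nu>)"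
    proof (rule fourier_restrict_eq[OF insert.prems(1,2)])
      fix t s
      have "(\<integral>x. cis (\<Sum>i\<in>insert j I. ((\<lambda>i. s * c i)(j := t)) i * X i x) \<partial>\<mu>) =
          (\<integral>x. cis (\<Sum>i\<in>insert j I. ((\<lambda>i. s * c i)(j := t)) i * Y i x) \<partial>\<nu>)"
        by (rule insert.prems(5))
      moreover have "(\<Sum>i\<in>insert j I. ((\<lambda>i. s * c i)(j := t)) i * f i) = t * f j + s * (\<Sum>i\<in>I. c i * f i)"
        for f :: "'i \<Rightarrow> real"
      proof -
        have "(\<Sum>i\<in>I. ((\<lambda>i. s * c i)(j := t)) i * f i) = (\<Sum>i\<in>I. s * (c i * f i))"
          using insert.hyps(2) by (intro sum.cong) auto
        then show ?thesis using insert.hyps by (simp add: sum_distrib_left)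
      qed
      ultimately show "(\<integral>x. cis (t * X j x + s * (\<Sum>i\<in>I. c i * X i x)) \<partial>\<mu>) =
          (\<integral>x. cis (t * Y j x + s * (\<Sum>i\<in>I. c i * Y i x)) \<partial>\<nu>)" by simp
    qed auto
    also have "\<dots> = (\<integral>x. cis (\<Sum>i\<in>I. c i * Y i x) \<partial>\<nu>')"
      unfolding \<nu>'_def by (rule integral_density_indicator_vimage[symmetric]) (auto simp: cis_conv_exp)
    finally show "(\<integral>x. cis (\<Sum>i\<in>I. c i * X i x) \<partial>\<mu>') = (\<integral>x. cis (\<Sum>i\<in>I. c i * Y i x) \<partial>\<nu>')" .
  qed (use Bj in auto)
  moreover have "measure \<mu>' {x \<in> space \<mu>'. \<forall>i\<in>I. X i x \<in> B i} =
      measure \<mu> {x \<in> space \<mu>. \<forall>i\<in>insert j I. X i x \<in> B i}"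
    unfolding \<mu>'_def by (subst measure_density_indicator)
      (use insert.hyps(1) in \<open>auto intro!: arg_cong[where f="measure \<mu>"]\<close>)
  moreover have "measure \<nu>' {x \<in> space \<nu>'. \<forall>i\<in>I. Y i x \<in> B i} =
      measure \<nu> {x \<in> space \<nu>. \<forall>i\<in>insert j I. Y i x \<in> B i}"
    unfolding \<nu>'_def by (subst measure_density_indicator)
      (use insert.hyps(1) in \<open>auto intro!: arg_cong[where f="measure \<nu>"]\<close>)
  ultimately show ?case by simp
qed

lemma finite_family_distr_eqI_fourier:
  fixes X :: "'i \<Rightarrow> 'a \<Rightarrow> real" and Y :: "'i \<Rightarrow> 'b \<Rightarrow> real"
  assumes I: "finite I"
    and fin: "finite_measure \<mu>" "finite_measure \<nu>"
    and X: "\<And>i. i \<in> I \<Longrightarrow> X i \<in> borel_measurable \<mu>"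
    and Y: "\<And>i. i \<in> I \<Longrightarrow> Y i \<in> borel_measurable \<nu>"
    and eq: "\<And>c. (\<integral>x. cis (\<Sum>i\<in>I. c i * X i x) \<partial>\<mu>) = (\<integral>x. cis (\<Sum>i\<in>I. c i * Y i x) \<partial>\<nu>)"
  shows "distr \<mu> (\<Pi>\<^sub>M i\<in>I. borel) (\<lambda>x. \<lambda>i\<in>I. X i x) = distr \<nu> (\<Pi>\<^sub>M i\<in>I. borel) (\<lambda>x. \<lambda>i\<in>I. Y i x)"
    (is "distr _ ?P ?X = distr _ ?P ?Y")
proof (rule measure_eqI_PiM_finite[OF I])
  interpret \<mu>: finite_measure \<mu> by fact
  interpret \<nu>: finite_measure \<nu> by fact
  have mX: "?X \<in> measurable \<mu> ?P" and mY: "?Y \<in> measurable \<nu> ?P"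
    using X Y by (auto intro!: measurable_restrict)
  show "sets (distr \<mu> ?P ?X) = sets ?P" "sets (distr \<nu> ?P ?Y) = sets ?P" by simp_all
  fix B :: "'i \<Rightarrow> real set" assume B: "\<And>i. i \<in> I \<Longrightarrow> B i \<in> sets borel"
  then have "Pi\<^sub>E I B \<in> sets ?P" using I by (intro sets_PiM_I_finite) auto
  moreover have "?X -` Pi\<^sub>E I B \<inter> space \<mu> = {x \<in> space \<mu>. \<forall>i\<in>I. X i x \<in> B i}"
    "?Y -` Pi\<^sub>E I B \<inter> space \<nu> = {x \<in> space \<nu>. \<forall>i\<in>I. Y i x \<in> B i}"
    by (auto simp: PiE_iff)
  ultimately show "emeasure (distr \<mu> ?P ?X) (Pi\<^sub>E I B) = emeasure (distr \<nu> ?P ?Y) (Pi\<^sub>E I B)"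
    using finite_family_measure_eqI_fourier[where B=B, OF I fin X Y eq B] mX mY
    by (simp add: emeasure_distr \<mu>.emeasure_eq_measure \<nu>.emeasure_eq_measure)
next
  interpret \<mu>: finite_measure \<mu> by fact
  show "range (\<lambda>_::nat. space ?P) \<subseteq> prod_algebra I (\<lambda>_. borel)"
    using I by (auto simp: prod_algebra_eq_finite space_PiM intro!: exI[of _ "\<lambda>_. UNIV"])
  show "(\<Union>_::nat. space ?P) = space (\<Pi>\<^sub>M i\<in>I. borel)" by simp
  interpret D: finite_measure "distr \<mu> ?P ?X"
    using X by (intro \<mu>.finite_measure_distr measurable_restrict) auto
  show "emeasure (distr \<mu> ?P ?X) (space ?P) \<noteq> \<infinity>" by (simp add: D.emeasure_eq_measure)
qed

section \<open>Shifts of Gaussian vectors\<close>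

text \<open>The matrix may be singular. The bound says that the right-hand side vanishes on the
  kernel of the form, which for a symmetric matrix means that it lies in the range. The induction is
  elimination of one variable.\<close>

lemma psd_system_solvable:
  fixes K :: "'i \<Rightarrow> 'i \<Rightarrow> real" and a :: "'i \<Rightarrow> real"
  assumes "finite I"
    and sym: "\<And>i j. K i j = K j i"
    and "\<And>c. 0 \<le> (\<Sum>i\<in>I. \<Sum>j\<in>I. c i * c j * K i j)"
    and "\<And>c. (\<Sum>i\<in>I. c i * a i)\<^sup>2 \<le> C * (\<Sum>i\<in>I. \<Sum>j\<in>I. c i * c j * K i j)"
  shows "\<exists>z. \<forall>i\<in>I. (\<Sum>j\<in>I. K i j * z j) = a i"
  using assms(1,3,4)
proof (induction I arbitrary: a C rule: finite_induct)
  case empty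
  then show ?case by simp
next
  case (insert n I)
  define q where "q c = (\<Sum>i\<in>I. \<Sum>j\<in>I. c i * c j * K i j)" for c
  define Q where "Q c = (\<Sum>i\<in>insert n I. \<Sum>j\<in>insert n I. c i * c j * K i j)" for c
  have Q: "Q c = q c + 2 * c n * (\<Sum>i\<in>I. c i * K i n) + c n * c n * K n n" for c
  proof -
    have "(\<Sum>j\<in>I. c n * c j * K n j) = c n * (\<Sum>i\<in>I. c i * K i n)"
      by (simp add: sum_distrib_left sym[of n] mult.assoc)
    moreover have "(\<Sum>i\<in>I. c i * c n * K i n) = c n * (\<Sum>i\<in>I. c i * K i n)"
      by (simp add: sum_distrib_left mult_ac)
    ultimately show ?thesis
      unfolding Q_def q_def using insert.hyps by (simp add: sum.distrib)
  qed
  have Q0: "Q (c(n := 0)) = q c" for c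
  proof -
    have "q (c(n := 0)) = q c"
      unfolding q_def using insert.hyps(2) by (intro sum.cong refl) auto
    then show ?thesis unfolding Q by simp
  qed
  have S0: "(\<Sum>i\<in>insert n I. (c(n := 0)) i * b i) = (\<Sum>i\<in>I. c i * b i)" for c b :: "'i \<Rightarrow> real"
    using insert.hyps by (simp, intro sum.cong) auto
  have Qnn: "0 \<le> Q c" for c using insert.prems(1) unfolding Q_def .
  have Qa: "(\<Sum>i\<in>insert n I. c i * a i)\<^sup>2 \<le> C * Q c" for c using insert.prems(2) unfolding Q_def .
  have qnn: "0 \<le> q c" for c using Qnn[of "c(n := 0)"] Q0 by simp
  have "\<exists>z. \<forall>i\<in>I. (\<Sum>j\<in>I. K i j * z j) = a i"
  proof (rule insert.IH)
    show "0 \<le> (\<Sum>i\<in>I. \<Sum>j\<in>I. c i * c j * K i j)" for c using qnn[of c] unfolding q_def .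
    show "(\<Sum>i\<in>I. c i * a i)\<^sup>2 \<le> C * (\<Sum>i\<in>I. \<Sum>j\<in>I. c i * c j * K i j)" for c
      using Qa[of "c(n := 0)"] unfolding S0 Q0 unfolding q_def .
  qed
  then obtain z where z: "\<And>i. i \<in> I \<Longrightarrow> (\<Sum>j\<in>I. K i j * z j) = a i" by blast
  \<comment> \<open>The new column is itself an admissible right-hand side: the enlarged form at (r
    c, 1) is a non-negative quadratic in r, and its discriminant is the required bound with constant
    \<open>K n n\<close>.\<close>
  have "\<exists>p. \<forall>i\<in>I. (\<Sum>j\<in>I. K i j * p j) = K i n"
  proof (rule insert.IH)
    show "0 \<le> (\<Sum>i\<in>I. \<Sum>j\<in>I. c i * c j * K i j)" for c using qnn[of c] unfolding q_def .
    show "(\<Sum>i\<in>I. c i * K i n)\<^sup>2 \<le> K n n * (\<Sum>i\<in>I. \<Sum>j\<in>I. c i * c j * K i j)" for c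
    proof -
      have "(\<Sum>i\<in>I. c i * K i n)\<^sup>2 \<le> q c * K n n"
      proof (rule quadratic_nonneg_imp_discriminant)
        fix r
        let ?d = "(\<lambda>i. r * c i)(n := 1)"
        have "q ?d = r\<^sup>2 * q c"
          unfolding q_def sum_distrib_left using insert.hyps(2)
          by (intro sum.cong refl) (auto simp: power2_eq_square)
        moreover have "(\<Sum>i\<in>I. ?d i * K i n) = r * (\<Sum>i\<in>I. c i * K i n)"
          unfolding sum_distrib_left using insert.hyps(2) by (intro sum.cong refl) auto
        ultimately have "Q ?d = q c * r\<^sup>2 + 2 * (\<Sum>i\<in>I. c i * K i n) * r + K n n"
          unfolding Q by simp
        then show "0 \<le> q c * r\<^sup>2 + 2 * (\<Sum>i\<in>I. c i * K i n) * r + K n n" using Qnn[of ?d] by simp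
      qed
      then show ?thesis unfolding q_def by (simp add: mult.commute)
    qed
  qed
  then obtain p where p: "\<And>i. i \<in> I \<Longrightarrow> (\<Sum>j\<in>I. K i j * p j) = K i n" by blast
  define e where "e = (\<lambda>i. - p i)(n := 1)"
  \<comment> \<open>\<open>l\<close> is the defect left in the new equation by the old solution, and
    \<open>v\<close> below is the Schur complement, which is the value of the form at the direction
    \<open>e\<close>. Moving along \<open>e\<close> changes the new equation and none of the old
    ones.\<close>
  define l where "l = a n - (\<Sum>i\<in>I. p i * a i)"
  define v where "v = K n n - (\<Sum>j\<in>I. K n j * p j)"
  have e_I: "(\<Sum>j\<in>I. f j * e j) = - (\<Sum>j\<in>I. f j * p j)" for f
    unfolding e_def sum_negf[symmetric] using insert.hyps(2) by (intro sum.cong) auto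
  have Ke: "(\<Sum>j\<in>insert n I. K i j * e j) = (if i = n then v else 0)" if "i \<in> insert n I" for i
  proof -
    have "(\<Sum>j\<in>insert n I. K i j * e j) = K i n - (\<Sum>j\<in>I. K i j * p j)"
      using insert.hyps by (simp add: e_I) (simp add: e_def)
    then show ?thesis using that p insert.hyps(2) by (auto simp: v_def)
  qed
  have "Q e = (\<Sum>i\<in>insert n I. e i * (\<Sum>j\<in>insert n I. K i j * e j))"
    unfolding Q_def sum_distrib_left by (intro sum.cong refl) (simp add: mult_ac)
  also have "\<dots> = (\<Sum>i\<in>insert n I. if i = n then v else 0)"
    by (rule sum.cong[OF refl]) (subst Ke, assumption, simp add: e_def)
  also have "\<dots> = v" using insert.hyps by simp
  finally have Qe: "Q e = v" .
  have "(\<Sum>i\<in>insert n I. e i * a i) = l"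
    using insert.hyps e_I[of a] unfolding l_def by (simp add: mult.commute) (simp add: e_def)
  then have lv: "l\<^sup>2 \<le> C * v" using Qa[of e] Qe by simp
  \<comment> \<open>In the singular case \<open>v = 0\<close> the bound forces \<open>l = 0\<close>,
    and division by zero yields the correction 0 that is wanted.\<close>
  have lv0: "l / v * v = l" using lv by (cases "v = 0") auto
  have z_n: "(\<Sum>j\<in>I. K n j * z j) = (\<Sum>i\<in>I. p i * a i)"
  proof -
    have "(\<Sum>j\<in>I. K n j * z j) = (\<Sum>j\<in>I. (\<Sum>i\<in>I. K j i * p i) * z j)"
      by (intro sum.cong refl) (simp add: p sym[of n])
    also have "\<dots> = (\<Sum>i\<in>I. p i * (\<Sum>j\<in>I. K i j * z j))"
      unfolding sum_distrib_left sum_distrib_right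
      by (subst sum.swap) (intro sum.cong refl, simp add: sym[of _ i for i] mult_ac)
    also have "\<dots> = (\<Sum>i\<in>I. p i * a i)" by (intro sum.cong refl) (simp add: z)
    finally show ?thesis .
  qed
  define y where "y i = (z(n := 0)) i + l / v * e i" for i
  have "(\<Sum>j\<in>insert n I. K i j * y j) = a i" if i: "i \<in> insert n I" for i
  proof -
    have "(\<Sum>j\<in>insert n I. K i j * y j) =
        (\<Sum>j\<in>insert n I. (z(n := 0)) j * K i j) + l / v * (\<Sum>j\<in>insert n I. K i j * e j)"
      unfolding y_def sum_distrib_left sum.distrib[symmetric]
      by (intro sum.cong refl) (simp add: algebra_simps)
    also have "\<dots> = (\<Sum>j\<in>I. K i j * z j) + l / v * (if i = n then v else 0)"
      unfolding S0 Ke[OF i] by (simp add: mult.commute)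
    also have "\<dots> = a i" using i z z_n lv0 insert.hyps(2) by (auto simp: l_def)
    finally show ?thesis .
  qed
  then show ?case by blast
qed

lemma fourier_normal_law:
  assumes v: "v \<ge> 0"
  shows "(\<integral>x. cis (t * x) \<partial>normal_law 0 v) = complex_of_real (exp (- (v * t\<^sup>2) / 2))"
proof (cases "v = 0")
  case True
  have [measurable]: "(\<lambda>x. cis (t * x)) \<in> borel_measurable borel" unfolding cis_conv_exp by measurable
  show ?thesis using True unfolding normal_law_def by (simp add: integral_return)
next
  case False
  define s where "s = sqrt v"
  have s: "s > 0" "s\<^sup>2 = v" unfolding s_def using v False by auto
  have [measurable]: "(\<lambda>x. cis (t * x)) \<in> borel_measurable borel" for t unfolding cis_conv_exp by measurable
  interpret N: prob_space std_normal_distribution by (rule prob_space_normal_density) simp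
  have "distributed std_normal_distribution lborel (\<lambda>x. x) std_normal_density"
    unfolding distributed_def by (auto simp: distr_id2)
  from N.normal_density_affine[OF this, of s 0] s
  have "distributed std_normal_distribution lborel (\<lambda>x. s * x) (normal_density 0 s)" by simp
  then have "density lborel (normal_density 0 s) = distr std_normal_distribution lborel (\<lambda>x. s * x)"
    by (simp add: distributed_distr_eq_density)
  then have "(\<integral>x. cis (t * x) \<partial>normal_law 0 v) = (\<integral>x. cis (t * x) \<partial>distr std_normal_distribution lborel (\<lambda>x. s * x))"
    using False unfolding normal_law_def s_def by simp
  also have "\<dots> = (\<integral>x. cis ((t * s) * x) \<partial>std_normal_distribution)"
    by (subst integral_distr) (auto simp: mult.assoc)
  also have "\<dots> = char std_normal_distribution (t * s)"
    unfolding char_def cis_conv_exp by simp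
  also have "\<dots> = complex_of_real (exp (- (v * t\<^sup>2) / 2))"
    unfolding char_std_normal_distribution using s by (simp add: power_mult_distrib mult.commute)
  finally show ?thesis .
qed

text \<open>With n(m) the density of mean m and variance s, completing the square gives n(s)^2 =
  n(0) e^s n(2 s), so the density ratio has second moment e^s. The bound integrates 2 n(s) \<le> r
  n(0) + n(s)^2 / (r n(0)). Shift and variance coincide because a Cameron-Martin shift moves its own
  linear functional by the variance of that functional.\<close>

lemma normal_law_shift_bound:
  assumes s: "s > 0" and r: "r > 0" and [measurable]: "E \<in> sets borel"
  shows "2 * emeasure (normal_law 0 s) ((\<lambda>x. x + s) -` E) \<le>
    ennreal r * emeasure (normal_law 0 s) E + ennreal (exp s / r)"
proof -
  define n where "n m x = normal_density m (sqrt s) x" for m x :: real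
  have n_def': "n m x = 1 / sqrt (2 * pi * s) * exp (- (x - m)\<^sup>2 / (2 * s))" for m x
    unfolding n_def normal_density_def using s by simp
  have [measurable]: "n m \<in> borel_measurable borel" for m unfolding n_def by measurable
  have n0: "n m x \<ge> 0" for m x unfolding n_def by simp
  have law: "normal_law 0 s = density lborel (\<lambda>x. ennreal (n 0 x))"
    unfolding normal_law_def n_def using s by simp
  have "(n s x)\<^sup>2 = n 0 x * (exp s * n (2 * s) x)" for x
  proof -
    have "- (x - s)\<^sup>2 / (2 * s) + - (x - s)\<^sup>2 / (2 * s) = - (x - 0)\<^sup>2 / (2 * s) + (s + - (x - 2 * s)\<^sup>2 / (2 * s))"
      using s by (simp add: field_simps power2_eq_square)
    then have "exp (- (x - s)\<^sup>2 / (2 * s)) * exp (- (x - s)\<^sup>2 / (2 * s)) =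
        exp (- (x - 0)\<^sup>2 / (2 * s)) * (exp s * exp (- (x - 2 * s)\<^sup>2 / (2 * s)))"
      unfolding exp_add[symmetric] by simp
    then show ?thesis unfolding n_def' power2_eq_square by (simp add: mult_ac)
  qed
  then have amgm: "2 * n s x \<le> r * n 0 x + exp s / r * n (2 * s) x" for x
  proof -
    define b where "b = r * n 0 x"
    define c where "c = exp s / r * n (2 * s) x"
    have bc: "0 \<le> b" "0 \<le> c" using r n0 unfolding b_def c_def by auto
    have "(n s x)\<^sup>2 = b * c"
      using \<open>(n s x)\<^sup>2 = n 0 x * (exp s * n (2 * s) x)\<close> r unfolding b_def c_def by simp
    moreover have "0 \<le> (b - c)\<^sup>2" by simp
    ultimately have "(2 * n s x)\<^sup>2 \<le> (b + c)\<^sup>2" by (simp add: power2_eq_square algebra_simps)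
    then show ?thesis unfolding b_def[symmetric] c_def[symmetric] using bc
      by - (rule power2_le_imp_le, auto)
  qed
  have shift_m: "(\<lambda>x. x + s) \<in> borel_measurable (borel :: real measure)" by measurable
  have [measurable]: "(\<lambda>x. x + s) -` E \<in> sets borel"
    using measurable_sets[OF shift_m \<open>E \<in> sets borel\<close>] by simp
  have "emeasure (normal_law 0 s) ((\<lambda>x. x + s) -` E) = (\<integral>\<^sup>+x. ennreal (n 0 x) * indicator E (x + s) \<partial>lborel)"
    unfolding law by (subst emeasure_density) (auto intro!: nn_integral_cong simp: indicator_def)
  also have "\<dots> = (\<integral>\<^sup>+x. ennreal (n s x) * indicator E x \<partial>lborel)"
    by (subst nn_integral_real_affine[of _ 1 "- s"])
      (auto intro!: nn_integral_cong simp: n_def' add.commute)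
  finally have "2 * emeasure (normal_law 0 s) ((\<lambda>x. x + s) -` E) =
      (\<integral>\<^sup>+x. ennreal (2 * n s x) * indicator E x \<partial>lborel)"
    by (subst ennreal_mult) (auto simp: n0 nn_integral_cmult mult.assoc)
  also have "\<dots> \<le> (\<integral>\<^sup>+x. ennreal r * (ennreal (n 0 x) * indicator E x) + ennreal (exp s / r) * ennreal (n (2 * s) x) \<partial>lborel)"
  proof (rule nn_integral_mono)
    fix x
    have "ennreal (2 * n s x) \<le> ennreal r * ennreal (n 0 x) + ennreal (exp s / r) * ennreal (n (2 * s) x)"
      using amgm[of x] r n0[of 0 x] n0[of "2 * s" x]
      by (subst ennreal_mult[symmetric], simp, simp)+ (simp add: ennreal_plus[symmetric] ennreal_leI del: ennreal_plus)
    then show "ennreal (2 * n s x) * indicator E x \<le>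
        ennreal r * (ennreal (n 0 x) * indicator E x) + ennreal (exp s / r) * ennreal (n (2 * s) x)"
      by (auto simp: indicator_def)
  qed
  also have "\<dots> = ennreal r * (\<integral>\<^sup>+x. ennreal (n 0 x) * indicator E x \<partial>lborel) +
      ennreal (exp s / r) * (\<integral>\<^sup>+x. ennreal (n (2 * s) x) \<partial>lborel)"
    by (subst nn_integral_add) (auto simp: nn_integral_cmult)
  also have "(\<integral>\<^sup>+x. ennreal (n (2 * s) x) \<partial>lborel) = 1"
    unfolding n_def using s by (subst nn_integral_eq_integral) auto
  finally show ?thesis unfolding law by (subst emeasure_density) auto
qed

lemma prod_measure_cis:
  assumes "prob_space M" and [measurable]: "f \<in> borel_measurable M" "g \<in> borel_measurable M"
  shows "(\<integral>x. cis (f (fst x) + g (snd x)) \<partial>(M \<Otimes>\<^sub>M M)) = (\<integral>x. cis (f x) \<partial>M) * (\<integral>x. cis (g x) \<partial>M)"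
proof -
  interpret prob_space M by fact
  interpret MM: pair_prob_space M M ..
  have fin: "finite_measure (M \<Otimes>\<^sub>M M)" by unfold_locales
  have int: "integrable (M \<Otimes>\<^sub>M M) (\<lambda>x. cis (f (fst x) + g (snd x)))"
    by (rule integrable_cis[OF fin]) measurable
  have "(\<integral>x. cis (f (fst x) + g (snd x)) \<partial>(M \<Otimes>\<^sub>M M)) = (\<integral>x. (\<integral>y. cis (f x + g y) \<partial>M) \<partial>M)"
    using MM.integral_fst'[OF int] by simp
  also have "\<dots> = (\<integral>x. cis (f x) * (\<integral>y. cis (g y) \<partial>M) \<partial>M)"
    by (simp add: cis_mult[symmetric])
  finally show ?thesis by simp
qed

lemma sum_mult_sum:
  fixes K :: "'i \<Rightarrow> 'i \<Rightarrow> real"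
  shows "(\<Sum>i\<in>I. \<Sum>j\<in>I. c i * d j * K i j) = (\<Sum>i\<in>I. c i * (\<Sum>j\<in>I. K i j * d j))"
  by (simp add: sum_distrib_left mult_ac)

text \<open>The Gaussian vector \<open>g\<close> has the same law as \<open>r(\<omega>') + (a / s) Z(\<omega>)\<close> on the product space, where
  \<open>Z = \<Sum>i. z i * g i\<close> has variance \<open>s\<close> and covariances \<open>a\<close> with \<open>g\<close>, and \<open>r = g - (a / s) Z\<close>. Hence the
  shift by \<open>a\<close> only shifts \<open>Z\<close> by \<open>s\<close>.\<close>

lemma finite_cameron_martin:
  fixes g :: "'i \<Rightarrow> 'w \<Rightarrow> real" and K :: "'i \<Rightarrow> 'i \<Rightarrow> real"
  assumes M: "prob_space M" and I: "finite I"
    and g[measurable]: "\<And>i. i \<in> I \<Longrightarrow> g i \<in> borel_measurable M"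
    and sym: "\<And>i j. K i j = K j i"
    and psd: "\<And>c. 0 \<le> (\<Sum>i\<in>I. \<Sum>j\<in>I. c i * c j * K i j)"
    and fourier: "\<And>c. (\<integral>\<omega>. cis (\<Sum>i\<in>I. c i * g i \<omega>) \<partial>M) =
      complex_of_real (exp (- (\<Sum>i\<in>I. \<Sum>j\<in>I. c i * c j * K i j) / 2))"
    and bound: "\<And>c. (\<Sum>i\<in>I. c i * a i)\<^sup>2 \<le> C * (\<Sum>i\<in>I. \<Sum>j\<in>I. c i * c j * K i j)"
    and C: "C \<ge> 0" and r: "r > 0" and B[measurable]: "B \<in> sets (\<Pi>\<^sub>M i\<in>I. borel)"
  shows "2 * emeasure M {\<omega> \<in> space M. (\<lambda>i\<in>I. g i \<omega> + a i) \<in> B} \<le>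
    ennreal r * emeasure M {\<omega> \<in> space M. (\<lambda>i\<in>I. g i \<omega>) \<in> B} + ennreal (exp C / r)"
proof -
  interpret prob_space M by fact
  define q where "q c d = (\<Sum>i\<in>I. \<Sum>j\<in>I. c i * d j * K i j)" for c d
  obtain z where z: "\<And>i. i \<in> I \<Longrightarrow> (\<Sum>j\<in>I. K i j * z j) = a i"
    using psd_system_solvable[OF I sym psd bound] by blast
  have qz: "q c z = (\<Sum>i\<in>I. c i * a i)" for c
    unfolding q_def sum_mult_sum by (intro sum.cong refl) (simp add: z)
  have q_sym: "q c d = q d c" for c d
    unfolding q_def by (subst sum.swap) (simp add: sym mult_ac)
  have q_lin: "q (\<lambda>i. c i + t * d i) (\<lambda>i. c i + t * d i) = q c c + 2 * t * q c d + t\<^sup>2 * q d d" for c d t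
  proof -
    have "q (\<lambda>i. c i + t * d i) (\<lambda>i. c i + t * d i) = q c c + t * q c d + t * q d c + t\<^sup>2 * q d d"
      unfolding q_def sum_distrib_left sum.distrib[symmetric]
      by (intro sum.cong refl) (simp add: power2_eq_square algebra_simps)
    then show ?thesis using q_sym[of c d] by simp
  qed
  define s where "s = q z z"
  have s0: "s \<ge> 0" unfolding s_def q_def by (rule psd)
  \<comment> \<open>Testing the bound at \<open>z\<close> reads s^2 \<le> C s. Here the variance,
    which depends on the projection, is replaced by a constant that does not.\<close>
  have sC: "s \<le> C"
  proof (cases "s = 0")
    case False
    have "s\<^sup>2 \<le> C * s" using bound[of z] qz[of z] unfolding s_def q_def by simp
    then show ?thesis using False s0 by (simp add: power2_eq_square)
  qed (use C in simp)
  show ?thesis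
  proof (cases "s = 0")
    \<comment> \<open>If the variance vanishes, Cauchy-Schwarz makes the shift zero, and what
      remains is 2 \<le> r + 1 / r multiplied by a probability.\<close>
    case True
    have a0: "a i = 0" if i: "i \<in> I" for i
    proof -
      define c where "c j = (if j = i then 1 else 0 :: real)" for j
      have "(q c z)\<^sup>2 \<le> s * q c c"
      proof (rule quadratic_nonneg_imp_discriminant)
        show "0 \<le> s * t\<^sup>2 + 2 * q c z * t + q c c" for t
          using psd[of "\<lambda>i. c i + t * z i"] q_lin[of c t z] unfolding q_def[symmetric] s_def
          by (simp add: algebra_simps)
      qed
      moreover have "q c z = a i"
        unfolding qz c_def using I i by (simp add: if_distrib[of "\<lambda>x. x * _"] cong: if_cong)
      ultimately show ?thesis using True by simp
    qed
    define p where "p = measure M {\<omega> \<in> space M. (\<lambda>i\<in>I. g i \<omega>) \<in> B}"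
    have "{\<omega> \<in> space M. (\<lambda>i\<in>I. g i \<omega> + a i) \<in> B} = {\<omega> \<in> space M. (\<lambda>i\<in>I. g i \<omega>) \<in> B}"
      using a0 by (auto intro!: arg_cong2[where f="(\<in>)"] restrict_ext cong: restrict_cong)
    moreover have "2 * p \<le> r * p + exp C / r"
    proof -
      have p01: "0 \<le> p" "p \<le> 1" unfolding p_def by auto
      have "0 \<le> (r - 1)\<^sup>2 * p" using p01 by simp
      then have "2 * p * r \<le> r * p * r + p" by (simp add: power2_eq_square algebra_simps)
      moreover have "p \<le> exp C" using p01 C one_le_exp_iff[of C] by linarith
      ultimately have "2 * p * r \<le> r * p * r + exp C" by linarith
      then show ?thesis using r by (simp add: field_simps)
    qed
    then have "ennreal (2 * p) \<le> ennreal (r * p + exp C / r)" by (rule ennreal_leI)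
    then have "2 * ennreal p \<le> ennreal r * ennreal p + ennreal (exp C / r)"
      using r p_def by (simp add: ennreal_mult ennreal_plus)
    ultimately show ?thesis unfolding emeasure_eq_measure p_def by simp
  next
    case False
    then have s: "s > 0" using s0 by simp
    define Z where "Z \<omega> = (\<Sum>j\<in>I. z j * g j \<omega>)" for \<omega>
    have Z[measurable]: "Z \<in> borel_measurable M" unfolding Z_def by measurable
    define R where "R i \<omega> = g i \<omega> - a i / s * Z \<omega>" for i \<omega>
    have R[measurable]: "R i \<in> borel_measurable M" if "i \<in> I" for i
      using that unfolding R_def by measurable
    define Y where "Y i x = R i (fst x) + a i / s * Z (snd x)" for i and x :: "'w \<times> 'w"
    have Y[measurable]: "Y i \<in> borel_measurable (M \<Otimes>\<^sub>M M)" if "i \<in> I" for i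
      using that unfolding Y_def by measurable
    have fin2: "finite_measure (M \<Otimes>\<^sub>M M)"
    proof -
      interpret MM: pair_prob_space M M ..
      show ?thesis by unfold_locales
    qed
    have law: "distr M (\<Pi>\<^sub>M i\<in>I. borel) (\<lambda>\<omega>. \<lambda>i\<in>I. g i \<omega>) =
        distr (M \<Otimes>\<^sub>M M) (\<Pi>\<^sub>M i\<in>I. borel) (\<lambda>x. \<lambda>i\<in>I. Y i x)"
    proof (rule finite_family_distr_eqI_fourier[OF I _ fin2])
      show "finite_measure M" by unfold_locales
      fix c
      \<comment> \<open>\<open>m\<close> is the regression coefficient of the combination with
        weights \<open>c\<close> on \<open>Z\<close>. The remaining weights \<open>c'\<close> are
        uncorrelated with \<open>Z\<close>, so the two variances add up to the original one, and the
        independent copy of \<open>Z\<close> has the same effect as \<open>Z\<close> itself.\<close>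
      define m where "m = (\<Sum>i\<in>I. c i * a i) / s"
      define c' where "c' i = c i + (- m) * z i" for i
      have split: "(\<Sum>i\<in>I. c i * Y i x) = (\<Sum>i\<in>I. c' i * g i (fst x)) + (\<Sum>i\<in>I. (m * z i) * g i (snd x))" for x
      proof -
        have "(\<Sum>i\<in>I. c i * Y i x) = (\<Sum>i\<in>I. c i * g i (fst x)) - m * Z (fst x) + m * Z (snd x)"
          unfolding Y_def R_def m_def sum_divide_distrib sum_distrib_right sum.distrib[symmetric] sum_subtractf[symmetric]
          by (intro sum.cong refl) (simp add: algebra_simps)
        moreover have "m * Z \<omega> = (\<Sum>i\<in>I. (m * z i) * g i \<omega>)" for \<omega>
          unfolding Z_def sum_distrib_left by (simp add: mult.assoc)
        ultimately show ?thesis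
          unfolding c'_def by (simp add: left_diff_distrib sum_subtractf)
      qed
      have "(\<integral>x. cis (\<Sum>i\<in>I. c i * Y i x) \<partial>(M \<Otimes>\<^sub>M M)) =
          (\<integral>\<omega>. cis (\<Sum>i\<in>I. c' i * g i \<omega>) \<partial>M) * (\<integral>\<omega>. cis (\<Sum>i\<in>I. (m * z i) * g i \<omega>) \<partial>M)"
        unfolding split by (rule prod_measure_cis[OF M]) measurable
      also have "\<dots> = complex_of_real (exp (- q c' c' / 2) * exp (- q (\<lambda>i. m * z i) (\<lambda>i. m * z i) / 2))"
        unfolding fourier q_def by simp
      also have "exp (- q c' c' / 2) * exp (- q (\<lambda>i. m * z i) (\<lambda>i. m * z i) / 2) = exp (- q c c / 2)"
      proof -
        have "q c' c' = q c c - 2 * m * (m * s) + m\<^sup>2 * s"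
          unfolding c'_def q_lin s_def[symmetric] unfolding qz m_def using s by simp
        moreover have "q (\<lambda>i. m * z i) (\<lambda>i. m * z i) = m\<^sup>2 * s"
          unfolding q_def s_def sum_distrib_left by (simp add: power2_eq_square mult_ac)
        ultimately have "q c' c' + q (\<lambda>i. m * z i) (\<lambda>i. m * z i) = q c c"
          by (simp add: power2_eq_square)
        then show ?thesis by (simp add: exp_add[symmetric] field_simps)
      qed
      finally show "(\<integral>\<omega>. cis (\<Sum>i\<in>I. c i * g i \<omega>) \<partial>M) = (\<integral>x. cis (\<Sum>i\<in>I. c i * Y i x) \<partial>(M \<Otimes>\<^sub>M M))"
        unfolding fourier q_def by simp
    qed (use g Y in auto)
    have lawZ: "distr M borel Z = normal_law 0 s"
    proof (rule finite_measure_eqI_fourier)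
      show "finite_measure (distr M borel Z)" by (rule finite_measure_distr) measurable
      show "finite_measure (normal_law 0 s)"
        unfolding normal_law_def using s prob_space_normal_density[of "sqrt s" 0]
        by (simp add: prob_space.finite_measure)
      show "sets (normal_law 0 s) = sets borel" unfolding normal_law_def by simp
      fix t
      have [measurable]: "(\<lambda>x. cis (t * x)) \<in> borel_measurable borel" unfolding cis_conv_exp by measurable
      have "(\<integral>x. cis (t * x) \<partial>distr M borel Z) = (\<integral>\<omega>. cis (\<Sum>i\<in>I. (t * z i) * g i \<omega>) \<partial>M)"
        by (subst integral_distr) (auto simp: Z_def sum_distrib_left mult.assoc)
      also have "\<dots> = complex_of_real (exp (- (t\<^sup>2 * s) / 2))"
        unfolding fourier s_def q_def sum_distrib_left by (simp add: power2_eq_square mult_ac)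
      finally show "(\<integral>x. cis (t * x) \<partial>distr M borel Z) = (\<integral>x. cis (t * x) \<partial>normal_law 0 s)"
        using fourier_normal_law[OF s0, of t] by (simp add: mult.commute)
    qed simp
    define E where "E \<omega> = {x. (\<lambda>i\<in>I. R i \<omega> + a i / s * x) \<in> B}" for \<omega>
    have E[measurable]: "E \<omega> \<in> sets borel" for \<omega>
    proof -
      have "(\<lambda>x. \<lambda>i\<in>I. R i \<omega> + a i / s * x) \<in> measurable borel (\<Pi>\<^sub>M i\<in>I. borel)"
        by (intro measurable_restrict) measurable
      from measurable_sets[OF this B] show ?thesis unfolding E_def by (simp add: vimage_def)
    qed
    have one: "2 * emeasure M {\<omega>'. \<omega>' \<in> space M \<and> Z \<omega>' + s \<in> E \<omega>} \<le>
        ennreal r * emeasure M {\<omega>'. \<omega>' \<in> space M \<and> Z \<omega>' \<in> E \<omega>} + ennreal (exp C / r)" for \<omega>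
    proof -
      have "emeasure (normal_law 0 s) F = emeasure M {\<omega>'. \<omega>' \<in> space M \<and> Z \<omega>' \<in> F}"
        if "F \<in> sets borel" for F
        unfolding lawZ[symmetric] using that
        by (subst emeasure_distr) (auto intro!: arg_cong[where f="emeasure M"])
      moreover have "(\<lambda>x. x + s) -` E \<omega> \<in> sets borel"
      proof -
        have "(\<lambda>x. x + s) \<in> borel_measurable (borel :: real measure)" by measurable
        from measurable_sets[OF this E] show ?thesis by simp
      qed
      ultimately have "2 * emeasure M {\<omega>'. \<omega>' \<in> space M \<and> Z \<omega>' + s \<in> E \<omega>} \<le>
        ennreal r * emeasure M {\<omega>'. \<omega>' \<in> space M \<and> Z \<omega>' \<in> E \<omega>} + ennreal (exp s / r)"
        using normal_law_shift_bound[OF s r E, of \<omega>] by simp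
      also have "\<dots> \<le> ennreal r * emeasure M {\<omega>'. \<omega>' \<in> space M \<and> Z \<omega>' \<in> E \<omega>} + ennreal (exp C / r)"
        using sC r by (intro add_left_mono ennreal_leI divide_right_mono) auto
      finally show ?thesis .
    qed
    have slice: "emeasure M {\<omega> \<in> space M. (\<lambda>i\<in>I. g i \<omega> + b i) \<in> B} =
        (\<integral>\<^sup>+\<omega>. emeasure M {\<omega>'. \<omega>' \<in> space M \<and> (\<lambda>i\<in>I. R i \<omega> + a i / s * Z \<omega>' + b i) \<in> B} \<partial>M)" for b
    proof -
      let ?T = "\<lambda>x. \<lambda>i\<in>I. x i + b i"
      have T[measurable]: "?T \<in> measurable (\<Pi>\<^sub>M i\<in>I. borel) (\<Pi>\<^sub>M i\<in>I. (borel :: real measure))"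
        by (intro measurable_restrict) measurable
      have gm: "(\<lambda>\<omega>. \<lambda>i\<in>I. g i \<omega>) \<in> measurable M (\<Pi>\<^sub>M i\<in>I. borel)"
        by (intro measurable_restrict) measurable
      have ym: "(\<lambda>x. \<lambda>i\<in>I. Y i x) \<in> measurable (M \<Otimes>\<^sub>M M) (\<Pi>\<^sub>M i\<in>I. borel)"
        by (intro measurable_restrict) measurable
      let ?P = "\<Pi>\<^sub>M i\<in>I. (borel :: real measure)"
      have TB: "?T -` B \<inter> space ?P \<in> sets ?P" by (rule measurable_sets[OF T B])
      have rT: "(\<lambda>i\<in>I. (if i \<in> I then h i else undefined) + b i) = (\<lambda>i\<in>I. h i + b i)"
        for h :: "'i \<Rightarrow> real" by (rule restrict_ext) simp
      have sp: "(\<lambda>i\<in>I. h i) \<in> space ?P" for h :: "'i \<Rightarrow> real" by (auto simp: space_PiM)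
      have "emeasure M {\<omega> \<in> space M. (\<lambda>i\<in>I. g i \<omega> + b i) \<in> B} =
          emeasure (distr M ?P (\<lambda>\<omega>. \<lambda>i\<in>I. g i \<omega>)) (?T -` B \<inter> space ?P)"
        by (subst emeasure_distr[OF gm TB]) (auto intro!: arg_cong[where f="emeasure M"] simp: rT sp)
      also have "\<dots> = emeasure (M \<Otimes>\<^sub>M M) {x \<in> space (M \<Otimes>\<^sub>M M). (\<lambda>i\<in>I. Y i x + b i) \<in> B}"
        unfolding law by (subst emeasure_distr[OF ym TB])
          (auto intro!: arg_cong[where f="emeasure (M \<Otimes>\<^sub>M M)"] simp: rT sp)
      also have "\<dots> = (\<integral>\<^sup>+\<omega>. emeasure M (Pair \<omega> -` {x \<in> space (M \<Otimes>\<^sub>M M). (\<lambda>i\<in>I. Y i x + b i) \<in> B}) \<partial>M)"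
      proof (rule emeasure_pair_measure_alt)
        have "(\<lambda>x. \<lambda>i\<in>I. Y i x + b i) \<in> measurable (M \<Otimes>\<^sub>M M) ?P"
          by (intro measurable_restrict) measurable
        from measurable_sets[OF this B]
        show "{x \<in> space (M \<Otimes>\<^sub>M M). (\<lambda>i\<in>I. Y i x + b i) \<in> B} \<in> sets (M \<Otimes>\<^sub>M M)"
          by (simp add: vimage_def Int_def conj_commute)
      qed
      also have "\<dots> = (\<integral>\<^sup>+\<omega>. emeasure M {\<omega>'. \<omega>' \<in> space M \<and> (\<lambda>i\<in>I. R i \<omega> + a i / s * Z \<omega>' + b i) \<in> B} \<partial>M)"
        by (intro nn_integral_cong arg_cong[where f="emeasure M"])
          (auto simp: space_pair_measure Y_def)
      finally show ?thesis .
    qed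
    have sl0: "emeasure M {\<omega> \<in> space M. (\<lambda>i\<in>I. g i \<omega>) \<in> B} =
        (\<integral>\<^sup>+\<omega>. emeasure M {\<omega>'. \<omega>' \<in> space M \<and> Z \<omega>' \<in> E \<omega>} \<partial>M)"
      using slice[of "\<lambda>_. 0"] unfolding E_def by simp
    \<comment> \<open>Adding \<open>a\<close> to R + (a / s) Z is the same as adding
      \<open>s\<close> to Z, so the residual in the slice \<open>E\<close> is untouched.\<close>
    have sl1: "emeasure M {\<omega> \<in> space M. (\<lambda>i\<in>I. g i \<omega> + a i) \<in> B} =
        (\<integral>\<^sup>+\<omega>. emeasure M {\<omega>'. \<omega>' \<in> space M \<and> Z \<omega>' + s \<in> E \<omega>} \<partial>M)"
      using slice[of a] s unfolding E_def by (simp add: distrib_left add.assoc add_divide_distrib)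
    have Em: "(\<lambda>\<omega>. emeasure M {\<omega>'. \<omega>' \<in> space M \<and> Z \<omega>' + b \<in> E \<omega>}) \<in> borel_measurable M" for b
    proof -
      have "(\<lambda>x. \<lambda>i\<in>I. R i (fst x) + a i / s * (Z (snd x) + b)) \<in> measurable (M \<Otimes>\<^sub>M M) (\<Pi>\<^sub>M i\<in>I. borel)"
        by (intro measurable_restrict) measurable
      from measurable_sets[OF this B]
      have "{x \<in> space (M \<Otimes>\<^sub>M M). Z (snd x) + b \<in> E (fst x)} \<in> sets (M \<Otimes>\<^sub>M M)"
        unfolding E_def by (simp add: vimage_def Int_def conj_commute)
      from measurable_emeasure_Pair[OF this] show ?thesis
        by (rule measurable_cong[THEN iffD1, rotated])
          (auto intro!: arg_cong[where f="emeasure M"] simp: space_pair_measure)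
    qed
    have "2 * emeasure M {\<omega> \<in> space M. (\<lambda>i\<in>I. g i \<omega> + a i) \<in> B} =
        (\<integral>\<^sup>+\<omega>. 2 * emeasure M {\<omega>'. \<omega>' \<in> space M \<and> Z \<omega>' + s \<in> E \<omega>} \<partial>M)"
      unfolding sl1 using Em by (subst nn_integral_cmult) auto
    also have "\<dots> \<le> (\<integral>\<^sup>+\<omega>. ennreal r * emeasure M {\<omega>'. \<omega>' \<in> space M \<and> Z \<omega>' \<in> E \<omega>} + ennreal (exp C / r) \<partial>M)"
      by (intro nn_integral_mono one)
    also have "\<dots> = ennreal r * emeasure M {\<omega> \<in> space M. (\<lambda>i\<in>I. g i \<omega>) \<in> B} + ennreal (exp C / r)"
      unfolding sl0 using Em[of 0] by (subst nn_integral_add) (auto simp: nn_integral_cmult emeasure_space_1)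
    finally show ?thesis .
  qed
qed

section \<open>From cylinder sets to Borel sets\<close>

text \<open>The bound passes from cylinder sets to open sets, which are increasing unions of them, and outer
  regularity gives small open neighbourhoods of null sets.\<close>

lemma cylinder_bound_imp_absolutely_continuous:
  fixes \<mu> \<nu> :: "('i::countable \<Rightarrow> real) measure"
  assumes fin: "finite_measure \<mu>" "finite_measure \<nu>"
    and sets: "sets \<mu> = sets borel" "sets \<nu> = sets borel"
    and E: "E \<ge> 0"
    and bound: "\<And>I B r. finite I \<Longrightarrow> B \<in> sets (\<Pi>\<^sub>M i\<in>I. borel) \<Longrightarrow> r > 0 \<Longrightarrow>
      2 * measure \<mu> {x. restrict x I \<in> B} \<le> r * measure \<nu> {x. restrict x I \<in> B} + E / r"
  shows "absolutely_continuous \<nu> \<mu>"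
proof -
  interpret \<mu>: finite_measure \<mu> by fact
  interpret \<nu>: finite_measure \<nu> by fact
  have open_bound: "2 * measure \<mu> U \<le> r * measure \<nu> U + E / r"
    if U: "open U" and r: "r > 0" for U :: "('i \<Rightarrow> real) set" and r
  proof -
    obtain \<K> :: "('i \<Rightarrow> real) set set" where \<K>: "topological_basis \<K>" "countable \<K>"
      "\<And>k. k \<in> \<K> \<Longrightarrow> \<exists>X. (k = Pi\<^sub>E UNIV X) \<and> (\<forall>i. open (X i)) \<and> finite {i. X i \<noteq> UNIV}"
      using product_topology_countable_basis by fast
    obtain \<B> where \<B>: "\<B> \<subseteq> \<K>" "U = \<Union>\<B>"
      using U \<K>(1) by (metis topological_basis_def)
    show ?thesis
    proof (cases "\<B> = {}")
      case True
      then show ?thesis using \<B>(2) E r by simp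
    next
      case False
      define f where "f = from_nat_into \<B>"
      have "countable \<B>" using \<B>(1) \<K>(2) countable_subset by blast
      then have range_f: "range f = \<B>" unfolding f_def using False by (rule range_from_nat_into[rotated])
      have "\<exists>X. \<forall>k. (f k = Pi\<^sub>E UNIV (X k)) \<and> (\<forall>i. open (X k i)) \<and> finite {i. X k i \<noteq> UNIV}"
        by (rule choice) (use \<K>(3) range_f \<B>(1) in blast)
      then obtain X where X: "\<And>k. f k = Pi\<^sub>E UNIV (X k)" "\<And>k i. open (X k i)" "\<And>k. finite {i. X k i \<noteq> UNIV}"
        by blast
      define C where "C n = (\<Union>k\<in>{..n}. f k)" for n :: nat
      have "C n \<in> sets borel" for n
      proof -
        have "open (f k)" for k using \<K>(1) range_f \<B>(1) by (metis rangeI subsetD topological_basis_open)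
        then show ?thesis unfolding C_def by auto
      qed
      then have Cs: "range C \<subseteq> sets \<mu>" "range C \<subseteq> sets \<nu>" using sets by auto
      have inc: "incseq C" unfolding C_def incseq_def by force
      have U_eq: "(\<Union>n. C n) = U" unfolding C_def \<B>(2) range_f[symmetric] by auto
      have Cn: "2 * measure \<mu> (C n) \<le> r * measure \<nu> U + E / r" for n
      proof -
        \<comment> \<open>A finite union of basic open sets depends only on the finitely many
          coordinates at which some factor is proper, hence is a cylinder set.\<close>
        define I where "I = (\<Union>k\<in>{..n}. {i. X k i \<noteq> UNIV})"
        define B where "B = (\<Union>k\<in>{..n}. Pi\<^sub>E I (X k))"
        have I: "finite I" unfolding I_def using X(3) by auto
        have B: "B \<in> sets (\<Pi>\<^sub>M i\<in>I. borel)"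
          unfolding B_def using I X(2) by (intro sets.finite_UN sets_PiM_I_finite) auto
        have "restrict x I \<in> Pi\<^sub>E I (X k) \<longleftrightarrow> x \<in> f k" if "k \<le> n" for x k
        proof -
          have "i \<in> I" if "X k i \<noteq> UNIV" for i using that \<open>k \<le> n\<close> unfolding I_def by blast
          then show ?thesis unfolding X(1) by (auto simp: PiE_iff)
        qed
        then have eq: "{x. restrict x I \<in> B} = C n" unfolding B_def C_def by auto
        have "measure \<nu> (C n) \<le> measure \<nu> U"
          unfolding U_eq[symmetric] using Cs by (intro \<nu>.finite_measure_mono) auto
        then have "r * measure \<nu> (C n) \<le> r * measure \<nu> U" using r by simp
        then show ?thesis using bound[OF I B r] unfolding eq by linarith
      qed
      have "(\<lambda>n. 2 * measure \<mu> (C n)) \<longlonglongrightarrow> 2 * measure \<mu> U"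
        unfolding U_eq[symmetric] by (intro tendsto_intros \<mu>.finite_Lim_measure_incseq Cs inc)
      then show ?thesis by (rule LIMSEQ_le_const2) (use Cn in blast)
    qed
  qed
  show ?thesis
    unfolding absolutely_continuous_def
  proof
    fix A assume A: "A \<in> null_sets \<nu>"
    then have As: "A \<in> sets borel" "emeasure \<nu> A = 0" using sets by auto
    have small: "2 * measure \<mu> A \<le> (1 + E) * (1 / real (Suc n))" for n
    proof -
      define r where "r = real (Suc n)"
      have r: "r > 0" unfolding r_def by simp
      have "emeasure \<nu> A = (INF U\<in>{U. A \<subseteq> U \<and> open U}. emeasure \<nu> U)"
        by (rule outer_regular) (use sets As \<nu>.emeasure_finite in auto)
      \<comment> \<open>The radius of the approximation is tied to \<open>r\<close>: a neighbourhood
        of measure below 1 / r^2 makes the first term of the bound as small as the second, and both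
        vanish as r grows.\<close>
      then have "(INF U\<in>{U. A \<subseteq> U \<and> open U}. emeasure \<nu> U) < ennreal (1 / r\<^sup>2)"
        using As r by simp
      then obtain U where U: "A \<subseteq> U" "open U" "emeasure \<nu> U < ennreal (1 / r\<^sup>2)"
        unfolding INF_less_iff by blast
      have "measure \<nu> U < 1 / r\<^sup>2"
        using U(3) by (simp add: \<nu>.emeasure_eq_measure ennreal_less_iff)
      then have "r * measure \<nu> U \<le> r * (1 / r\<^sup>2)"
        using r by (intro mult_left_mono less_imp_le)
      also have "\<dots> = 1 / r" using r by (simp add: power2_eq_square)
      finally have 1: "r * measure \<nu> U \<le> 1 / r" .
      have "measure \<mu> A \<le> measure \<mu> U"
        using U sets by (intro \<mu>.finite_measure_mono) auto
      then have "2 * measure \<mu> A \<le> 1 / r + E / r" using open_bound[OF U(2) r] 1 by linarith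
      also have "\<dots> = (1 + E) * (1 / r)" by (simp add: add_divide_distrib)
      finally show ?thesis unfolding r_def .
    qed
    have "(\<lambda>n. (1 + E) * (1 / real (Suc n))) \<longlonglongrightarrow> (1 + E) * 0"
      by (intro tendsto_intros LIMSEQ_Suc[OF lim_1_over_n])
    then have "2 * measure \<mu> A \<le> (1 + E) * 0" by (rule LIMSEQ_le_const) (use small in auto)
    then have "measure \<mu> A = 0" using measure_nonneg[of \<mu> A] by linarith
    then show "A \<in> null_sets \<mu>" using As sets by (auto simp: \<mu>.emeasure_eq_measure)
  qed
qed

section \<open>Testing vectors against a dense sequence\<close>

lemma norm_le_iff_inner_dense:
  fixes x :: "nat \<Rightarrow> 'h::real_inner"
  assumes dense: "\<And>U. open U \<Longrightarrow> U \<noteq> {} \<Longrightarrow> \<exists>j. x j \<in> U" and r: "r \<ge> 0"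
  shows "norm y \<le> r \<longleftrightarrow> (\<forall>j. x j \<bullet> y \<le> r * norm (x j))"
proof
  assume "norm y \<le> r"
  show "\<forall>j. x j \<bullet> y \<le> r * norm (x j)"
  proof
    fix j
    have "x j \<bullet> y \<le> norm (x j) * norm y" by (rule norm_cauchy_schwarz)
    also have "\<dots> \<le> norm (x j) * r" using \<open>norm y \<le> r\<close> by (intro mult_left_mono) auto
    finally show "x j \<bullet> y \<le> r * norm (x j)" by (simp add: mult.commute)
  qed
next
  assume *: "\<forall>j. x j \<bullet> y \<le> r * norm (x j)"
  \<comment> \<open>The inequality extends from the dense sequence to all vectors by continuity and
    is then read at \<open>y\<close> itself.\<close>
  let ?F = "{z. z \<bullet> y \<le> r * norm z}"
  have "closed ?F" by (intro closed_Collect_le continuous_intros)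
  have "?F = UNIV"
  proof (rule ccontr)
    assume "?F \<noteq> UNIV"
    then have "- ?F \<noteq> {}" by blast
    then obtain j where "x j \<in> - ?F" using dense[of "- ?F"] \<open>closed ?F\<close> by (auto simp: open_Compl)
    then show False using * by auto
  qed
  then have "y \<in> ?F" by (metis UNIV_I)
  then have "norm y * norm y \<le> r * norm y" by (simp add: dot_square_norm power2_eq_square)
  then show "norm y \<le> r" using r by (cases "y = 0") auto
qed

text \<open>Weak measurability implies Borel measurability in a separable space: closed balls are
  countable intersections of conditions on inner products, and open sets are countable unions of
  such balls.\<close>

lemma borel_measurable_inner_dense:
  fixes x :: "nat \<Rightarrow> 'h::real_inner" and f :: "'a \<Rightarrow> 'h"
  assumes dense: "\<And>U. open U \<Longrightarrow> U \<noteq> {} \<Longrightarrow> \<exists>j. x j \<in> U"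
    and f: "\<And>j. (\<lambda>a. x j \<bullet> f a) \<in> borel_measurable M"
  shows "f \<in> borel_measurable M"
proof (rule borel_measurableI)
  fix U :: "'h set" assume U: "open U"
  have cb: "{a \<in> space M. f a \<in> cball z r} \<in> sets M" if r: "r \<ge> 0" for z r
  proof -
    have "f a \<in> cball z r \<longleftrightarrow> (\<forall>j. x j \<bullet> f a - x j \<bullet> z \<le> r * norm (x j))" for a
      using norm_le_iff_inner_dense[of x r "f a - z"] dense r
      by (simp add: dist_norm norm_minus_commute inner_diff_right)
    then have "{a \<in> space M. f a \<in> cball z r} = {a \<in> space M. \<forall>j. x j \<bullet> f a - x j \<bullet> z \<le> r * norm (x j)}"
      by simp
    moreover have "\<dots> \<in> sets M" using f by measurable
    ultimately show ?thesis by simp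
  qed
  define P where "P = {p. cball (x (fst p)) (1 / real (Suc (snd p))) \<subseteq> U}"
  have "f -` U \<inter> space M = (\<Union>p\<in>P. {a \<in> space M. f a \<in> cball (x (fst p)) (1 / real (Suc (snd p)))})"
  proof (intro equalityI subsetI)
    fix a assume a: "a \<in> f -` U \<inter> space M"
    then obtain e where e: "e > 0" "ball (f a) e \<subseteq> U" using U open_contains_ball by blast
    obtain m where m: "1 / real (Suc m) < e / 2" using nat_approx_posE[of "e / 2"] e(1) by auto
    obtain j where j: "x j \<in> ball (f a) (1 / real (Suc m))"
      using dense[of "ball (f a) (1 / real (Suc m))"] by auto
    have "cball (x j) (1 / real (Suc m)) \<subseteq> ball (f a) e"
    proof
      fix y assume "y \<in> cball (x j) (1 / real (Suc m))"
      then show "y \<in> ball (f a) e" using j m dist_triangle[of "f a" y "x j"] by auto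
    qed
    then have "(j, m) \<in> P" using e(2) unfolding P_def by auto
    moreover have "f a \<in> cball (x j) (1 / real (Suc m))" using j by (simp add: dist_commute less_imp_le)
    ultimately show "a \<in> (\<Union>p\<in>P. {a \<in> space M. f a \<in> cball (x (fst p)) (1 / real (Suc (snd p)))})"
      using a by (intro UN_I[of "(j, m)"]) auto
  qed (auto simp: P_def)
  moreover have "\<dots> \<in> sets M" by (intro sets.countable_UN'' cb) auto
  ultimately show "f -` U \<inter> space M \<in> sets M" by simp
qed

lemma dense_sequence_exists:
  "\<exists>x :: nat \<Rightarrow> 'h::second_countable_topology. \<forall>U. open U \<longrightarrow> U \<noteq> {} \<longrightarrow> (\<exists>j. x j \<in> U)"
proof -
  obtain D :: "'h set" where D: "countable D" "\<And>U. open U \<Longrightarrow> U \<noteq> {} \<Longrightarrow> \<exists>d\<in>D. d \<in> U"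
    using countable_dense_setE by blast
  have "D \<noteq> {}" using D(2)[of UNIV] by auto
  then have "range (from_nat_into D) = D" using D(1) by (rule range_from_nat_into)
  then show ?thesis using D(2) by (metis rangeE)
qed

section \<open>Shifts of the Wiener process\<close>

lemma L2_space_facts:
  fixes u :: "real \<Rightarrow> 'h::{real_inner, banach, second_countable_topology}"
  assumes u: "u \<in> L2_space T"
  defines "v \<equiv> \<lambda>s. indicator {0..T} s *\<^sub>R u s"
  shows "v \<in> borel_measurable lborel" "integrable lborel (\<lambda>s. (norm (v s))\<^sup>2)" "integrable lborel v"
proof -
  show m: "v \<in> borel_measurable lborel"
    using u unfolding L2_space_def set_borel_measurable_def v_def by simp
  have "(\<lambda>s. (norm (v s))\<^sup>2) = (\<lambda>s. indicator {0..T} s *\<^sub>R (norm (u s))\<^sup>2)"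
    unfolding v_def by (auto simp: indicator_def)
  then show i2: "integrable lborel (\<lambda>s. (norm (v s))\<^sup>2)"
    using u unfolding L2_space_def set_integrable_def by simp
  have "integrable lborel (\<lambda>s. indicator {0..T} s + (norm (v s))\<^sup>2)"
    using i2 by (intro Bochner_Integration.integrable_add integrable_real_indicator)
      (auto simp: emeasure_lborel_Icc_eq)
  then show "integrable lborel v"
  proof (rule Bochner_Integration.integrable_bound[OF _ m], intro AE_I2)
    fix s
    have "0 \<le> (norm (v s) - 1)\<^sup>2" by simp
    then have "2 * norm (v s) \<le> 1 + (norm (v s))\<^sup>2"
      by (simp add: power2_eq_square algebra_simps)
    then have "norm (v s) \<le> 1 + (norm (v s))\<^sup>2" using norm_ge_zero[of "v s"] by linarith
    then show "norm (v s) \<le> norm (indicator {0..T} s + (norm (v s))\<^sup>2 :: real)"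
      by (auto simp: v_def indicator_def)
  qed
qed

text \<open>An element of the Cameron-Martin space of the Wiener process, with energy at most the
  squared norm of \<open>u\<close>.\<close>

definition path_shift ::
  "('h::{real_inner, banach, second_countable_topology} \<Rightarrow>\<^sub>L 'h) \<Rightarrow> (real \<Rightarrow> 'h) \<Rightarrow> real \<Rightarrow> 'h" where
  "path_shift Q u t = (LINT s:{0..t}|lborel. operator_sqrt Q (u s))"

text \<open>Both sides are inner products in L^2. Let R be the root of Q and \<phi> the sum of the c
  i R (x i), each switched on during [0, t i]. The functional of the shift is the inner product of
  \<open>u\<close> with \<phi>, and the variance is the squared norm of \<phi>. So the bound is
  Cauchy-Schwarz, with a constant that does not see the functional.\<close>

lemma path_shift_bound:
  fixes Q :: "'h::{real_inner, banach, second_countable_topology} \<Rightarrow>\<^sub>L 'h"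
  assumes Q: "nonneg_operator Q" and u: "u \<in> L2_space T"
    and I: "finite I" and t: "\<And>i. i \<in> I \<Longrightarrow> t i \<in> {0..T}"
  shows "(\<Sum>i\<in>I. c i * (x i \<bullet> path_shift Q u (t i)))\<^sup>2 \<le>
      (\<integral>s. (norm (indicator {0..T} s *\<^sub>R u s))\<^sup>2 \<partial>lborel) *
      (\<Sum>i\<in>I. \<Sum>j\<in>I. c i * c j * (min (t i) (t j) * (Q (x i) \<bullet> x j)))"
    and "0 \<le> (\<Sum>i\<in>I. \<Sum>j\<in>I. c i * c j * (min (t i) (t j) * (Q (x i) \<bullet> x j)))"
proof -
  define R where "R = operator_sqrt Q"
  have symR: "R x \<bullet> y = x \<bullet> R y" for x y
    using nonneg_operator_operator_sqrt[OF Q] unfolding nonneg_operator_def R_def by blast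
  have RR: "R (R x) = Q x" for x
    using operator_sqrt_compose[OF Q] unfolding R_def by (metis blinfun_apply_blinfun_compose)
  define v where "v s = indicator {0..T} s *\<^sub>R u s" for s
  note v = L2_space_facts[OF u, folded v_def]
  define \<phi> where "\<phi> s = (\<Sum>i\<in>I. (c i * indicator {0..t i} s) *\<^sub>R R (x i))" for s
  define P where "P = (\<Sum>i\<in>I. c i * (x i \<bullet> path_shift Q u (t i)))"
  define A where "A = (\<Sum>i\<in>I. \<Sum>j\<in>I. c i * c j * (min (t i) (t j) * (Q (x i) \<bullet> x j)))"
  define U where "U = (\<integral>s. (norm (v s))\<^sup>2 \<partial>lborel)"
  have norm_\<phi>: "has_bochner_integral lborel (\<lambda>s. (norm (\<phi> s))\<^sup>2) A"
  proof -
    have "(norm (\<phi> s))\<^sup>2 = (\<Sum>i\<in>I. \<Sum>j\<in>I. (c i * c j * (Q (x i) \<bullet> x j)) * indicator {0..min (t i) (t j)} s)" for s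
    proof -
      have "(norm (\<phi> s))\<^sup>2 = (\<Sum>i\<in>I. \<Sum>j\<in>I. (c i * indicator {0..t i} s) * ((c j * indicator {0..t j} s) * (R (x i) \<bullet> R (x j))))"
        unfolding power2_norm_eq_inner \<phi>_def inner_sum_left
          by (intro sum.cong refl) (simp add: inner_sum_right sum_distrib_left mult_ac)
      also have "\<dots> = (\<Sum>i\<in>I. \<Sum>j\<in>I. (c i * c j * (Q (x i) \<bullet> x j)) * indicator {0..min (t i) (t j)} s)"
        by (intro sum.cong refl) (auto simp: symR[symmetric, of "R y" for y] RR indicator_def)
      finally show ?thesis .
    qed
    moreover have "has_bochner_integral lborel (\<lambda>s. \<Sum>i\<in>I. \<Sum>j\<in>I. (c i * c j * (Q (x i) \<bullet> x j)) * indicator {0..min (t i) (t j)} s)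
        (\<Sum>i\<in>I. \<Sum>j\<in>I. (c i * c j * (Q (x i) \<bullet> x j)) * min (t i) (t j))"
    proof (intro has_bochner_integral_sum has_bochner_integral_mult_right)
      fix i j assume "i \<in> I" "j \<in> I"
      then have "0 \<le> min (t i) (t j)" using t by auto
      then show "has_bochner_integral lborel (indicator {0..min (t i) (t j)}) (min (t i) (t j))"
        using has_bochner_integral_real_indicator[of "{0..min (t i) (t j)}" lborel] by simp
    qed
    moreover have "(\<Sum>i\<in>I. \<Sum>j\<in>I. (c i * c j * (Q (x i) \<bullet> x j)) * min (t i) (t j)) = A"
      unfolding A_def by (intro sum.cong refl) (simp add: mult_ac)
    ultimately show ?thesis by simp
  qed
  have cross: "has_bochner_integral lborel (\<lambda>s. v s \<bullet> \<phi> s) P"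
  proof -
    have "has_bochner_integral lborel (\<lambda>s. \<Sum>i\<in>I. c i * (x i \<bullet> (indicator {0..t i} s *\<^sub>R R (u s)))) P"
      unfolding P_def
    proof (intro has_bochner_integral_sum has_bochner_integral_mult_right has_bochner_integral_inner_right)
      fix i assume "i \<in> I"
      then have ti: "t i \<le> T" using t by auto
      have "integrable lborel (\<lambda>s. R (v s))"
        by (rule integrable_bounded_linear[OF blinfun.bounded_linear_right v(3)])
      then have "integrable lborel (\<lambda>s. indicator {0..t i} s *\<^sub>R R (v s))"
        by (rule integrable_mult_indicator[rotated]) simp
      moreover have "indicator {0..t i} s *\<^sub>R R (v s) = indicator {0..t i} s *\<^sub>R R (u s)" for s
        unfolding v_def using ti by (auto simp: indicator_def)
      ultimately have "integrable lborel (\<lambda>s. indicator {0..t i} s *\<^sub>R R (u s))" by simp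
      then show "has_bochner_integral lborel (\<lambda>s. indicator {0..t i} s *\<^sub>R R (u s)) (path_shift Q u (t i))"
        unfolding path_shift_def set_lebesgue_integral_def R_def by (rule has_bochner_integral_integrable)
    qed
    moreover have "(\<Sum>i\<in>I. c i * (x i \<bullet> (indicator {0..t i} s *\<^sub>R R (u s)))) = v s \<bullet> \<phi> s" for s
      unfolding \<phi>_def inner_sum_right
    proof (rule sum.cong[OF refl])
      fix i assume "i \<in> I"
      then have eq: "indicator {0..t i} s *\<^sub>R R (u s) = indicator {0..t i} s *\<^sub>R R (v s)"
        unfolding v_def using t[of i] by (auto simp: indicator_def)
      then show "c i * (x i \<bullet> (indicator {0..t i} s *\<^sub>R R (u s))) = v s \<bullet> (c i * indicator {0..t i} s) *\<^sub>R R (x i)"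
        unfolding eq using symR[of "x i" "v s"] by (simp add: inner_commute)
    qed
    ultimately show ?thesis by simp
  qed
  have "0 \<le> U * r\<^sup>2 + 2 * P * r + A" for r
  proof -
    have "has_bochner_integral lborel (\<lambda>s. r\<^sup>2 * (norm (v s))\<^sup>2 + (2 * r) * (v s \<bullet> \<phi> s) + (norm (\<phi> s))\<^sup>2)
        (r\<^sup>2 * U + (2 * r) * P + A)"
      unfolding U_def
      by (intro has_bochner_integral_add has_bochner_integral_mult_right cross norm_\<phi>
          has_bochner_integral_integrable v(2))
    moreover have "r\<^sup>2 * (norm (v s))\<^sup>2 + (2 * r) * (v s \<bullet> \<phi> s) + (norm (\<phi> s))\<^sup>2 = (norm (r *\<^sub>R v s + \<phi> s))\<^sup>2" for s
      unfolding power2_norm_eq_inner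
      by (simp add: inner_add_left inner_add_right inner_commute[of "\<phi> s" "v s"] power2_eq_square algebra_simps)
    ultimately have "has_bochner_integral lborel (\<lambda>s. (norm (r *\<^sub>R v s + \<phi> s))\<^sup>2) (r\<^sup>2 * U + (2 * r) * P + A)"
      by simp
    from has_bochner_integral_integral_eq[OF this, symmetric]
    have "0 \<le> r\<^sup>2 * U + (2 * r) * P + A" by simp
    then show ?thesis by (simp add: algebra_simps)
  qed
  then show "P\<^sup>2 \<le> (\<integral>s. (norm (indicator {0..T} s *\<^sub>R u s))\<^sup>2 \<partial>lborel) * A"
    unfolding v_def[symmetric] U_def[symmetric] by (rule quadratic_nonneg_imp_discriminant)
  show "0 \<le> A" using has_bochner_integral_integral_eq[OF norm_\<phi>, symmetric] by simp
qed

text \<open>Finitely many dyadic times lie on one common grid, on which the functional is a sum over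
  independent increments of equal length. The minimum of two times arises by counting the increments
  that precede both. Subtracting \<open>W 0\<close> makes the telescoping exact in every
  scenario.\<close>

lemma wiener_fourier:
  fixes Q :: "'h::{real_inner, banach, second_countable_topology} \<Rightarrow>\<^sub>L 'h"
  assumes M: "prob_space M" and W: "wiener_process M Q W" and Q: "nonneg_operator Q"
    and T: "T > 0" and I: "finite I"
  shows "(\<integral>\<omega>. cis (\<Sum>i\<in>I. c i * (x i \<bullet> (W (dyadic_time T (p i)) \<omega> - W 0 \<omega>))) \<partial>M) =
    complex_of_real (exp (- (\<Sum>i\<in>I. \<Sum>j\<in>I. c i * c j *
      (min (dyadic_time T (p i)) (dyadic_time T (p j)) * (Q (x i) \<bullet> x j))) / 2))"
proof -
  interpret prob_space M by fact
  define N where "N = Max (insert 0 ((\<lambda>i. fst (p i)) ` I))"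
  define n where "n = (2::nat) ^ N"
  define \<delta> where "\<delta> = T / real n"
  have \<delta>: "\<delta> > 0" unfolding \<delta>_def n_def using T by simp
  have Wm[measurable]: "W t \<in> borel_measurable M" if "t \<ge> 0" for t
    using W that unfolding wiener_process_def by blast
  have "\<exists>k. k \<le> n \<and> dyadic_time T (p i) = real k * \<delta>" if i: "i \<in> I" for i
  \<comment> \<open>Refining to level \<open>N\<close> multiplies the index by a power of two; the
    cap at \<open>n\<close> mirrors the cap of dyadic times at \<open>T\<close>.\<close>
  proof (intro exI[of _ "min (snd (p i) * 2 ^ (N - fst (p i))) n"] conjI)
    have "fst (p i) \<le> N" unfolding N_def using I i by (intro Max_ge) auto
    then have n_split: "real n = 2 ^ fst (p i) * 2 ^ (N - fst (p i))"
      unfolding n_def by (simp add: power_add[symmetric])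
    have "real (snd (p i) * 2 ^ (N - fst (p i))) * \<delta> = real (snd (p i)) * T / 2 ^ fst (p i)"
      unfolding \<delta>_def n_split by simp
    moreover have "real n * \<delta> = T" unfolding \<delta>_def n_def by simp
    moreover have "real (min a b) * \<delta> = min (real a * \<delta>) (real b * \<delta>)" for a b
      using \<delta> by (auto simp: min_def)
    ultimately show "dyadic_time T (p i) = real (min (snd (p i) * 2 ^ (N - fst (p i))) n) * \<delta>"
      unfolding dyadic_time_def by simp
  qed simp
  then obtain k where k: "\<And>i. i \<in> I \<Longrightarrow> k i \<le> n" "\<And>i. i \<in> I \<Longrightarrow> dyadic_time T (p i) = real (k i) * \<delta>"
    by metis
  define \<Delta> where "\<Delta> l \<omega> = W (real (Suc l) * \<delta>) \<omega> - W (real l * \<delta>) \<omega>" for l \<omega>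
  have [measurable]: "\<Delta> l \<in> borel_measurable M" for l
    unfolding \<Delta>_def by (intro borel_measurable_diff Wm) (use \<delta> in auto)
  define y where "y l = (\<Sum>i\<in>I. (c i * (if l < k i then 1 else 0)) *\<^sub>R x i)" for l
  have sum_eq: "(\<Sum>i\<in>I. c i * (x i \<bullet> (W (dyadic_time T (p i)) \<omega> - W 0 \<omega>))) = (\<Sum>l<n. y l \<bullet> \<Delta> l \<omega>)" for \<omega>
  proof -
    have "W (dyadic_time T (p i)) \<omega> - W 0 \<omega> = (\<Sum>l<n. (if l < k i then 1 else 0) *\<^sub>R \<Delta> l \<omega>)" if i: "i \<in> I" for i
    proof -
      have "W (dyadic_time T (p i)) \<omega> - W 0 \<omega> = (\<Sum>l<k i. \<Delta> l \<omega>)"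
        unfolding k(2)[OF i] \<Delta>_def using sum_lessThan_telescope[of "\<lambda>l. W (real l * \<delta>) \<omega>" "k i"] by simp
      also have "\<dots> = (\<Sum>l<n. (if l < k i then 1 else 0) *\<^sub>R \<Delta> l \<omega>)"
        using k(1)[OF i] by (intro sum.mono_neutral_cong_left) auto
      finally show ?thesis .
    qed
    then have "(\<Sum>i\<in>I. c i * (x i \<bullet> (W (dyadic_time T (p i)) \<omega> - W 0 \<omega>))) =
        (\<Sum>i\<in>I. \<Sum>l<n. ((c i * (if l < k i then 1 else 0)) *\<^sub>R x i) \<bullet> \<Delta> l \<omega>)"
      by (simp add: inner_sum_right sum_distrib_left mult.assoc)
    also have "\<dots> = (\<Sum>l<n. y l \<bullet> \<Delta> l \<omega>)"
      unfolding y_def inner_sum_left by (rule sum.swap)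
    finally show ?thesis .
  qed
  have "indep_vars (\<lambda>_. borel) \<Delta> {..<n}"
  proof -
    have "independent_increments M W" using W unfolding wiener_process_def by blast
    then show ?thesis
      unfolding independent_increments_def \<Delta>_def
      by (elim allE[of _ n] allE[of _ "\<lambda>l. real l * \<delta>"] impE) (use \<delta> in auto)
  qed
  then have ind: "indep_vars (\<lambda>_. borel) (\<lambda>l \<omega>. y l \<bullet> \<Delta> l \<omega>) {..<n}"
    by (rule indep_vars_compose2) simp
  have char1: "char (distr M borel (\<lambda>\<omega>. y l \<bullet> \<Delta> l \<omega>)) 1 = complex_of_real (exp (- (\<delta> * (Q (y l) \<bullet> y l)) / 2))" for l
  proof -
    have "distr M borel (\<lambda>\<omega>. y l \<bullet> \<Delta> l \<omega>) = normal_law 0 ((real (Suc l) * \<delta> - real l * \<delta>) * (Q (y l) \<bullet> y l))"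
      using W \<delta> unfolding wiener_process_def \<Delta>_def by (auto intro!: mult_right_mono)
    also have "(real (Suc l) * \<delta> - real l * \<delta>) = \<delta>" by (simp add: algebra_simps)
    finally have law: "distr M borel (\<lambda>\<omega>. y l \<bullet> \<Delta> l \<omega>) = normal_law 0 (\<delta> * (Q (y l) \<bullet> y l))" .
    have "0 \<le> Q (y l) \<bullet> y l" using Q unfolding nonneg_operator_def by blast
    then have "0 \<le> \<delta> * (Q (y l) \<bullet> y l)" using \<delta> by simp
    from fourier_normal_law[OF this, of 1] show ?thesis
      unfolding char_def law by (simp add: cis_conv_exp)
  qed
  have "(\<integral>\<omega>. cis (\<Sum>i\<in>I. c i * (x i \<bullet> (W (dyadic_time T (p i)) \<omega> - W 0 \<omega>))) \<partial>M) =
      char (distr M borel (\<lambda>\<omega>. \<Sum>l<n. y l \<bullet> \<Delta> l \<omega>)) 1"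
    unfolding sum_eq char_def by (subst integral_distr) (auto simp: cis_conv_exp)
  also have "\<dots> = (\<Prod>l<n. complex_of_real (exp (- (\<delta> * (Q (y l) \<bullet> y l)) / 2)))"
    unfolding char_distr_sum[OF ind] char1 ..
  also have "\<dots> = complex_of_real (exp (- (\<Sum>l<n. \<delta> * (Q (y l) \<bullet> y l)) / 2))"
    unfolding of_real_prod[symmetric] exp_sum[OF finite_lessThan, symmetric]
    by (simp add: sum_negf sum_divide_distrib)
  also have "(\<Sum>l<n. \<delta> * (Q (y l) \<bullet> y l)) = (\<Sum>i\<in>I. \<Sum>j\<in>I. c i * c j *
      (min (dyadic_time T (p i)) (dyadic_time T (p j)) * (Q (x i) \<bullet> x j)))"
  proof -
    have "(\<Sum>l<n. \<delta> * (Q (y l) \<bullet> y l)) = (\<Sum>l<n. \<Sum>i\<in>I. \<Sum>j\<in>I.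
        c i * c j * (Q (x i) \<bullet> x j) * (\<delta> * (if l < min (k i) (k j) then 1 else 0)))"
    proof (rule sum.cong[OF refl])
      fix l
      have "\<delta> * (Q (y l) \<bullet> y l) = (\<Sum>i\<in>I. \<Sum>j\<in>I. \<delta> * (c i * (if l < k i then 1 else 0) *
          (c j * (if l < k j then 1 else 0) * (Q (x i) \<bullet> x j))))"
        unfolding y_def blinfun.sum_right blinfun.scaleR_right inner_sum_left
        by (simp add: inner_sum_right sum_distrib_left mult_ac)
      also have "\<dots> = (\<Sum>i\<in>I. \<Sum>j\<in>I. c i * c j * (Q (x i) \<bullet> x j) * (\<delta> * (if l < min (k i) (k j) then 1 else 0)))"
        by (intro sum.cong refl) auto
      finally show "\<delta> * (Q (y l) \<bullet> y l) = (\<Sum>i\<in>I. \<Sum>j\<in>I. c i * c j * (Q (x i) \<bullet> x j) * (\<delta> * (if l < min (k i) (k j) then 1 else 0)))" .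
    qed
    also have "\<dots> = (\<Sum>i\<in>I. \<Sum>l<n. \<Sum>j\<in>I. c i * c j * (Q (x i) \<bullet> x j) * (\<delta> * (if l < min (k i) (k j) then 1 else 0)))"
      by (rule sum.swap)
    also have "\<dots> = (\<Sum>i\<in>I. \<Sum>j\<in>I. \<Sum>l<n. c i * c j * (Q (x i) \<bullet> x j) * (\<delta> * (if l < min (k i) (k j) then 1 else 0)))"
      by (intro sum.cong refl) (rule sum.swap)
    also have "\<dots> = (\<Sum>i\<in>I. \<Sum>j\<in>I. c i * c j *
      (min (dyadic_time T (p i)) (dyadic_time T (p j)) * (Q (x i) \<bullet> x j)))"
    proof (intro sum.cong refl)
      fix i j assume ij: "i \<in> I" "j \<in> I"
      have "(\<Sum>l<n. (if l < min (k i) (k j) then 1 else 0 :: real)) = (\<Sum>l<min (k i) (k j). 1)"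
        using k(1)[OF ij(1)] by (intro sum.mono_neutral_cong_right) auto
      then have "(\<Sum>l<n. \<delta> * (if l < min (k i) (k j) then 1 else 0)) = \<delta> * real (min (k i) (k j))"
        unfolding sum_distrib_left[symmetric] by simp
      also have "\<dots> = min (dyadic_time T (p i)) (dyadic_time T (p j))"
        unfolding k(2)[OF ij(1)] k(2)[OF ij(2)] using \<delta> by (auto simp: min_def)
      finally show "(\<Sum>l<n. c i * c j * (Q (x i) \<bullet> x j) * (\<delta> * (if l < min (k i) (k j) then 1 else 0))) =
          c i * c j * (min (dyadic_time T (p i)) (dyadic_time T (p j)) * (Q (x i) \<bullet> x j))"
        unfolding sum_distrib_left[symmetric] by simp
    qed
    finally show ?thesis .
  qed
  finally show ?thesis .
qed

lemma wiener_cameron_martin: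
  fixes Q :: "'h::{real_inner, banach, second_countable_topology} \<Rightarrow>\<^sub>L 'h"
  assumes M: "prob_space M" and W: "wiener_process M Q W" and Q: "nonneg_operator Q"
    and T: "T > 0" and u: "u \<in> L2_space T"
  defines "V \<equiv> \<lambda>\<omega> p. W (dyadic_time T p) \<omega> - W 0 \<omega>"
  shows "absolutely_continuous (distr M borel V)
    (distr M borel (\<lambda>\<omega> p. V \<omega> p + path_shift Q u (dyadic_time T p)))"
proof -
  interpret prob_space M by fact
  obtain x :: "nat \<Rightarrow> 'h" where x: "\<And>U. open U \<Longrightarrow> U \<noteq> {} \<Longrightarrow> \<exists>j. x j \<in> U"
    using dense_sequence_exists by blast
  define h where "h p = path_shift Q u (dyadic_time T p)" for p
  have Wm[measurable]: "W (dyadic_time T p) \<in> borel_measurable M" "W 0 \<in> borel_measurable M" for p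
    using W dyadic_time_in[of T p] T unfolding wiener_process_def by auto
  have V[measurable]: "V \<in> borel_measurable M"
    unfolding V_def by (rule measurable_coordinatewise_then_product) measurable
  have Vh[measurable]: "(\<lambda>\<omega> p. V \<omega> p + h p) \<in> borel_measurable M"
    unfolding V_def by (rule measurable_coordinatewise_then_product) measurable
  \<comment> \<open>The Gaussian results are about real vectors, so a path in the Hilbert space is
    encoded by its inner products with a dense sequence, still a countable family.\<close>
  define coord where "coord s i = x (snd i) \<bullet> s (fst i)" for s :: "nat \<times> nat \<Rightarrow> 'h" and i :: "(nat \<times> nat) \<times> nat"
  have coord[measurable]: "coord \<in> borel_measurable borel"
    unfolding coord_def by (rule measurable_coordinatewise_then_product) measurable
  have coord_add: "coord (\<lambda>p. V \<omega> p + h p) = (\<lambda>i. coord (V \<omega>) i + coord h i)" for \<omega>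
    unfolding coord_def by (simp add: inner_add_right)
  define \<nu> where "\<nu> = distr M borel (\<lambda>\<omega>. coord (V \<omega>))"
  define \<mu> where "\<mu> = distr M borel (\<lambda>\<omega>. coord (\<lambda>p. V \<omega> p + h p))"
  define K where "K i j = min (dyadic_time T (fst i)) (dyadic_time T (fst j)) * (Q (x (snd i)) \<bullet> x (snd j))"
    for i j :: "(nat \<times> nat) \<times> nat"
  define C where "C = (\<integral>s. (norm (indicator {0..T} s *\<^sub>R u s))\<^sup>2 \<partial>lborel)"
  have C: "C \<ge> 0" unfolding C_def by simp
  have "absolutely_continuous \<nu> \<mu>"
  proof (rule cylinder_bound_imp_absolutely_continuous)
    show "finite_measure \<mu>" "finite_measure \<nu>"
      unfolding \<mu>_def \<nu>_def by (rule finite_measure_distr, measurable)+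
    show "sets \<mu> = sets borel" "sets \<nu> = sets borel" unfolding \<mu>_def \<nu>_def by simp_all
    show "0 \<le> exp C" by simp
    fix I B and r :: real
    assume I: "finite I" and B[measurable]: "B \<in> sets (\<Pi>\<^sub>M i\<in>(I :: ((nat \<times> nat) \<times> nat) set). (borel :: real measure))"
      and r: "r > 0"
    have *: "2 * emeasure M {\<omega> \<in> space M. (\<lambda>i\<in>I. coord (V \<omega>) i + coord h i) \<in> B} \<le>
        ennreal r * emeasure M {\<omega> \<in> space M. (\<lambda>i\<in>I. coord (V \<omega>) i) \<in> B} + ennreal (exp C / r)"
    proof (rule finite_cameron_martin[OF M I, where K=K])
      show "(\<lambda>\<omega>. coord (V \<omega>) i) \<in> borel_measurable M" for i
        unfolding coord_def V_def by measurable
      show "K i j = K j i" for i j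
        unfolding K_def using Q by (simp add: nonneg_operator_def min.commute inner_commute)
      show "0 \<le> (\<Sum>i\<in>I. \<Sum>j\<in>I. c i * c j * K i j)" for c
        unfolding K_def by (rule path_shift_bound(2)[OF Q u I]) (use dyadic_time_in T in auto)
      show "(\<integral>\<omega>. cis (\<Sum>i\<in>I. c i * coord (V \<omega>) i) \<partial>M) =
          complex_of_real (exp (- (\<Sum>i\<in>I. \<Sum>j\<in>I. c i * c j * K i j) / 2))" for c
        unfolding K_def coord_def V_def by (rule wiener_fourier[OF M W Q T I])
      show "(\<Sum>i\<in>I. c i * coord h i)\<^sup>2 \<le> C * (\<Sum>i\<in>I. \<Sum>j\<in>I. c i * c j * K i j)" for c
        unfolding K_def C_def coord_def h_def
        by (rule path_shift_bound(1)[OF Q u I]) (use dyadic_time_in T in auto)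
    qed (use C r in auto)
    have rm: "(\<lambda>z. restrict z I) \<in> measurable borel (\<Pi>\<^sub>M i\<in>I. (borel :: real measure))"
      by (rule measurable_restrict) measurable
    have Bm: "{z. restrict z I \<in> B} \<in> sets borel"
      using measurable_sets[OF rm B] by (simp add: vimage_def)
    have "measure \<nu> {z. restrict z I \<in> B} = measure M {\<omega> \<in> space M. (\<lambda>i\<in>I. coord (V \<omega>) i) \<in> B}"
      unfolding \<nu>_def using Bm by (subst measure_distr) (auto intro!: arg_cong[where f="measure M"])
    moreover have "measure \<mu> {z. restrict z I \<in> B} = measure M {\<omega> \<in> space M. (\<lambda>i\<in>I. coord (V \<omega>) i + coord h i) \<in> B}"
      unfolding \<mu>_def
      by (subst measure_distr[OF measurable_compose[OF Vh coord] Bm]) (auto intro!: arg_cong[where f="measure M"] simp: coord_add)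
    moreover have "2 * p \<le> r * q + e" if "2 * ennreal p \<le> ennreal r * ennreal q + ennreal e" "p \<ge> 0" "q \<ge> 0" "e \<ge> 0" for p q e
    proof -
      have "ennreal (2 * p) \<le> ennreal (r * q + e)"
        using that r by (simp add: ennreal_mult ennreal_plus)
      moreover have "0 \<le> r * q + e" using that r by simp
      ultimately show ?thesis by (metis ennreal_le_iff)
    qed
    ultimately show "2 * measure \<mu> {z. restrict z I \<in> B} \<le> r * measure \<nu> {z. restrict z I \<in> B} + exp C / r"
      using * r unfolding emeasure_eq_measure by simp
  qed
  \<comment> \<open>The encoding loses no Borel set, so absolute continuity of the encoded laws
    passes back to the laws of the paths.\<close>
  have sets_coord: "\<exists>A'\<in>sets borel. A = coord -` A'" if A: "A \<in> sets borel" for A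
  proof -
    let ?N = "vimage_algebra UNIV coord borel"
    have cm: "coord \<in> measurable ?N borel" by (rule measurable_vimage_algebra1) simp
    have "(\<lambda>s. s) \<in> borel_measurable ?N"
    proof (intro measurable_coordinatewise_then_product borel_measurable_inner_dense[where x=x] x)
      fix p j
      have "(\<lambda>s. coord s (p, j)) \<in> borel_measurable ?N"
        by (rule measurable_compose[OF cm measurable_product_coordinates])
      then show "(\<lambda>s. x j \<bullet> s p) \<in> borel_measurable ?N" unfolding coord_def by simp
    qed
    from measurable_sets[OF this A] have "A \<in> sets ?N" by simp
    then show ?thesis by (subst (asm) sets_vimage_algebra2) auto
  qed
  show ?thesis
    unfolding absolutely_continuous_def h_def[symmetric]
  proof
    fix A assume A: "A \<in> null_sets (distr M borel V)"
    then have As: "A \<in> sets borel" and "emeasure (distr M borel V) A = 0" by auto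
    then have A0: "emeasure M (V -` A \<inter> space M) = 0" by (simp add: emeasure_distr)
    obtain A' where A': "A' \<in> sets borel" "A = coord -` A'" using sets_coord[OF As] by blast
    have "emeasure \<nu> A' = 0"
      unfolding \<nu>_def using A0 A' by (subst emeasure_distr) (auto simp: vimage_def)
    then have "A' \<in> null_sets \<nu>" using A' unfolding \<nu>_def by auto
    then have "A' \<in> null_sets \<mu>" using \<open>absolutely_continuous \<nu> \<mu>\<close> unfolding absolutely_continuous_def by blast
    then have "emeasure M ((\<lambda>\<omega>. coord (\<lambda>p. V \<omega> p + h p)) -` A' \<inter> space M) = 0"
      unfolding \<mu>_def by (subst (asm) null_sets_distr_iff) auto
    then have "emeasure (distr M borel (\<lambda>\<omega> p. V \<omega> p + h p)) A = 0"
      using As unfolding A'(2) by (subst emeasure_distr) (auto simp: vimage_def)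
    then show "A \<in> null_sets (distr M borel (\<lambda>\<omega> p. V \<omega> p + h p))" using As by auto
  qed
qed

section \<open>Riemann sums and mixtures of laws\<close>

text \<open>The partition of the whole interval stopped at \<open>t\<close>: cells beyond
  \<open>t\<close> are degenerate and contribute nothing, and refining the level gives partitions
  for every \<open>t\<close> at once.\<close>

definition riemann_sum ::
  "real \<Rightarrow> (real \<Rightarrow> 'h::real_normed_vector \<Rightarrow>\<^sub>L 'h) \<Rightarrow> real \<Rightarrow> nat \<Rightarrow> (real \<Rightarrow> 'h) \<Rightarrow> 'h" where
  "riemann_sum T \<Phi> t k w = (\<Sum>i<2 ^ k. \<Phi> (min (real i * T / 2 ^ k) t)
     (w (min (real (Suc i) * T / 2 ^ k) t) - w (min (real i * T / 2 ^ k) t)))"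

lemma riemann_sum_convolution:
  fixes S :: "real \<Rightarrow> 'h::{banach, second_countable_topology} \<Rightarrow>\<^sub>L 'h"
  assumes S: "c0_semigroup S" and T: "T > 0" and t: "t \<in> {0..T}"
    and f: "set_integrable lborel {0..t} f"
    and F: "\<And>r. r \<in> {0..t} \<Longrightarrow> F r = (LINT s:{0..r}|lborel. f s)"
  shows "(\<lambda>k. riemann_sum T (\<lambda>s. S (t - s)) t k F) \<longlonglongrightarrow> (LINT s:{0..t}|lborel. S (t - s) (f s))"
    and "set_integrable lborel {0..t} (\<lambda>s. S (t - s) (f s))"
proof -
  obtain C where C: "\<And>r. r \<in> {0..T} \<Longrightarrow> norm (S r) \<le> C" using c0_semigroup_bounded[OF S] by blast
  define f0 where "f0 s = indicator {0..t} s *\<^sub>R f s" for s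
  have f0: "integrable lborel f0" using f unfolding set_integrable_def f0_def .
  define \<tau> where "\<tau> k i = min (real i * T / 2 ^ k) t" for k i
  have \<tau>: "\<tau> k i \<in> {0..t}" for k i using t T unfolding \<tau>_def by auto
  have \<tau>_mono: "\<tau> k i \<le> \<tau> k j" if "i \<le> j" for k i j
    unfolding \<tau>_def using that T by (intro min.mono divide_right_mono mult_right_mono) auto
  define J where "J k i = {\<tau> k i<..\<tau> k (Suc i)}" for k i
  define g where "g k s = (\<Sum>i<2 ^ k. S (t - \<tau> k i) (indicator (J k i) s *\<^sub>R f0 s))" for k s
  have J_int: "integrable lborel (\<lambda>s. indicator (J k i) s *\<^sub>R f0 s)" for k i
    by (rule integrable_mult_indicator[OF _ f0]) (simp add: J_def)
  have inc: "F (\<tau> k (Suc i)) - F (\<tau> k i) = (\<integral>s. indicator (J k i) s *\<^sub>R f0 s \<partial>lborel)" for k i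
  proof -
    have I: "integrable lborel (\<lambda>s. indicator {0..r} s *\<^sub>R f0 s)" for r
      by (rule integrable_mult_indicator[OF _ f0]) simp
    have F0: "F r = (\<integral>s. indicator {0..r} s *\<^sub>R f0 s \<partial>lborel)" if "r \<in> {0..t}" for r
      unfolding F[OF that] set_lebesgue_integral_def f0_def
      by (rule Bochner_Integration.integral_cong) (use that in \<open>auto simp: indicator_def\<close>)
    have "F (\<tau> k (Suc i)) - F (\<tau> k i) =
        (\<integral>s. indicator {0..\<tau> k (Suc i)} s *\<^sub>R f0 s - indicator {0..\<tau> k i} s *\<^sub>R f0 s \<partial>lborel)"
      unfolding F0[OF \<tau>] by (rule Bochner_Integration.integral_diff[OF I I, symmetric])
    also have "\<dots> = (\<integral>s. indicator (J k i) s *\<^sub>R f0 s \<partial>lborel)"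
      unfolding J_def using \<tau>_mono[of i "Suc i" k] \<tau>[of k i]
      by (intro Bochner_Integration.integral_cong) (auto simp: indicator_def)
    finally show ?thesis .
  qed
  have g_int: "integrable lborel (g k)" for k
    unfolding g_def
    by (intro Bochner_Integration.integrable_sum integrable_bounded_linear[OF blinfun.bounded_linear_right J_int])
  have sum_eq: "riemann_sum T (\<lambda>s. S (t - s)) t k F = (\<integral>s. g k s \<partial>lborel)" for k
  proof -
    have "riemann_sum T (\<lambda>s. S (t - s)) t k F = (\<Sum>i<2 ^ k. S (t - \<tau> k i) (F (\<tau> k (Suc i)) - F (\<tau> k i)))"
      unfolding riemann_sum_def \<tau>_def ..
    also have "\<dots> = (\<Sum>i<2 ^ k. \<integral>s. S (t - \<tau> k i) (indicator (J k i) s *\<^sub>R f0 s) \<partial>lborel)"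
      unfolding inc
      by (intro sum.cong refl integral_bounded_linear[OF blinfun.bounded_linear_right J_int, symmetric])
    also have "\<dots> = (\<integral>s. g k s \<partial>lborel)"
      unfolding g_def
      by (intro Bochner_Integration.integral_sum[symmetric] integrable_bounded_linear[OF blinfun.bounded_linear_right J_int])
    finally show ?thesis .
  qed
  have cell: "\<exists>r. t - s < r \<and> r \<le> t - s + T / 2 ^ k \<and> r \<in> {0..T} \<and> g k s = S r (f0 s)"
    if s: "s \<in> {0<..t}" for k s
  proof -
    define \<delta> where "\<delta> = T / 2 ^ k"
    have \<delta>: "\<delta> > 0" unfolding \<delta>_def using T by simp
    \<comment> \<open>Cells are open on the left and closed on the right, so the index of the cell
      of \<open>s\<close> is a ceiling minus one.\<close>
    define i where "i = nat (\<lceil>s / \<delta>\<rceil> - 1)"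
    have "s / \<delta> > 0" using s \<delta> by simp
    then have i_real: "real i = of_int \<lceil>s / \<delta>\<rceil> - 1" unfolding i_def by (simp add: of_nat_nat)
    have "real i < s / \<delta>" "s / \<delta> \<le> real i + 1" unfolding i_real by linarith+
    then have i_s: "real i * \<delta> < s" "s \<le> real (Suc i) * \<delta>" using \<delta> by (auto simp: field_simps)
    have "real i * \<delta> < T" using i_s s t by auto
    then have "real i < 2 ^ k" unfolding \<delta>_def using T by (simp add: field_simps)
    then have "real i < real (2 ^ k)" by simp
    then have i_less: "i < 2 ^ k" by (simp only: of_nat_less_iff)
    have \<tau>i: "\<tau> k i = real i * \<delta>" "s \<le> \<tau> k (Suc i)"
      using i_s s unfolding \<tau>_def \<delta>_def by auto
    have "indicator (J k j) s = (if j = i then 1 else 0 :: real)" for j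
    proof -
      have "s \<notin> J k j" if "j < i"
        using \<tau>_mono[of "Suc j" i k] that \<tau>i i_s unfolding J_def by auto
      moreover have "s \<notin> J k j" if "i < j"
        using \<tau>_mono[of "Suc i" j k] that \<tau>i unfolding J_def by auto
      moreover have "s \<in> J k i" using \<tau>i i_s unfolding J_def by auto
      ultimately show ?thesis by (auto simp: indicator_def) (metis linorder_neqE_nat)
    qed
    then have "g k s = (\<Sum>j<2 ^ k. if j = i then S (t - \<tau> k i) (f0 s) else 0)"
      unfolding g_def by (intro sum.cong refl) (auto simp: blinfun.scaleR_right)
    also have "\<dots> = S (t - \<tau> k i) (f0 s)" using i_less by simp
    finally have "g k s = S (t - \<tau> k i) (f0 s)" .
    moreover have "t - \<tau> k i \<in> {0..T}" using \<tau>[of k i] t by auto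
    moreover have "t - s < t - \<tau> k i" "t - \<tau> k i \<le> t - s + T / 2 ^ k"
      using \<tau>i i_s unfolding \<delta>_def[symmetric] by (auto simp: algebra_simps)
    ultimately show ?thesis by blast
  qed
  have g_out: "g k s = 0" if "s \<notin> {0<..t}" for k s
  proof -
    have "s \<notin> J k i" for i using that \<tau>[of k i] \<tau>[of k "Suc i"] unfolding J_def by auto
    then show ?thesis unfolding g_def by simp
  qed
  define G where "G s = indicator {0<..t} s *\<^sub>R S (t - s) (f s)" for s
  have lim: "(\<lambda>k. g k s) \<longlonglongrightarrow> G s" for s
  proof (cases "s \<in> {0<..t}")
    case False
    then show ?thesis unfolding G_def using g_out by simp
  next
    case True
    obtain r where r: "\<And>k. t - s < r k" "\<And>k. r k \<le> t - s + T / 2 ^ k" "\<And>k. g k s = S (r k) (f0 s)"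
      using cell[OF True] by metis
    have "(\<lambda>k. t - s + T * (1 / 2) ^ k) \<longlonglongrightarrow> t - s + T * 0"
      by (intro tendsto_intros LIMSEQ_realpow_zero) auto
    then have up: "(\<lambda>k. t - s + T / 2 ^ k) \<longlonglongrightarrow> t - s" by (simp add: power_one_over)
    have "r \<longlonglongrightarrow> t - s"
      by (rule tendsto_sandwich[OF _ _ tendsto_const up]) (use r in \<open>auto intro!: always_eventually less_imp_le\<close>)
    then have "filterlim r (at_right (t - s)) sequentially"
      using r(1) by (auto simp: filterlim_at less_imp_neq[symmetric])
    from filterlim_compose[OF c0_semigroup_right_continuous[OF S] this]
    have "(\<lambda>k. S (r k) (f0 s)) \<longlonglongrightarrow> S (t - s) (f0 s)" using True by simp
    moreover have "S (t - s) (f0 s) = G s" unfolding G_def f0_def using True by simp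
    ultimately show ?thesis unfolding r(3) by simp
  qed
  have bnd: "norm (g k s) \<le> C * norm (f0 s)" for k s
  proof (cases "s \<in> {0<..t}")
    case False
    have "0 \<le> C" using C[of 0] T order_trans[OF norm_ge_zero] by auto
    then show ?thesis using g_out[OF False] by simp
  next
    case True
    then obtain r where "r \<in> {0..T}" "g k s = S r (f0 s)" using cell by blast
    then show ?thesis using norm_blinfun[of "S r" "f0 s"] C[of r]
      by (metis mult_right_mono norm_ge_zero order_trans)
  qed
  have G_meas: "G \<in> borel_measurable lborel"
    by (rule borel_measurable_LIMSEQ_metric[OF _ lim]) (use g_int in auto)
  have w: "integrable lborel (\<lambda>s. C * norm (f0 s))" using f0 by simp
  have G_int: "integrable lborel G"
    by (rule integrable_dominated_convergence[where s=g, OF G_meas borel_measurable_integrable[OF g_int] w])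
      (auto simp: lim bnd)
  have conv: "(\<lambda>k. \<integral>s. g k s \<partial>lborel) \<longlonglongrightarrow> (\<integral>s. G s \<partial>lborel)"
    by (rule integral_dominated_convergence[where s=g, OF G_meas borel_measurable_integrable[OF g_int] w])
      (auto simp: lim bnd)
  \<comment> \<open>The cells cover the interval without 0, and the difference sits on one point of
    Lebesgue measure zero.\<close>
  have G_eq: "indicator {0..t} s *\<^sub>R S (t - s) (f s) = G s + indicator {0} s *\<^sub>R S t (f 0)" for s
    using t unfolding G_def by (auto simp: indicator_def)
  have pt: "integrable lborel (indicator {0} :: real \<Rightarrow> real)"
    by (rule integrable_real_indicator) auto
  show "set_integrable lborel {0..t} (\<lambda>s. S (t - s) (f s))"
    unfolding set_integrable_def G_eq
    by (intro Bochner_Integration.integrable_add G_int integrable_scaleR_left pt)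
  have "(LINT s:{0..t}|lborel. S (t - s) (f s)) = (\<integral>s. G s \<partial>lborel)"
    unfolding set_lebesgue_integral_def G_eq
    using G_int pt by (subst Bochner_Integration.integral_add) auto
  then show "(\<lambda>k. riemann_sum T (\<lambda>s. S (t - s)) t k F) \<longlonglongrightarrow> (LINT s:{0..t}|lborel. S (t - s) (f s))"
    using conv unfolding sum_eq by simp
qed

lemma stochastic_integral_riemann_sum:
  assumes T: "T > 0" and t: "t \<in> {0..T}"
    and int: "has_stochastic_integral M \<Phi> L t I" and e: "e > 0"
  shows "\<forall>\<^sub>F k in sequentially.
    measure M {\<omega> \<in> space M. norm (riemann_sum T \<Phi> t k (\<lambda>s. L s \<omega>) - I \<omega>) > e} < e"
proof -
  obtain \<delta> where \<delta>: "\<delta> > 0" "\<And>n \<tau>. partition_of t \<delta> n \<tau> \<Longrightarrow> measure M {\<omega> \<in> space M.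
      norm ((\<Sum>i<n. \<Phi> (\<tau> i) (L (\<tau> (Suc i)) \<omega> - L (\<tau> i) \<omega>)) - I \<omega>) > e} < e"
    using int e unfolding has_stochastic_integral_def by blast
  have "(\<lambda>k. T * (1 / 2) ^ k) \<longlonglongrightarrow> T * 0" by (intro tendsto_intros LIMSEQ_realpow_zero) auto
  then have "\<forall>\<^sub>F k in sequentially. T * (1 / 2) ^ k < \<delta>"
    using \<delta>(1) by (auto dest: order_tendstoD(2)[of _ _ _ \<delta>])
  then show ?thesis
  proof eventually_elim
    case (elim k)
    define \<tau> where "\<tau> i = min (real i * T / 2 ^ k) t" for i
    have step: "real (Suc i) * T / 2 ^ k = real i * T / 2 ^ k + T / 2 ^ k" for i
      by (simp add: field_simps)
    have "T / 2 ^ k > 0" "T / 2 ^ k < \<delta>" using T elim by (auto simp: power_one_over)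
    then have "\<tau> i \<le> \<tau> (Suc i) \<and> \<tau> (Suc i) - \<tau> i < \<delta>" for i
      unfolding \<tau>_def step min_def by auto
    moreover have "\<tau> 0 = 0" "\<tau> (2 ^ k) = t" using t unfolding \<tau>_def by auto
    ultimately have "partition_of t \<delta> (2 ^ k) \<tau>" unfolding partition_of_def by blast
    from \<delta>(2)[OF this] show ?case unfolding riemann_sum_def \<tau>_def .
  qed
qed

text \<open>A finite family allows one index to meet all error bounds at once. Choosing errors 2^-n
  makes the exceptional probabilities summable, and Borel-Cantelli gives almost sure
  convergence.\<close>

lemma AE_convergent_subsequence:
  fixes \<F> :: "((nat \<Rightarrow> 'a \<Rightarrow> 'b::{second_countable_topology, real_normed_vector}) \<times> ('a \<Rightarrow> 'b)) set"
  assumes M: "prob_space M" and fin: "finite \<F>"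
    and meas: "\<And>X Y k. (X, Y) \<in> \<F> \<Longrightarrow> X k \<in> borel_measurable M"
      "\<And>X Y. (X, Y) \<in> \<F> \<Longrightarrow> Y \<in> borel_measurable M"
    and conv: "\<And>X Y e. (X, Y) \<in> \<F> \<Longrightarrow> e > 0 \<Longrightarrow>
      \<forall>\<^sub>F k in sequentially. measure M {\<omega> \<in> space M. norm (X k \<omega> - Y \<omega>) > e} < e"
  shows "\<exists>r :: nat \<Rightarrow> nat. strict_mono r \<and>
    (\<forall>(X, Y)\<in>\<F>. AE \<omega> in M. (\<lambda>k. X (r k) \<omega>) \<longlonglongrightarrow> Y \<omega>)"
proof -
  interpret prob_space M by fact
  define P where "P n k \<longleftrightarrow> (\<forall>(X, Y)\<in>\<F>. measure M {\<omega> \<in> space M. norm (X k \<omega> - Y \<omega>) > (1 / 2) ^ n} < (1 / 2) ^ n)"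
    for n k :: nat
  have ev: "\<forall>\<^sub>F k in sequentially. P n k" for n
    unfolding P_def using conv by (intro eventually_ball_finite[OF fin]) auto
  have "\<exists>r. strict_mono r \<and> (\<forall>n. P n (r n))"
  proof -
    have "\<exists>k. P 0 k" using eventually_happens[OF ev[of 0]] by auto
    moreover have "\<exists>k'. P (Suc n) k' \<and> k < k'" for n k
      using eventually_happens[OF eventually_conj[OF ev[of "Suc n"] eventually_gt_at_top[of k]]] by auto
    ultimately obtain r where "\<And>n. P n (r n)" "\<And>n. r n < r (Suc n)"
      using dependent_nat_choice[of P "\<lambda>_ k k'. k < k'"] by metis
    then show ?thesis using strict_mono_Suc_iff by blast
  qed
  then obtain r where r: "strict_mono r" "\<And>n. P n (r n)" by blast
  have "AE \<omega> in M. (\<lambda>k. X (r k) \<omega>) \<longlonglongrightarrow> Y \<omega>" if XY: "(X, Y) \<in> \<F>" for X Y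
  proof -
    have [measurable]: "X k \<in> borel_measurable M" "Y \<in> borel_measurable M" for k using meas XY by auto
    define A where "A n = {\<omega> \<in> space M. norm (X (r n) \<omega> - Y \<omega>) > (1 / 2) ^ n}" for n
    have "summable (\<lambda>n. measure M (A n))"
    proof (rule summable_comparison_test'[OF summable_geometric[of "1 / 2 :: real"]])
      show "norm (measure M (A n)) \<le> (1 / 2) ^ n" for n
        using r(2)[of n] XY unfolding P_def A_def by fastforce
    qed simp
    then have "AE \<omega> in M. eventually (\<lambda>n. \<omega> \<in> space M - A n) sequentially"
      unfolding A_def by (intro borel_cantelli_AE1) (auto simp: emeasure_eq_measure less_top[symmetric])
    then show ?thesis
    proof eventually_elim
      case (elim \<omega>)
      then have "\<forall>\<^sub>F n in sequentially. norm (X (r n) \<omega> - Y \<omega>) \<le> (1 / 2) ^ n"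
        by eventually_elim (auto simp: A_def)
      then have "(\<lambda>n. X (r n) \<omega> - Y \<omega>) \<longlonglongrightarrow> 0"
        by (rule Lim_null_comparison) (intro LIMSEQ_realpow_zero, auto)
      then show ?case by (simp add: LIM_zero_iff)
    qed
  qed
  then show ?thesis using r(1) by (intro exI[of _ r]) auto
qed

section \<open>Absolute continuity under maps, mixtures and restriction to the grid\<close>

lemma absolutely_continuous_trans:
  "absolutely_continuous M N \<Longrightarrow> absolutely_continuous N P \<Longrightarrow> absolutely_continuous M P"
  unfolding absolutely_continuous_def by blast

lemma absolutely_continuous_distr:
  assumes ac: "absolutely_continuous (distr M N f) (distr M' N f')"
    and [measurable]: "f \<in> measurable M N" "f' \<in> measurable M' N" "g \<in> measurable N P"
  shows "absolutely_continuous (distr M P (\<lambda>x. g (f x))) (distr M' P (\<lambda>x. g (f' x)))"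
  unfolding absolutely_continuous_def
proof
  fix A assume A: "A \<in> null_sets (distr M P (\<lambda>x. g (f x)))"
  then have "g -` A \<inter> space N \<in> null_sets (distr M N f)"
    using measurable_space[of f M N] by (auto simp: null_sets_distr_iff vimage_def Int_def conj_ac cong: conj_cong)
  then have "g -` A \<inter> space N \<in> null_sets (distr M' N f')" using ac unfolding absolutely_continuous_def by blast
  then show "A \<in> null_sets (distr M' P (\<lambda>x. g (f' x)))"
    using A measurable_space[of f' M' N] by (auto simp: null_sets_distr_iff vimage_def Int_def conj_ac cong: conj_cong)
qed

lemma mixture_absolutely_continuous:
  assumes M: "prob_space M"
    and ind: "prob_space.indep_var M N1 w N2 z"
    and F[measurable]: "case_prod F \<in> measurable (N1 \<Otimes>\<^sub>M N2) P"
    and G[measurable]: "case_prod G \<in> measurable (N1 \<Otimes>\<^sub>M N2) P"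
    and ac: "AE \<omega> in M. absolutely_continuous (distr M P (\<lambda>\<omega>'. F (w \<omega>') (z \<omega>))) (distr M P (\<lambda>\<omega>'. G (w \<omega>') (z \<omega>)))"
  shows "absolutely_continuous (distr M P (\<lambda>\<omega>. F (w \<omega>) (z \<omega>))) (distr M P (\<lambda>\<omega>. G (w \<omega>) (z \<omega>)))"
proof -
  interpret prob_space M by fact
  have w[measurable]: "w \<in> measurable M N1" and z[measurable]: "z \<in> measurable M N2"
    using indep_var_rv1[OF ind] indep_var_rv2[OF ind] by auto
  interpret D1: prob_space "distr M N1 w" by (rule prob_space_distr) simp
  interpret D2: prob_space "distr M N2 z" by (rule prob_space_distr) simp
  interpret D: pair_prob_space "distr M N1 w" "distr M N2 z" ..
  have law: "distr M (N1 \<Otimes>\<^sub>M N2) (\<lambda>\<omega>. (w \<omega>, z \<omega>)) = distr M N1 w \<Otimes>\<^sub>M distr M N2 z"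
    using ind unfolding indep_var_distribution_eq by simp
  have slice: "A \<in> null_sets (distr M P (\<lambda>\<omega>. H (w \<omega>) (z \<omega>))) \<longleftrightarrow>
      (AE \<omega> in M. A \<in> null_sets (distr M P (\<lambda>\<omega>'. H (w \<omega>') (z \<omega>))))"
    if H[measurable]: "case_prod H \<in> measurable (N1 \<Otimes>\<^sub>M N2) P" and A[measurable]: "A \<in> sets P" for H A
  proof -
    define X where "X = case_prod H -` A \<inter> space (N1 \<Otimes>\<^sub>M N2)"
    have X[measurable]: "X \<in> sets (N1 \<Otimes>\<^sub>M N2)" unfolding X_def by measurable
    have X': "X \<in> sets (distr M N1 w \<Otimes>\<^sub>M distr M N2 z)"
      using X by (simp cong: sets_pair_measure_cong)
    have sect: "(\<lambda>x. (x, y)) -` X \<in> sets N1" for y by (rule sets_Pair2[OF X])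
    have m: "(\<lambda>y. emeasure (distr M N1 w) ((\<lambda>x. (x, y)) -` X)) \<in> borel_measurable N2"
      using D.measurable_emeasure_Pair2[OF X'] by simp
    have "emeasure M ((\<lambda>\<omega>. H (w \<omega>) (z \<omega>)) -` A \<inter> space M) = emeasure (distr M (N1 \<Otimes>\<^sub>M N2) (\<lambda>\<omega>. (w \<omega>, z \<omega>))) X"
      using measurable_space[OF w] measurable_space[OF z]
      by (subst emeasure_distr) (auto intro!: arg_cong[where f="emeasure M"] simp: X_def space_pair_measure)
    also have "\<dots> = (\<integral>\<^sup>+y. emeasure (distr M N1 w) ((\<lambda>x. (x, y)) -` X) \<partial>distr M N2 z)"
      unfolding law by (rule D.emeasure_pair_measure_alt2[OF X'])
    also have "\<dots> = (\<integral>\<^sup>+\<omega>. emeasure (distr M N1 w) ((\<lambda>x. (x, z \<omega>)) -` X) \<partial>M)"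
      using m by (subst nn_integral_distr) auto
    also have "\<dots> = (\<integral>\<^sup>+\<omega>. emeasure M ((\<lambda>\<omega>'. H (w \<omega>') (z \<omega>)) -` A \<inter> space M) \<partial>M)"
      using measurable_space[OF w] measurable_space[OF z] sect
      by (intro nn_integral_cong, subst emeasure_distr)
        (auto intro!: arg_cong[where f="emeasure M"] simp: X_def space_pair_measure)
    finally have eq: "emeasure M ((\<lambda>\<omega>. H (w \<omega>) (z \<omega>)) -` A \<inter> space M) =
        (\<integral>\<^sup>+\<omega>. emeasure M ((\<lambda>\<omega>'. H (w \<omega>') (z \<omega>)) -` A \<inter> space M) \<partial>M)" .
    have "(\<lambda>\<omega>. emeasure M ((\<lambda>\<omega>'. H (w \<omega>') (z \<omega>)) -` A \<inter> space M)) \<in> borel_measurable M"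
    proof (rule measurable_cong[THEN iffD1, OF _ measurable_compose[OF z m]])
      show "emeasure (distr M N1 w) ((\<lambda>x. (x, z \<omega>)) -` X) = emeasure M ((\<lambda>\<omega>'. H (w \<omega>') (z \<omega>)) -` A \<inter> space M)"
        if "\<omega> \<in> space M" for \<omega>
        using measurable_space[OF w] measurable_space[OF z] sect that
        by (subst emeasure_distr) (auto intro!: arg_cong[where f="emeasure M"] simp: X_def space_pair_measure)
    qed
    from nn_integral_0_iff_AE[OF this]
    have 1: "emeasure M ((\<lambda>\<omega>. H (w \<omega>) (z \<omega>)) -` A \<inter> space M) = 0 \<longleftrightarrow>
        (AE \<omega> in M. emeasure M ((\<lambda>\<omega>'. H (w \<omega>') (z \<omega>)) -` A \<inter> space M) = 0)" by (simp only: eq)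
    have Hm: "(\<lambda>\<omega>. H (w \<omega>) (z \<omega>)) \<in> measurable M P"
      using measurable_compose[OF measurable_Pair[OF w z] H] by simp
    have "(\<lambda>\<omega>'. H (w \<omega>') (z \<omega>)) \<in> measurable M P" if "\<omega> \<in> space M" for \<omega>
      using measurable_compose[OF measurable_Pair[OF w measurable_const[OF measurable_space[OF z that]]] H] by simp
    then have 2: "(AE \<omega> in M. emeasure M ((\<lambda>\<omega>'. H (w \<omega>') (z \<omega>)) -` A \<inter> space M) = 0) \<longleftrightarrow>
        (AE \<omega> in M. A \<in> null_sets (distr M P (\<lambda>\<omega>'. H (w \<omega>') (z \<omega>))))"
      by (intro AE_cong) (simp add: null_sets_def emeasure_distr)
    have "A \<in> null_sets (distr M P (\<lambda>\<omega>. H (w \<omega>) (z \<omega>))) \<longleftrightarrow>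
        emeasure M ((\<lambda>\<omega>. H (w \<omega>) (z \<omega>)) -` A \<inter> space M) = 0"
      using A by (simp add: null_sets_def emeasure_distr[OF Hm])
    then show ?thesis unfolding 1 2 .
  qed
  show ?thesis
    unfolding absolutely_continuous_def
  proof
    fix A assume A: "A \<in> null_sets (distr M P (\<lambda>\<omega>. F (w \<omega>) (z \<omega>)))"
    then have As: "A \<in> sets P" by auto
    have "AE \<omega> in M. A \<in> null_sets (distr M P (\<lambda>\<omega>'. F (w \<omega>') (z \<omega>)))"
      using A slice[OF F As] by blast
    with ac have "AE \<omega> in M. A \<in> null_sets (distr M P (\<lambda>\<omega>'. G (w \<omega>') (z \<omega>)))"
      by eventually_elim (auto simp: absolutely_continuous_def)
    then show "A \<in> null_sets (distr M P (\<lambda>\<omega>. G (w \<omega>) (z \<omega>)))"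
      using slice[OF G As] by blast
  qed
qed

text \<open>Both directions are wanted: the Gaussian hypothesis is carried to the grid, and the
  conclusion for the full processes is carried back.\<close>

lemma skorohod_law_absolutely_continuous_iff:
  fixes X X' :: "real \<Rightarrow> 'w \<Rightarrow> 'h::{metric_space, second_countable_topology}"
  assumes T: "T > 0"
    and X: "sample_path {0..T} X \<in> measurable M (skorohod_borel T)"
    and X': "sample_path {0..T} X' \<in> measurable M (skorohod_borel T)"
  shows "absolutely_continuous (skorohod_law M T X) (skorohod_law M T X') \<longleftrightarrow>
    absolutely_continuous (distr M borel (\<lambda>\<omega> p. X (dyadic_time T p) \<omega>))
      (distr M borel (\<lambda>\<omega> p. X' (dyadic_time T p) \<omega>))"
proof -
  let ?e = "\<lambda>x p. x (dyadic_time T p)"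
  let ?B = "skorohod_borel T :: (real \<Rightarrow> 'h) measure"
  have val: "?e (sample_path {0..T} Y \<omega>) = (\<lambda>p. Y (dyadic_time T p) \<omega>)" for Y :: "real \<Rightarrow> 'w \<Rightarrow> 'h" and \<omega>
    unfolding sample_path_def using dyadic_time_in[of T] T by auto
  have e: "?e \<in> measurable ?B (borel :: (nat \<times> nat \<Rightarrow> 'h) measure)"
    using T by (intro measurable_coordinatewise_then_product skorohod_evaluation_measurable dyadic_time_in) auto
  have em: "(\<lambda>\<omega> p. Y (dyadic_time T p) \<omega>) \<in> borel_measurable M"
    if "sample_path {0..T} Y \<in> measurable M ?B" for Y
    using measurable_compose[OF that e] unfolding val .
  have null: "?e -` A \<inter> skorohod_space T \<in> null_sets (skorohod_law M T Y) \<longleftrightarrow>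
      A \<in> null_sets (distr M borel (\<lambda>\<omega> p. Y (dyadic_time T p) \<omega>))"
    if Y: "sample_path {0..T} Y \<in> measurable M ?B" and A: "A \<in> sets borel" for A Y
  proof -
    have eA: "?e -` A \<inter> skorohod_space T \<in> sets ?B"
      using measurable_sets[OF e A] by (simp add: space_skorohod_borel)
    have "sample_path {0..T} Y -` (?e -` A \<inter> skorohod_space T) \<inter> space M =
        (\<lambda>\<omega> p. Y (dyadic_time T p) \<omega>) -` A \<inter> space M"
      using measurable_space[OF Y] by (auto simp: space_skorohod_borel val)
    then show ?thesis
      unfolding skorohod_law_def null_sets_def using eA A
      by (simp add: emeasure_distr[OF Y] emeasure_distr[OF em[OF Y]])
  qed
  have repr: "\<exists>A\<in>sets borel. B = ?e -` A \<inter> skorohod_space T" if "B \<in> sets ?B" for B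
    using that unfolding sets_skorohod_borel_eq_vimage_algebra[OF T]
    by (subst (asm) sets_vimage_algebra2) auto
  show ?thesis
  proof
    assume ac: "absolutely_continuous (skorohod_law M T X) (skorohod_law M T X')"
    show "absolutely_continuous (distr M borel (\<lambda>\<omega> p. X (dyadic_time T p) \<omega>))
      (distr M borel (\<lambda>\<omega> p. X' (dyadic_time T p) \<omega>))"
      unfolding absolutely_continuous_def
    proof
      fix A assume A: "A \<in> null_sets (distr M borel (\<lambda>\<omega> p. X (dyadic_time T p) \<omega>))"
      then have As: "A \<in> sets borel" by auto
      show "A \<in> null_sets (distr M borel (\<lambda>\<omega> p. X' (dyadic_time T p) \<omega>))"
        using A ac null[OF X As] null[OF X' As] unfolding absolutely_continuous_def by blast
    qed
  next
    assume ac: "absolutely_continuous (distr M borel (\<lambda>\<omega> p. X (dyadic_time T p) \<omega>))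
      (distr M borel (\<lambda>\<omega> p. X' (dyadic_time T p) \<omega>))"
    show "absolutely_continuous (skorohod_law M T X) (skorohod_law M T X')"
      unfolding absolutely_continuous_def
    proof
      fix B assume B: "B \<in> null_sets (skorohod_law M T X)"
      then have "B \<in> sets ?B" unfolding skorohod_law_def by auto
      then obtain A where A: "A \<in> sets borel" "B = ?e -` A \<inter> skorohod_space T" using repr by blast
      show "B \<in> null_sets (skorohod_law M T X')"
        using B ac null[OF X A(1)] null[OF X' A(1)] A(2) unfolding absolutely_continuous_def by blast
    qed
  qed
qed

section \<open>Ornstein-Uhlenbeck processes on the dyadic grid\<close>

text \<open>The partition points \<open>min (i T / 2\<^sup>k) t\<close> of \<open>[0, t]\<close> for a dyadic time \<open>t\<close> are dyadic times, so
  Riemann sums depend only on the values of a path on the dyadic grid.\<close>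

definition grid_index :: "real \<Rightarrow> nat \<times> nat \<Rightarrow> nat \<Rightarrow> nat \<Rightarrow> nat \<times> nat" where
  "grid_index T p k i = (if dyadic_time T (k, i) \<le> dyadic_time T p then (k, i) else p)"

definition grid_sum ::
  "real \<Rightarrow> (real \<Rightarrow> 'h::real_normed_vector \<Rightarrow>\<^sub>L 'h) \<Rightarrow> nat \<times> nat \<Rightarrow> nat \<Rightarrow> (nat \<times> nat \<Rightarrow> 'h) \<Rightarrow> 'h" where
  "grid_sum T \<Phi> p k s = (\<Sum>i<2 ^ k. \<Phi> (dyadic_time T (grid_index T p k i))
     (s (grid_index T p k (Suc i)) - s (grid_index T p k i)))"

lemma grid_sum_eq_riemann_sum:
  "grid_sum T \<Phi> p k (\<lambda>p. w (dyadic_time T p)) = riemann_sum T \<Phi> (dyadic_time T p) k w"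
proof -
  have "dyadic_time T (grid_index T p k i) = min (real i * T / 2 ^ k) (dyadic_time T p)" for i
    unfolding grid_index_def by (auto simp: dyadic_time_def)
  then show ?thesis unfolding grid_sum_def riemann_sum_def by simp
qed

lemma grid_sum_add: "grid_sum T \<Phi> p k (\<lambda>p. s p + t p) = grid_sum T \<Phi> p k s + grid_sum T \<Phi> p k t"
  unfolding grid_sum_def sum.distrib[symmetric] by (simp add: blinfun.bilinear_simps algebra_simps)

text \<open>Riemann sums see increments only, so convolutions can be computed from
  \<open>W - W 0\<close>, the process whose law is compared with its shifts.\<close>

lemma grid_sum_diff_const: "grid_sum T \<Phi> p k (\<lambda>p. s p - a) = grid_sum T \<Phi> p k s"
  unfolding grid_sum_def by simp

lemma grid_sum_diff_operator:
  "grid_sum T (\<lambda>s. \<Phi> s - \<Psi> s) p k s = grid_sum T \<Phi> p k s - grid_sum T \<Psi> p k s"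
  unfolding grid_sum_def by (simp add: blinfun.diff_left sum_subtractf)

lemma grid_sum_measurable[measurable]:
  fixes \<Phi> :: "real \<Rightarrow> 'h::{real_normed_vector, second_countable_topology} \<Rightarrow>\<^sub>L 'h"
  shows "grid_sum T \<Phi> p k \<in> borel_measurable borel"
proof -
  have [measurable]: "(\<lambda>x. blinfun_apply A x) \<in> borel_measurable borel" for A :: "'h \<Rightarrow>\<^sub>L 'h"
    by (intro borel_measurable_continuous_onI linear_continuous_on blinfun.bounded_linear_right)
  show ?thesis unfolding grid_sum_def by measurable
qed

text \<open>A version of the stochastic convolution that is a function of the driving values in
  every scenario, with an arbitrary value where the sums diverge. The subsequence may depend on the
  grid time.\<close>

definition grid_limit ::
  "real \<Rightarrow> (nat \<times> nat \<Rightarrow> nat \<Rightarrow> nat) \<Rightarrow> (real \<Rightarrow> 'h::real_normed_vector \<Rightarrow>\<^sub>L 'h) \<Rightarrow>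
    (nat \<times> nat \<Rightarrow> 'h) \<Rightarrow> nat \<times> nat \<Rightarrow> 'h" where
  "grid_limit T r S s p = lim (\<lambda>k. grid_sum T (\<lambda>t. S (dyadic_time T p - t)) p (r p k) s)"

lemma grid_limit_measurable[measurable]:
  fixes S :: "real \<Rightarrow> 'h::{banach, second_countable_topology} \<Rightarrow>\<^sub>L 'h"
  shows "grid_limit T r S \<in> borel_measurable borel"
  unfolding grid_limit_def[abs_def]
  by (intro measurable_coordinatewise_then_product borel_measurable_lim_metric) measurable

lemma grid_sum_convolution:
  fixes S :: "real \<Rightarrow> 'h::{banach, second_countable_topology} \<Rightarrow>\<^sub>L 'h"
  assumes S: "c0_semigroup S" and T: "T > 0"
    and f: "set_integrable lborel {0..dyadic_time T p} f"
    and F: "\<And>t. t \<in> {0..T} \<Longrightarrow> F t = (LINT s:{0..t}|lborel. f s)"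
    and r: "strict_mono r"
  shows "(\<lambda>k. grid_sum T (\<lambda>t. S (dyadic_time T p - t)) p (r k) (\<lambda>p. F (dyadic_time T p))) \<longlonglongrightarrow>
    (LINT s:{0..dyadic_time T p}|lborel. S (dyadic_time T p - s) (f s))"
proof -
  have q: "dyadic_time T p \<in> {0..T}" using T by (intro dyadic_time_in) simp
  have "(\<lambda>k. grid_sum T (\<lambda>t. S (dyadic_time T p - t)) p k (\<lambda>p. F (dyadic_time T p))) \<longlonglongrightarrow>
      (LINT s:{0..dyadic_time T p}|lborel. S (dyadic_time T p - s) (f s))"
    unfolding grid_sum_eq_riemann_sum
    by (rule riemann_sum_convolution(1)[OF S T q f]) (use F q in auto)
  from LIMSEQ_subseq_LIMSEQ[OF this r] show ?thesis by (simp add: o_def)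
qed

lemma set_integrable_operator_L2:
  fixes R :: "'h::{real_inner, banach, second_countable_topology} \<Rightarrow>\<^sub>L 'h"
  assumes u: "u \<in> L2_space T" and t: "t \<le> T"
  shows "set_integrable lborel {0..t} (\<lambda>s. R (u s))"
proof -
  have "integrable lborel (\<lambda>s. indicator {0..t} s *\<^sub>R R (indicator {0..T} s *\<^sub>R u s))"
    by (intro integrable_mult_indicator integrable_bounded_linear[OF blinfun.bounded_linear_right]
        L2_space_facts(3)[OF u]) simp
  moreover have "indicator {0..t} s *\<^sub>R R (indicator {0..T} s *\<^sub>R u s) = indicator {0..t} s *\<^sub>R R (u s)" for s
    using t by (auto simp: indicator_def)
  ultimately show ?thesis unfolding set_integrable_def by simp
qed

lemma uminus_L2_space:
  assumes "u \<in> L2_space T"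
  shows "(\<lambda>s. - u s) \<in> L2_space T"
proof -
  have "(\<lambda>s. indicator {0..T} s *\<^sub>R - u s) = (\<lambda>s. - (indicator {0..T} s *\<^sub>R u s))" by auto
  then show ?thesis
    using assms unfolding L2_space_def set_borel_measurable_def by simp
qed

lemma distr_AE_eq:
  assumes "AE x in M. f x = g x" "f \<in> measurable M N" "g \<in> measurable M N"
  shows "distr M N f = distr M N g"
  using assms by (intro distr_cong_AE) auto

text \<open>Absolute continuity of the noise is pushed through \<open>grid_limit\<close>. Wherever
  the sums of the noise converge, those of the shifted noise converge to the same limit plus the
  deterministic convolution, because sums are additive and the shift is an integral.\<close>

lemma ornstein_uhlenbeck_cameron_martin:
  fixes Q :: "'h::{real_inner, banach, second_countable_topology} \<Rightarrow>\<^sub>L 'h"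
  assumes M: "prob_space M" and W: "wiener_process M Q W" and Q: "nonneg_operator Q"
    and T: "T > 0" and u: "u \<in> L2_space T" and S: "c0_semigroup S"
    and r: "\<And>p. strict_mono (r p)"
    and conv: "AE \<omega> in M. \<forall>p. convergent
      (\<lambda>k. grid_sum T (\<lambda>t. S (dyadic_time T p - t)) p (r p k) (\<lambda>p. W (dyadic_time T p) \<omega>))"
  defines "G \<equiv> \<lambda>\<omega>. grid_limit T r S (\<lambda>p. W (dyadic_time T p) \<omega> - W 0 \<omega>)"
  shows "absolutely_continuous (distr M borel G)
    (distr M borel (\<lambda>\<omega> p. G \<omega> p +
      (LINT s:{0..dyadic_time T p}|lborel. S (dyadic_time T p - s) (operator_sqrt Q (u s)))))"
proof -
  define V where "V \<omega> p = W (dyadic_time T p) \<omega> - W 0 \<omega>" for \<omega> p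
  define h where "h p = path_shift Q u (dyadic_time T p)" for p
  define D where "D p = (LINT s:{0..dyadic_time T p}|lborel. S (dyadic_time T p - s) (operator_sqrt Q (u s)))" for p
  have Wm[measurable]: "W (dyadic_time T p) \<in> borel_measurable M" "W 0 \<in> borel_measurable M" for p
    using W dyadic_time_in[of T p] T unfolding wiener_process_def by auto
  have V[measurable]: "V \<in> borel_measurable M"
    unfolding V_def[abs_def] by (rule measurable_coordinatewise_then_product) measurable
  have Vh[measurable]: "(\<lambda>\<omega> p. V \<omega> p + h p) \<in> borel_measurable M"
    unfolding V_def by (rule measurable_coordinatewise_then_product) measurable
  have G: "G = (\<lambda>\<omega>. grid_limit T r S (V \<omega>))" unfolding G_def V_def ..
  have Gm[measurable]: "G \<in> borel_measurable M" unfolding G by measurable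
  have "absolutely_continuous (distr M borel V) (distr M borel (\<lambda>\<omega> p. V \<omega> p + h p))"
    unfolding V_def[abs_def] h_def by (rule wiener_cameron_martin[OF M W Q T u])
  then have "absolutely_continuous (distr M borel G) (distr M borel (\<lambda>\<omega>. grid_limit T r S (\<lambda>p. V \<omega> p + h p)))"
    unfolding G by (rule absolutely_continuous_distr) measurable
  moreover have "distr M borel (\<lambda>\<omega>. grid_limit T r S (\<lambda>p. V \<omega> p + h p)) = distr M borel (\<lambda>\<omega> p. G \<omega> p + D p)"
  proof (rule distr_AE_eq)
    show "AE \<omega> in M. grid_limit T r S (\<lambda>p. V \<omega> p + h p) = (\<lambda>p. G \<omega> p + D p)"
      using conv
    proof eventually_elim
      case (elim \<omega>)
      show ?case
      proof
        fix p
        let ?g = "\<lambda>k. grid_sum T (\<lambda>t. S (dyadic_time T p - t)) p (r p k)"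
        have V_eq: "?g k (V \<omega>) = ?g k (\<lambda>p. W (dyadic_time T p) \<omega>)" for k
          unfolding V_def by (rule grid_sum_diff_const)
        have "(\<lambda>k. ?g k (V \<omega>)) \<longlonglongrightarrow> G \<omega> p"
          using elim[rule_format, of p] unfolding G grid_limit_def V_eq by (simp add: convergent_LIMSEQ_iff)
        moreover have "(\<lambda>k. ?g k h) \<longlonglongrightarrow> D p"
          unfolding h_def[abs_def] D_def
        proof (rule grid_sum_convolution[OF S T _ _ r])
          show "set_integrable lborel {0..dyadic_time T p} (\<lambda>s. operator_sqrt Q (u s))"
            by (rule set_integrable_operator_L2[OF u]) (use dyadic_time_in[of T p] T in auto)
        qed (simp add: path_shift_def)
        ultimately have "(\<lambda>k. ?g k (\<lambda>p. V \<omega> p + h p)) \<longlonglongrightarrow> G \<omega> p + D p"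
          unfolding grid_sum_add by (rule tendsto_add)
        then show "grid_limit T r S (\<lambda>p. V \<omega> p + h p) p = G \<omega> p + D p"
          unfolding grid_limit_def by (rule limI)
      qed
    qed
    show "(\<lambda>\<omega>. grid_limit T r S (\<lambda>p. V \<omega> p + h p)) \<in> borel_measurable M"
      by (rule measurable_compose[OF Vh]) measurable
    show "(\<lambda>\<omega> p. G \<omega> p + D p) \<in> borel_measurable M"
      by (rule measurable_coordinatewise_then_product) (intro borel_measurable_add measurable_compose[OF Gm] borel_measurable_const measurable_product_coordinates)
  qed
  ultimately show ?thesis unfolding D_def by simp
qed

lemma absolutely_continuous_distr_translate:
  fixes f f' :: "'a \<Rightarrow> 'i::countable \<Rightarrow> 'h::{real_normed_vector, second_countable_topology}"
  assumes "absolutely_continuous (distr M borel f) (distr M borel f')"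
    and "f \<in> borel_measurable M" "f' \<in> borel_measurable M"
  shows "absolutely_continuous (distr M borel (\<lambda>\<omega> p. f \<omega> p + a p)) (distr M borel (\<lambda>\<omega> p. f' \<omega> p + a p))"
proof -
  have "(\<lambda>s p. s p + a p) \<in> borel_measurable (borel :: ('i \<Rightarrow> 'h) measure)"
    by (rule measurable_coordinatewise_then_product) measurable
  from absolutely_continuous_distr[OF assms this] show ?thesis .
qed

section \<open>Comparison of the full laws with the jump part frozen\<close>

theorem theoremA:
  fixes M :: "'w measure"
    and T :: real
    and A A' :: "('h::{real_inner, banach, second_countable_topology} \<times> 'h) set"
    and S S' :: "real \<Rightarrow> 'h \<Rightarrow>\<^sub>L 'h"
    and L W Z :: "real \<Rightarrow> 'w \<Rightarrow> 'h"
    and b :: 'h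
    and Q :: "'h \<Rightarrow>\<^sub>L 'h"
    and Y Y' J J' X X' K :: "real \<Rightarrow> 'w \<Rightarrow> 'h"
  assumes "prob_space M"
    and "T > 0"
    and "generates_c0_semigroup A S"
    and "generates_c0_semigroup A' S'"
    and "levy_ito_decomposition M L b Q W Z"
    and "cadlag_convolution M T S W Y"
    and "cadlag_convolution M T S' W Y'"
    and "cadlag_convolution M T S Z J"
    and "cadlag_convolution M T S' Z J'"
    and "cadlag_convolution M T S L X"
    and "cadlag_convolution M T S' L X'"
    and "cadlag_convolution M T (\<lambda>r. S r - S' r) Z K"
    and "absolutely_continuous (skorohod_law M T Y') (skorohod_law M T Y)"
    and "\<exists>U :: 'w \<Rightarrow> real \<Rightarrow> 'h.
           U \<in> measurable (process_algebra M Z) (L2_borel T) \<and>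
           prob_space.indep_var M (L2_borel T) U path_measure (sample_path {0..} W) \<and>
           (AE \<omega> in M. \<forall>t\<in>{0..T}.
              K t \<omega> + (LINT s:{0..t}|lborel. (S (t - s) - S' (t - s)) b) =
              (LINT s:{0..t}|lborel. S' (t - s) (operator_sqrt Q (U \<omega> s))))"
  shows "absolutely_continuous (skorohod_law M T X') (skorohod_law M T X) \<and>
         (mutually_absolutely_continuous (skorohod_law M T Y) (skorohod_law M T Y') \<longrightarrow>
          mutually_absolutely_continuous (skorohod_law M T X) (skorohod_law M T X'))"
proof -
  interpret prob_space M by fact
  note T = \<open>T > 0\<close>
  let ?q = "dyadic_time T"
  have q: "?q p \<in> {0..T}" for p using T by (intro dyadic_time_in) simp
  have S: "c0_semigroup S" and S': "c0_semigroup S'"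
    using assms(3,4) unfolding generates_c0_semigroup_def by auto
  have L: "levy_process M L" and trQ: "nonneg_trace_class Q" and W: "wiener_process M Q W"
    and Z: "jump_part_of M L Z"
    and ind: "indep_var path_measure (sample_path {0..} W) path_measure (sample_path {0..} Z)"
    and decomp: "AE \<omega> in M. \<forall>t\<ge>0. L t \<omega> = t *\<^sub>R b + W t \<omega> + Z t \<omega>"
    using assms(5) unfolding levy_ito_decomposition_def by auto
  have Q: "nonneg_operator Q" using trQ unfolding nonneg_trace_class_def by blast
  obtain U where U: "U \<in> measurable (process_algebra M Z) (L2_borel T)"
    and shift: "AE \<omega> in M. \<forall>t\<in>{0..T}.
       K t \<omega> + (LINT s:{0..t}|lborel. (S (t - s) - S' (t - s)) b) =
       (LINT s:{0..t}|lborel. S' (t - s) (operator_sqrt Q (U \<omega> s)))"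
    using assms(14) by blast
  have U_L2: "U \<omega> \<in> L2_space T" if "\<omega> \<in> space M" for \<omega>
  proof -
    have "space (L2_borel T :: (real \<Rightarrow> 'h) measure) = L2_space T"
      unfolding L2_borel_def by (rule space_measure_of) auto
    then show ?thesis using measurable_space[OF U] that unfolding process_algebra_def by simp
  qed
  have [measurable]: "W t \<in> borel_measurable M" "Z t \<in> borel_measurable M" "L t \<in> borel_measurable M"
    if "t \<ge> 0" for t
    using W Z L that
    unfolding wiener_process_def jump_part_of_def levy_process_def cadlag_process_def by auto
  then have grid_meas: "W (?q p) \<in> borel_measurable M" "Z (?q p) \<in> borel_measurable M"
    "L (?q p) \<in> borel_measurable M" for p
    using q[of p] by auto
  define P where "P = (\<lambda>S (V :: real \<Rightarrow> 'w \<Rightarrow> 'h) p k \<omega>. grid_sum T (\<lambda>t. S (?q p - t)) p k (\<lambda>p. V (?q p) \<omega>))"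
  define \<F> where "\<F> p = {(P S W p, Y (?q p)), (P S' W p, Y' (?q p)), (P S' Z p, J' (?q p)),
    (P (\<lambda>r. S r - S' r) Z p, K (?q p)), (P S L p, X (?q p)), (P S' L p, X' (?q p))}" for p
  have "\<exists>r :: nat \<Rightarrow> nat. strict_mono r \<and> (\<forall>(f, g)\<in>\<F> p. AE \<omega> in M. (\<lambda>k. f (r k) \<omega>) \<longlonglongrightarrow> g \<omega>)" for p
  proof (rule AE_convergent_subsequence[OF \<open>prob_space M\<close>])
    show "finite (\<F> p)" unfolding \<F>_def by simp
    fix f g assume "(f, g) \<in> \<F> p"
    then obtain S0 :: "real \<Rightarrow> 'h \<Rightarrow>\<^sub>L 'h" and V N where f: "f = P S0 V p" and g: "g = N (?q p)"
      and conv: "cadlag_convolution M T S0 V N" and V: "V \<in> {W, Z, L}"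
      unfolding \<F>_def using assms(6,7,9,10,11,12) by auto
    have int: "has_stochastic_integral M (\<lambda>s. S0 (?q p - s)) V (?q p) g"
      using conv q[of p] unfolding cadlag_convolution_def g by blast
    then show "g \<in> borel_measurable M" unfolding has_stochastic_integral_def by blast
    have "(\<lambda>\<omega> p. V (?q p) \<omega>) \<in> borel_measurable M"
      using V grid_meas by (intro measurable_coordinatewise_then_product) auto
    then show "f k \<in> borel_measurable M" for k
      unfolding f P_def by (rule measurable_compose) measurable
    show "\<forall>\<^sub>F k in sequentially. measure M {\<omega> \<in> space M. norm (f k \<omega> - g \<omega>) > e} < e" if "e > 0" for e
      using stochastic_integral_riemann_sum[OF T q int that]
      unfolding f P_def grid_sum_eq_riemann_sum[where w="\<lambda>s. V s \<omega>" for \<omega>] .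
  qed
  \<comment> \<open>Each grid time gets its own subsequence. There are countably many of them, so
    one null set carries all exceptional scenarios.\<close>
  then have "\<exists>r. \<forall>p. strict_mono (r p) \<and> (\<forall>(f, g)\<in>\<F> p. AE \<omega> in M. (\<lambda>k. f (r p k) \<omega>) \<longlonglongrightarrow> g \<omega>)"
    by (intro choice allI)
  then obtain r where r0: "\<And>p. strict_mono (r p) \<and> (\<forall>(f, g)\<in>\<F> p. AE \<omega> in M. (\<lambda>k. f (r p k) \<omega>) \<longlonglongrightarrow> g \<omega>)"
    by (elim exE) (rule that, erule spec)
  have r: "strict_mono (r p)" for p using r0 by (rule conjunct1)
  have r_lim: "AE \<omega> in M. (\<lambda>k. f (r p k) \<omega>) \<longlonglongrightarrow> g \<omega>" if "(f, g) \<in> \<F> p" for p f g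
    using bspec[OF conjunct2[OF r0] that] by simp
  have lim: "AE \<omega> in M. \<forall>p. (\<lambda>k. P S W p (r p k) \<omega>) \<longlonglongrightarrow> Y (?q p) \<omega>"
    "AE \<omega> in M. \<forall>p. (\<lambda>k. P S' W p (r p k) \<omega>) \<longlonglongrightarrow> Y' (?q p) \<omega>"
    "AE \<omega> in M. \<forall>p. (\<lambda>k. P S' Z p (r p k) \<omega>) \<longlonglongrightarrow> J' (?q p) \<omega>"
    "AE \<omega> in M. \<forall>p. (\<lambda>k. P (\<lambda>r. S r - S' r) Z p (r p k) \<omega>) \<longlonglongrightarrow> K (?q p) \<omega>"
    "AE \<omega> in M. \<forall>p. (\<lambda>k. P S L p (r p k) \<omega>) \<longlonglongrightarrow> X (?q p) \<omega>"
    "AE \<omega> in M. \<forall>p. (\<lambda>k. P S' L p (r p k) \<omega>) \<longlonglongrightarrow> X' (?q p) \<omega>"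
    unfolding AE_all_countable by (intro allI r_lim; simp add: \<F>_def)+
  define c where "c p = (LINT s:{0..?q p}|lborel. S (?q p - s) b)" for p
  define c' where "c' p = (LINT s:{0..?q p}|lborel. S' (?q p - s) b)" for p
  have b_int: "set_integrable lborel {0..t} (\<lambda>_. b)" for t :: real
    unfolding set_integrable_def by (intro integrable_scaleR_left integrable_real_indicator)
      (auto simp: emeasure_lborel_Icc_eq)
  have b_F: "t *\<^sub>R b = (LINT s:{0..t}|lborel. b)" if "t \<in> {0..T}" for t
    using that unfolding set_lebesgue_integral_def by simp
  have drift: "(\<lambda>k. P S (\<lambda>t _. t *\<^sub>R b) p (r p k) \<omega>) \<longlonglongrightarrow> c p"
    "(\<lambda>k. P S' (\<lambda>t _. t *\<^sub>R b) p (r p k) \<omega>) \<longlonglongrightarrow> c' p" for p \<omega>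
    unfolding P_def c_def c'_def
    by (rule grid_sum_convolution[where F="\<lambda>t. t *\<^sub>R b", OF S T b_int b_F r]
        grid_sum_convolution[where F="\<lambda>t. t *\<^sub>R b", OF S' T b_int b_F r]; assumption)+
  have c_diff: "(LINT s:{0..?q p}|lborel. (S (?q p - s) - S' (?q p - s)) b) = c p - c' p" for p
    unfolding c_def c'_def blinfun.diff_left
    by (rule set_integral_diff(2)[OF riemann_sum_convolution(2)[OF S T q b_int refl]
        riemann_sum_convolution(2)[OF S' T q b_int refl]])
  define WW where "WW \<omega> p = W (?q p) \<omega> - W 0 \<omega>" for \<omega> p
  define ZZ where "ZZ \<omega> p = Z (?q p) \<omega>" for \<omega> p
  have WW_m[measurable]: "WW \<in> borel_measurable M"
    unfolding WW_def[abs_def] using grid_meas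
    by (intro measurable_coordinatewise_then_product borel_measurable_diff) auto
  have indWZ: "indep_var borel WW borel ZZ"
  proof -
    have m1: "(\<lambda>w p. w (?q p) - w 0) \<in> measurable (path_measure :: (real \<Rightarrow> 'h) measure) borel"
      using q by (intro measurable_coordinatewise_then_product borel_measurable_diff
          measurable_component_singleton) auto
    have m2: "(\<lambda>w p. w (?q p)) \<in> measurable (path_measure :: (real \<Rightarrow> 'h) measure) borel"
      using q by (intro measurable_coordinatewise_then_product measurable_component_singleton) auto
    have "(\<lambda>w p. w (?q p) - w 0) \<circ> sample_path {0..} W = WW" "(\<lambda>w p. w (?q p)) \<circ> sample_path {0..} Z = ZZ"
      using q unfolding WW_def ZZ_def sample_path_def by (auto simp: fun_eq_iff)
    then show ?thesis using indep_var_compose[OF ind m1 m2] by simp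
  qed
  let ?\<Gamma> = "grid_limit T r"
  \<comment> \<open>As functions of the jump path on the grid, \<open>v\<close> is the difference
    \<open>X' - Y'\<close> and \<open>d\<close> the extra shift \<open>(X - Y) - (X' - Y')\<close>.
    Both are Borel by construction, which makes the mixture argument available.\<close>
  define v where "v z p = ?\<Gamma> S' z p + c' p" for z p
  define d where "d z p = ?\<Gamma> (\<lambda>r. S r - S' r) z p + (c p - c' p)" for z p
  define F where "F w z = (\<lambda>p. ?\<Gamma> S w p + (v z p + d z p))" for w z
  define F' where "F' w z = (\<lambda>p. ?\<Gamma> S' w p + v z p)" for w z
  have \<Gamma>_WW: "?\<Gamma> S0 (WW \<omega>) p = y" if "(\<lambda>k. P S0 W p (r p k) \<omega>) \<longlonglongrightarrow> y" for S0 \<omega> p y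
    using that unfolding P_def grid_limit_def WW_def grid_sum_diff_const by (rule limI)
  have \<Gamma>_ZZ: "?\<Gamma> S0 (ZZ \<omega>) p = y" if "(\<lambda>k. P S0 Z p (r p k) \<omega>) \<longlonglongrightarrow> y" for S0 \<omega> p y
    using that unfolding P_def grid_limit_def ZZ_def by (rule limI)
  have repr: "AE \<omega> in M. (\<lambda>p. Y (?q p) \<omega>) = ?\<Gamma> S (WW \<omega>) \<and> (\<lambda>p. Y' (?q p) \<omega>) = ?\<Gamma> S' (WW \<omega>) \<and>
      (\<lambda>p. X (?q p) \<omega>) = F (WW \<omega>) (ZZ \<omega>) \<and> (\<lambda>p. X' (?q p) \<omega>) = F' (WW \<omega>) (ZZ \<omega>)"
    using lim decomp
  proof eventually_elim
    case (elim \<omega>)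
    have X_split: "P S0 L p k \<omega> = P S0 (\<lambda>t _. t *\<^sub>R b) p k \<omega> + P S0 W p k \<omega> + P S0 Z p k \<omega>" for S0 p k
    proof -
      have "(\<lambda>p. L (?q p) \<omega>) = (\<lambda>p. (?q p *\<^sub>R b + W (?q p) \<omega>) + Z (?q p) \<omega>)"
        using elim(7) q by auto
      then show ?thesis unfolding P_def by (simp only: grid_sum_add)
    qed
    \<comment> \<open>At the level of sums the operator S is (S - S') + S', so the jump convolution
      with \<open>S\<close> is the sum of \<open>K\<close> and \<open>J'\<close>.\<close>
    have Z_split: "P S Z p k \<omega> = P (\<lambda>r. S r - S' r) Z p k \<omega> + P S' Z p k \<omega>" for p k
      unfolding P_def by (simp add: grid_sum_diff_operator)
    have "X (?q p) \<omega> = c p + Y (?q p) \<omega> + (K (?q p) \<omega> + J' (?q p) \<omega>)" for p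
    proof (rule LIMSEQ_unique)
      show "(\<lambda>k. P S L p (r p k) \<omega>) \<longlonglongrightarrow> X (?q p) \<omega>" using elim by blast
      show "(\<lambda>k. P S L p (r p k) \<omega>) \<longlonglongrightarrow> c p + Y (?q p) \<omega> + (K (?q p) \<omega> + J' (?q p) \<omega>)"
        unfolding X_split Z_split by (intro tendsto_add drift elim(1,3,4)[rule_format])
    qed
    moreover have "X' (?q p) \<omega> = c' p + Y' (?q p) \<omega> + J' (?q p) \<omega>" for p
    proof (rule LIMSEQ_unique)
      show "(\<lambda>k. P S' L p (r p k) \<omega>) \<longlonglongrightarrow> X' (?q p) \<omega>" using elim by blast
      show "(\<lambda>k. P S' L p (r p k) \<omega>) \<longlonglongrightarrow> c' p + Y' (?q p) \<omega> + J' (?q p) \<omega>"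
        unfolding X_split by (intro tendsto_add drift elim(2,3)[rule_format])
    qed
    moreover have "?\<Gamma> S (WW \<omega>) p = Y (?q p) \<omega>" "?\<Gamma> S' (WW \<omega>) p = Y' (?q p) \<omega>"
      "?\<Gamma> S' (ZZ \<omega>) p = J' (?q p) \<omega>" "?\<Gamma> (\<lambda>r. S r - S' r) (ZZ \<omega>) p = K (?q p) \<omega>" for p
      using elim by (blast intro: \<Gamma>_WW \<Gamma>_ZZ)+
    ultimately show ?case unfolding F_def F'_def v_def d_def by (simp add: fun_eq_iff)
  qed
  \<comment> \<open>The assumption on \<open>U\<close> read in one scenario: once the jumps are
    frozen, \<open>d\<close> is the deterministic convolution of a fixed square-integrable function,
    hence an admissible shift.\<close>
  have d_eq: "AE \<omega> in M. \<exists>u\<in>L2_space T. \<forall>p. d (ZZ \<omega>) p =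
      (LINT s:{0..?q p}|lborel. S' (?q p - s) (operator_sqrt Q (u s)))"
    using lim(4) shift AE_space
  proof eventually_elim
    case (elim \<omega>)
    have "d (ZZ \<omega>) p = (LINT s:{0..?q p}|lborel. S' (?q p - s) (operator_sqrt Q (U \<omega> s)))" for p
      using elim(2)[rule_format, OF q[of p]] \<Gamma>_ZZ[OF elim(1)[rule_format, of p]]
      unfolding d_def c_diff by simp
    then show ?case using U_L2[OF elim(3)] by blast
  qed
  have \<Gamma>_meas[measurable]: "(\<lambda>\<omega>. ?\<Gamma> S0 (WW \<omega>)) \<in> borel_measurable M" for S0 by measurable
  have meas: "(\<lambda>\<omega> p. N (?q p) \<omega>) \<in> borel_measurable M" if "cadlag_convolution M T S0 V N" for S0 V and N :: "real \<Rightarrow> 'w \<Rightarrow> 'h"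
  proof (rule measurable_coordinatewise_then_product)
    show "N (?q p) \<in> borel_measurable M" for p
      using that q[of p] unfolding cadlag_convolution_def has_stochastic_integral_def by blast
  qed
  have path: "sample_path {0..T} N \<in> measurable M (skorohod_borel T)" if "cadlag_convolution M T S0 V N" for S0 V and N :: "real \<Rightarrow> 'w \<Rightarrow> 'h"
    using that unfolding cadlag_convolution_def by blast
  have pr: "(\<lambda>x. N (fst x) p) \<in> borel_measurable (borel \<Otimes>\<^sub>M borel)"
    "(\<lambda>x. N (snd x) p) \<in> borel_measurable (borel \<Otimes>\<^sub>M borel)"
    if "N \<in> borel_measurable borel" for N :: "(nat \<times> nat \<Rightarrow> 'h) \<Rightarrow> nat \<times> nat \<Rightarrow> 'h" and p
    by (rule measurable_compose[OF measurable_compose[OF measurable_fst that] measurable_product_coordinates]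
        measurable_compose[OF measurable_compose[OF measurable_snd that] measurable_product_coordinates])+
  have F_m: "case_prod F \<in> measurable (borel \<Otimes>\<^sub>M borel) borel"
    and F'_m: "case_prod F' \<in> measurable (borel \<Otimes>\<^sub>M borel) borel"
    unfolding F_def F'_def v_def d_def split_beta
    by (intro measurable_coordinatewise_then_product borel_measurable_add borel_measurable_const pr
        grid_limit_measurable)+
  have FWZ_m: "(\<lambda>\<omega>. F (WW \<omega>) (ZZ \<omega>)) \<in> borel_measurable M" "(\<lambda>\<omega>. F' (WW \<omega>) (ZZ \<omega>)) \<in> borel_measurable M"
    using measurable_compose[OF measurable_Pair[OF indep_var_rv1[OF indWZ] indep_var_rv2[OF indWZ]] F_m]
      measurable_compose[OF measurable_Pair[OF indep_var_rv1[OF indWZ] indep_var_rv2[OF indWZ]] F'_m]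
    by simp_all
  have law: "distr M borel (\<lambda>\<omega> p. Y (?q p) \<omega>) = distr M borel (\<lambda>\<omega>. ?\<Gamma> S (WW \<omega>))"
    "distr M borel (\<lambda>\<omega> p. Y' (?q p) \<omega>) = distr M borel (\<lambda>\<omega>. ?\<Gamma> S' (WW \<omega>))"
    "distr M borel (\<lambda>\<omega> p. X (?q p) \<omega>) = distr M borel (\<lambda>\<omega>. F (WW \<omega>) (ZZ \<omega>))"
    "distr M borel (\<lambda>\<omega> p. X' (?q p) \<omega>) = distr M borel (\<lambda>\<omega>. F' (WW \<omega>) (ZZ \<omega>))"
    using repr assms(6,7,10,11) by (auto intro!: distr_AE_eq meas FWZ_m \<Gamma>_meas)
  have cm: "absolutely_continuous (distr M borel (\<lambda>\<omega>. ?\<Gamma> S' (WW \<omega>)))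
      (distr M borel (\<lambda>\<omega> p. ?\<Gamma> S' (WW \<omega>) p +
        (LINT s:{0..?q p}|lborel. S' (?q p - s) (operator_sqrt Q (u s)))))" if u: "u \<in> L2_space T" for u
    unfolding WW_def[abs_def]
  proof (rule ornstein_uhlenbeck_cameron_martin[OF \<open>prob_space M\<close> W Q T u S' r])
    show "AE \<omega> in M. \<forall>p. convergent
      (\<lambda>k. grid_sum T (\<lambda>t. S' (?q p - t)) p (r p k) (\<lambda>p. W (?q p) \<omega>))"
      using lim(2) unfolding P_def by eventually_elim (blast intro: convergentI)
  qed
  have translate_m: "(\<lambda>\<omega> p. ?\<Gamma> S0 (WW \<omega>) p + a p) \<in> borel_measurable M" for S0 a
    by (intro measurable_coordinatewise_then_product borel_measurable_add borel_measurable_const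
        measurable_compose[OF \<Gamma>_meas measurable_product_coordinates])
  \<comment> \<open>For frozen jumps the law of \<open>Y' + v\<close> is equivalent to that of
    \<open>Y' + v + d\<close>; it is the bridge between the two Gaussian laws.\<close>
  have F'_equiv: "AE \<omega> in M.
      absolutely_continuous (distr M borel (\<lambda>\<omega>'. F' (WW \<omega>') (ZZ \<omega>)))
        (distr M borel (\<lambda>\<omega>' p. ?\<Gamma> S' (WW \<omega>') p + (v (ZZ \<omega>) p + d (ZZ \<omega>) p))) \<and>
      absolutely_continuous (distr M borel (\<lambda>\<omega>' p. ?\<Gamma> S' (WW \<omega>') p + (v (ZZ \<omega>) p + d (ZZ \<omega>) p)))
        (distr M borel (\<lambda>\<omega>'. F' (WW \<omega>') (ZZ \<omega>)))"
    using d_eq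
  proof eventually_elim
    case (elim \<omega>)
    then obtain u where u: "u \<in> L2_space T"
      and du: "(\<lambda>p. LINT s:{0..?q p}|lborel. S' (?q p - s) (operator_sqrt Q (u s))) = d (ZZ \<omega>)"
      by (auto simp: fun_eq_iff)
    let ?a = "\<lambda>p. v (ZZ \<omega>) p + d (ZZ \<omega>) p"
    have "absolutely_continuous (distr M borel (\<lambda>\<omega>'. F' (WW \<omega>') (ZZ \<omega>)))
        (distr M borel (\<lambda>\<omega>' p. (?\<Gamma> S' (WW \<omega>') p + d (ZZ \<omega>) p) + v (ZZ \<omega>) p))"
      unfolding F'_def using cm[OF u] fun_cong[OF du]
      by (intro absolutely_continuous_distr_translate translate_m \<Gamma>_meas) simp
    \<comment> \<open>The reverse domination is the shift by the negative function, followed by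
      translation of both laws by \<open>v + d\<close>.\<close>
    moreover have "(LINT s:{0..t}|lborel. S' (t - s) (operator_sqrt Q (- u s))) =
        - (LINT s:{0..t}|lborel. S' (t - s) (operator_sqrt Q (u s)))" for t
      unfolding set_lebesgue_integral_def by (simp add: blinfun.minus_right)
    then have "absolutely_continuous (distr M borel (\<lambda>\<omega>'. ?\<Gamma> S' (WW \<omega>')))
        (distr M borel (\<lambda>\<omega>' p. ?\<Gamma> S' (WW \<omega>') p + (- d (ZZ \<omega>) p)))"
      using cm[OF uminus_L2_space[OF u]] fun_cong[OF du] by simp
    then have "absolutely_continuous (distr M borel (\<lambda>\<omega>' p. ?\<Gamma> S' (WW \<omega>') p + ?a p))
        (distr M borel (\<lambda>\<omega>' p. (?\<Gamma> S' (WW \<omega>') p + (- d (ZZ \<omega>) p)) + ?a p))"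
      by (intro absolutely_continuous_distr_translate translate_m \<Gamma>_meas)
    ultimately show ?case unfolding F'_def by (simp add: algebra_simps)
  qed
  \<comment> \<open>For frozen jumps the law of \<open>Y' + v\<close> dominates that of
    \<open>Y' + v + d\<close>, which dominates that of \<open>Y + v + d\<close> by translating the
    Gaussian hypothesis. The converse below runs the same chain backwards.\<close>
  have "absolutely_continuous (distr M borel (\<lambda>\<omega>. F' (WW \<omega>) (ZZ \<omega>))) (distr M borel (\<lambda>\<omega>. F (WW \<omega>) (ZZ \<omega>)))"
    if ac: "absolutely_continuous (distr M borel (\<lambda>\<omega>. ?\<Gamma> S' (WW \<omega>))) (distr M borel (\<lambda>\<omega>. ?\<Gamma> S (WW \<omega>)))"
    using F'_equiv
    by (intro mixture_absolutely_continuous[OF \<open>prob_space M\<close> indWZ F'_m F_m], eventually_elim)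
      (auto simp: F_def intro: absolutely_continuous_trans absolutely_continuous_distr_translate[OF ac \<Gamma>_meas \<Gamma>_meas])
  moreover have "absolutely_continuous (distr M borel (\<lambda>\<omega>. F (WW \<omega>) (ZZ \<omega>))) (distr M borel (\<lambda>\<omega>. F' (WW \<omega>) (ZZ \<omega>)))"
    if ac: "absolutely_continuous (distr M borel (\<lambda>\<omega>. ?\<Gamma> S (WW \<omega>))) (distr M borel (\<lambda>\<omega>. ?\<Gamma> S' (WW \<omega>)))"
    using F'_equiv
    by (intro mixture_absolutely_continuous[OF \<open>prob_space M\<close> indWZ F_m F'_m], eventually_elim)
      (auto simp: F_def intro: absolutely_continuous_trans absolutely_continuous_distr_translate[OF ac \<Gamma>_meas \<Gamma>_meas])
  ultimately show ?thesis
    using assms(13)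
    unfolding mutually_absolutely_continuous_def law
      skorohod_law_absolutely_continuous_iff[OF T path[OF assms(6)] path[OF assms(7)]]
      skorohod_law_absolutely_continuous_iff[OF T path[OF assms(7)] path[OF assms(6)]]
      skorohod_law_absolutely_continuous_iff[OF T path[OF assms(10)] path[OF assms(11)]]
      skorohod_law_absolutely_continuous_iff[OF T path[OF assms(11)] path[OF assms(10)]]
    by blast
qed

end
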